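(* Let $X$ be a geodesic vector field on a connected closed flat Riemannian $3$-manifold $M$. If $X$ is conformally Reeb for a contact form $\alpha$ on $M$, then the contact structure $\ker\tilde\alpha$ on $\mathbb{R}^3$, where $\tilde\alpha$ is the lift (pullback) of $\alpha$ to the universal cover $\mathbb{R}^3$ of $M$, is diffeomorphic to the standard contact structure $\ker(dz + x\,dy)$.
   Context: All objects are smooth. A vector field $X$ on a Riemannian manifold is geodesic if it has unit length and all its integral curves are geodesics. On a $3$-manifold a contact form is a $1$-form $\alpha$ with $\alpha\wedge d\alpha\neq 0$ everywhere, and $\ker\alpha$ is the contact structure it defines. Its Reeb vector field $R_\alpha$ is the unique vector field with $i_{R_\alpha}d\alpha=0$, $\alpha(R_\alpha)=1$. $X$ is conformally Reeb for $\alpha$ if $X=\lambda R_\alpha$ for some positive function $\lambda$. Two contact structures are diffeomorphic if there is a diffeomorphism whose differential maps one to the other. *)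

theory Defs
  imports "HOL-Analysis.Analysis"
begin

subsection \<open>Smooth maps between Euclidean spaces\<close>

text \<open>Meant for open \<open>S\<close>, where \<open>frechet_derivative\<close> at a point of \<open>S\<close> depends only on \<open>f\<close> on \<open>S\<close>.\<close>

fun Ck_on :: "nat \<Rightarrow> 'a::euclidean_space set \<Rightarrow> ('a \<Rightarrow> 'b::real_normed_vector) \<Rightarrow> bool" where
  "Ck_on 0 S f \<longleftrightarrow> continuous_on S f"
| "Ck_on (Suc k) S f \<longleftrightarrow>
     (\<forall>x\<in>S. f differentiable (at x)) \<and>
     (\<forall>v. Ck_on k S (\<lambda>x. frechet_derivative f (at x) v))"

definition smooth_on :: "'a::euclidean_space set \<Rightarrow> ('a \<Rightarrow> 'b::real_normed_vector) \<Rightarrow> bool" where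
  "smooth_on S f \<longleftrightarrow> (\<forall>k. Ck_on k S f)"

definition diffeomorphism :: "(real^3 \<Rightarrow> real^3) \<Rightarrow> bool" where
  "diffeomorphism f \<longleftrightarrow> bij f \<and> smooth_on UNIV f \<and> smooth_on UNIV (inv f)"


subsection \<open>Smooth 3-manifolds\<close>

text \<open>
  A manifold is a subset \<open>M\<close> of a Hausdorff second countable type, with the subspace topology,
  together with a smooth atlas (not required to be maximal). A chart is a pair \<open>(U, \<phi>)\<close>; the
  values of \<open>\<phi>\<close> outside \<open>U\<close> are irrelevant.
\<close>

type_synonym 'a chart = "'a set \<times> ('a \<Rightarrow> real^3)"

abbreviation cdom :: "'a chart \<Rightarrow> 'a set" where "cdom \<equiv> fst"
abbreviation cmap :: "'a chart \<Rightarrow> 'a \<Rightarrow> real^3" where "cmap \<equiv> snd"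

definition cran :: "'a chart \<Rightarrow> (real^3) set" where
  "cran c = cmap c ` cdom c"

definition cinv :: "'a chart \<Rightarrow> real^3 \<Rightarrow> 'a" where
  "cinv c = inv_into (cdom c) (cmap c)"

definition is_chart :: "'a::topological_space set \<Rightarrow> 'a chart \<Rightarrow> bool" where
  "is_chart M c \<longleftrightarrow> openin (top_of_set M) (cdom c) \<and> open (cran c) \<and>
     homeomorphism (cdom c) (cran c) (cmap c) (cinv c)"

definition overlap :: "'a chart \<Rightarrow> 'a chart \<Rightarrow> (real^3) set" where
  "overlap c d = cmap c ` (cdom c \<inter> cdom d)"

definition transition :: "'a chart \<Rightarrow> 'a chart \<Rightarrow> real^3 \<Rightarrow> real^3" where
  "transition c d = cmap d \<circ> cinv c"

definition smooth_manifold :: "'a::{t2_space,second_countable_topology} set \<Rightarrow> 'a chart set \<Rightarrow> bool" where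
  "smooth_manifold M A \<longleftrightarrow>
     (\<forall>c\<in>A. is_chart M c) \<and> (\<Union>c\<in>A. cdom c) = M \<and>
     (\<forall>c\<in>A. \<forall>d\<in>A. smooth_on (overlap c d) (transition c d))"

text \<open>
  \<open>c\<close> belongs to the maximal atlas generated by \<open>A\<close>; equivalently, \<open>c\<close> is a diffeomorphism from
  an open subset of \<open>M\<close> onto an open subset of Euclidean space.
\<close>

definition compatible_chart :: "'a::topological_space set \<Rightarrow> 'a chart set \<Rightarrow> 'a chart \<Rightarrow> bool" where
  "compatible_chart M A c \<longleftrightarrow> is_chart M c \<and>
     (\<forall>d\<in>A. smooth_on (overlap c d) (transition c d) \<and> smooth_on (overlap d c) (transition d c))"


subsection \<open>Tensor fields\<close>

text \<open>
  Tensor fields are given by their components in every chart of the atlas, as functions on the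
  chart image, subject to the transformation law of the respective type. Only the values at
  points of \<open>cran c\<close> for charts \<open>c\<close> of the atlas matter. The 1-form with components \<open>\<alpha> c\<close> is
  \<open>v \<mapsto> \<alpha> c x \<bullet> v\<close>.
\<close>

definition smooth_function :: "'a chart set \<Rightarrow> ('a \<Rightarrow> real) \<Rightarrow> bool" where
  "smooth_function A f \<longleftrightarrow> (\<forall>c\<in>A. smooth_on (cran c) (f \<circ> cinv c))"

definition vector_field :: "'a chart set \<Rightarrow> ('a chart \<Rightarrow> real^3 \<Rightarrow> real^3) \<Rightarrow> bool" where
  "vector_field A X \<longleftrightarrow>
     (\<forall>c\<in>A. smooth_on (cran c) (X c)) \<and>
     (\<forall>c\<in>A. \<forall>d\<in>A. \<forall>x\<in>overlap c d.
        X d (transition c d x) = frechet_derivative (transition c d) (at x) (X c x))"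

definition one_form :: "'a chart set \<Rightarrow> ('a chart \<Rightarrow> real^3 \<Rightarrow> real^3) \<Rightarrow> bool" where
  "one_form A \<alpha> \<longleftrightarrow>
     (\<forall>c\<in>A. smooth_on (cran c) (\<alpha> c)) \<and>
     (\<forall>c\<in>A. \<forall>d\<in>A. \<forall>x\<in>overlap c d. \<forall>v.
        \<alpha> c x \<bullet> v = \<alpha> d (transition c d x) \<bullet> frechet_derivative (transition c d) (at x) v)"

definition riemannian_metric :: "'a chart set \<Rightarrow> ('a chart \<Rightarrow> real^3 \<Rightarrow> real^3^3) \<Rightarrow> bool" where
  "riemannian_metric A g \<longleftrightarrow>
     (\<forall>c\<in>A. smooth_on (cran c) (g c)) \<and>
     (\<forall>c\<in>A. \<forall>x\<in>cran c. transpose (g c x) = g c x \<and> (\<forall>v. v \<noteq> 0 \<longrightarrow> v \<bullet> (g c x *v v) > 0)) \<and>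
     (\<forall>c\<in>A. \<forall>d\<in>A. \<forall>x\<in>overlap c d. \<forall>u v.
        u \<bullet> (g c x *v v) =
          frechet_derivative (transition c d) (at x) u \<bullet>
            (g d (transition c d x) *v frechet_derivative (transition c d) (at x) v))"


subsection \<open>Flat metrics and geodesic vector fields\<close>

text \<open>Flat means locally isometric to Euclidean space: \<open>c\<close> below is an isometry onto its image.\<close>

definition flat_metric ::
    "'a::topological_space set \<Rightarrow> 'a chart set \<Rightarrow> ('a chart \<Rightarrow> real^3 \<Rightarrow> real^3^3) \<Rightarrow> bool" where
  "flat_metric M A g \<longleftrightarrow>
     (\<forall>q\<in>M. \<exists>c. compatible_chart M A c \<and> q \<in> cdom c \<and>
        (\<forall>d\<in>A. \<forall>x\<in>overlap d c. \<forall>u v.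
           u \<bullet> (g d x *v v) =
             frechet_derivative (transition d c) (at x) u \<bullet>
             frechet_derivative (transition d c) (at x) v))"

definition partial :: "3 \<Rightarrow> (real^3 \<Rightarrow> real) \<Rightarrow> real^3 \<Rightarrow> real" where
  "partial i f x = frechet_derivative f (at x) (axis i 1)"

definition christoffel :: "(real^3 \<Rightarrow> real^3^3) \<Rightarrow> real^3 \<Rightarrow> 3 \<Rightarrow> 3 \<Rightarrow> 3 \<Rightarrow> real" where
  "christoffel G x k i j =
     (1/2) * (\<Sum>l\<in>UNIV. matrix_inv (G x) $ k $ l *
       (partial i (\<lambda>y. G y $ j $ l) x + partial j (\<lambda>y. G y $ i $ l) x - partial l (\<lambda>y. G y $ i $ j) x))"

definition smooth_curve ::
    "'a::topological_space set \<Rightarrow> 'a chart set \<Rightarrow> real set \<Rightarrow> (real \<Rightarrow> 'a) \<Rightarrow> bool" where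
  "smooth_curve M A T \<gamma> \<longleftrightarrow> continuous_on T \<gamma> \<and> \<gamma> ` T \<subseteq> M \<and>
     (\<forall>c\<in>A. smooth_on {t\<in>T. \<gamma> t \<in> cdom c} (cmap c \<circ> \<gamma>))"

definition geodesic ::
    "'a::topological_space set \<Rightarrow> 'a chart set \<Rightarrow> ('a chart \<Rightarrow> real^3 \<Rightarrow> real^3^3) \<Rightarrow>
     real set \<Rightarrow> (real \<Rightarrow> 'a) \<Rightarrow> bool" where
  "geodesic M A g T \<gamma> \<longleftrightarrow> smooth_curve M A T \<gamma> \<and>
     (\<forall>c\<in>A. \<forall>t\<in>T. \<gamma> t \<in> cdom c \<longrightarrow>
        (let y = cmap c \<circ> \<gamma>;
             y' = (\<lambda>s. vector_derivative y (at s));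
             y'' = (\<lambda>s. vector_derivative y' (at s))
         in \<forall>k. y'' t $ k +
              (\<Sum>i\<in>UNIV. \<Sum>j\<in>UNIV. christoffel (g c) (y t) k i j * y' t $ i * y' t $ j) = 0))"

definition integral_curve ::
    "'a::topological_space set \<Rightarrow> 'a chart set \<Rightarrow> ('a chart \<Rightarrow> real^3 \<Rightarrow> real^3) \<Rightarrow>
     real set \<Rightarrow> (real \<Rightarrow> 'a) \<Rightarrow> bool" where
  "integral_curve M A X T \<gamma> \<longleftrightarrow> smooth_curve M A T \<gamma> \<and>
     (\<forall>c\<in>A. \<forall>t\<in>T. \<gamma> t \<in> cdom c \<longrightarrow>
        ((cmap c \<circ> \<gamma>) has_vector_derivative X c (cmap c (\<gamma> t))) (at t))"

definition geodesic_vector_field ::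
    "'a::topological_space set \<Rightarrow> 'a chart set \<Rightarrow> ('a chart \<Rightarrow> real^3 \<Rightarrow> real^3^3) \<Rightarrow>
     ('a chart \<Rightarrow> real^3 \<Rightarrow> real^3) \<Rightarrow> bool" where
  "geodesic_vector_field M A g X \<longleftrightarrow> vector_field A X \<and>
     (\<forall>c\<in>A. \<forall>x\<in>cran c. X c x \<bullet> (g c x *v X c x) = 1) \<and>
     (\<forall>T \<gamma>. open T \<longrightarrow> is_interval T \<longrightarrow> integral_curve M A X T \<gamma> \<longrightarrow> geodesic M A g T \<gamma>)"


subsection \<open>Contact forms and Reeb vector fields\<close>

definition ext_deriv :: "(real^3 \<Rightarrow> real^3) \<Rightarrow> real^3 \<Rightarrow> real^3 \<Rightarrow> real^3 \<Rightarrow> real" where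
  "ext_deriv \<omega> x u v =
     frechet_derivative \<omega> (at x) u \<bullet> v - frechet_derivative \<omega> (at x) v \<bullet> u"

text \<open>The 3-form \<open>\<omega> \<and> d\<omega>\<close>.\<close>

definition wedge_ext_deriv :: "(real^3 \<Rightarrow> real^3) \<Rightarrow> real^3 \<Rightarrow> real^3 \<Rightarrow> real^3 \<Rightarrow> real^3 \<Rightarrow> real" where
  "wedge_ext_deriv \<omega> x u v w =
     (\<omega> x \<bullet> u) * ext_deriv \<omega> x v w + (\<omega> x \<bullet> v) * ext_deriv \<omega> x w u + (\<omega> x \<bullet> w) * ext_deriv \<omega> x u v"

definition contact_form :: "'a chart set \<Rightarrow> ('a chart \<Rightarrow> real^3 \<Rightarrow> real^3) \<Rightarrow> bool" where
  "contact_form A \<alpha> \<longleftrightarrow> one_form A \<alpha> \<and>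
     (\<forall>c\<in>A. \<forall>x\<in>cran c. \<exists>u v w. wedge_ext_deriv (\<alpha> c) x u v w \<noteq> 0)"

definition reeb_field ::
    "'a chart set \<Rightarrow> ('a chart \<Rightarrow> real^3 \<Rightarrow> real^3) \<Rightarrow> ('a chart \<Rightarrow> real^3 \<Rightarrow> real^3) \<Rightarrow> bool" where
  "reeb_field A \<alpha> R \<longleftrightarrow> vector_field A R \<and>
     (\<forall>c\<in>A. \<forall>x\<in>cran c. (\<forall>v. ext_deriv (\<alpha> c) x (R c x) v = 0) \<and> \<alpha> c x \<bullet> R c x = 1)"

definition conformally_reeb ::
    "'a set \<Rightarrow> 'a chart set \<Rightarrow> ('a chart \<Rightarrow> real^3 \<Rightarrow> real^3) \<Rightarrow> ('a chart \<Rightarrow> real^3 \<Rightarrow> real^3) \<Rightarrow> bool" where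
  "conformally_reeb M A \<alpha> X \<longleftrightarrow>
     (\<exists>R f. reeb_field A \<alpha> R \<and> smooth_function A f \<and> (\<forall>q\<in>M. f q > 0) \<and>
        (\<forall>c\<in>A. \<forall>x\<in>cran c. X c x = f (cinv c x) *\<^sub>R R c x))"


subsection \<open>The universal cover and contact structures on Euclidean space\<close>

text \<open>
  A smooth covering map: a covering map that is a local diffeomorphism, that is, near every point
  it has a local inverse which is a chart of the maximal atlas. Since \<open>real^3\<close> is simply
  connected, such a map is a universal covering.
\<close>

definition smooth_covering :: "'a::topological_space set \<Rightarrow> 'a chart set \<Rightarrow> (real^3 \<Rightarrow> 'a) \<Rightarrow> bool" where
  "smooth_covering M A p \<longleftrightarrow> covering_space UNIV p M \<and>
     (\<forall>x. \<exists>V. open V \<and> x \<in> V \<and> inj_on p V \<and> compatible_chart M A (p ` V, inv_into V p))"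

text \<open>
  The pullback \<open>p\<^sup>*\<alpha>\<close>, as a covector field. By the transformation law of 1-forms, the value does
  not depend on the chart chosen around \<open>p x\<close>.
\<close>

definition pullback_form ::
    "'a chart set \<Rightarrow> (real^3 \<Rightarrow> 'a) \<Rightarrow> ('a chart \<Rightarrow> real^3 \<Rightarrow> real^3) \<Rightarrow> real^3 \<Rightarrow> real^3" where
  "pullback_form A p \<alpha> x =
     (let c = (SOME c. c \<in> A \<and> p x \<in> cdom c)
      in \<chi> i. \<alpha> c (cmap c (p x)) \<bullet> frechet_derivative (cmap c \<circ> p) (at x) (axis i 1))"

definition ker_form :: "(real^3 \<Rightarrow> real^3) \<Rightarrow> real^3 \<Rightarrow> (real^3) set" where
  "ker_form \<omega> x = {v. \<omega> x \<bullet> v = 0}"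

text \<open>The form \<open>dz + x dy\<close>, with coordinates \<open>(x, y, z) = (q $ 1, q $ 2, q $ 3)\<close>.\<close>

definition std_contact_form :: "real^3 \<Rightarrow> real^3" where
  "std_contact_form q = vector [0, q $ 1, 1]"

definition diffeomorphic_structures ::
    "(real^3 \<Rightarrow> (real^3) set) \<Rightarrow> (real^3 \<Rightarrow> (real^3) set) \<Rightarrow> bool" where
  "diffeomorphic_structures \<xi> \<eta> \<longleftrightarrow>
     (\<exists>f. diffeomorphism f \<and> (\<forall>x. frechet_derivative f (at x) ` \<xi> x = \<eta> (f x)))"

end

theory Submission
  imports Defs
begin

text \<open>
  The developing map of the flat metric identifies the universal cover isometrically with Euclidean
  3-space \<open>E\<close>. On \<open>E\<close> the integral curves of \<open>X\<close> are straight lines, and by compactness of \<open>M\<close> all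
  geometric quantities built from \<open>X\<close> and \<open>\<alpha>\<close> are bounded. As \<open>i\<^sub>X d\<alpha> = 0\<close>, the 2-form \<open>d\<alpha>\<close> is
  invariant under the flow \<open>q \<mapsto> q + t X(q)\<close>, so \<open>det (1 + t DX)\<close> is bounded in \<open>t\<close>; hence
  \<open>(DX)\<^sup>2 = 0\<close>, and \<open>X\<close> turns out to be constant along the planes orthogonal to some fixed unit
  vector \<open>n\<close> and tangent to them. On each such plane \<open>\<alpha>\<close> is closed. Let \<open>W\<close> be its primitive vanishing
  on the axis spanned by \<open>n\<close>, and put \<open>x = (\<alpha> - dW)(n)\<close> and \<open>y = \<langle>q, n\<rangle>\<close>. Then \<open>\<alpha> = dW + x dy\<close>,
  and uniform lower bounds for \<open>\<alpha>(X)\<close> and \<open>d\<alpha>\<close> make \<open>(x, y, W)\<close> a global diffeomorphism.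
\<close>

subsection \<open>Smooth calculus\<close>

text \<open>Compactness of \<open>M\<close> enters twice. First it gives completeness: a developing
  map is only a local isometry, and finitely many neighbourhoods provide local inverses on balls of
  one radius, which make it a covering and then a bijection. Second, it gives uniformity: quantities
  invariant under the changes of sheets are bounded, and bounded away from zero where they do not
  vanish. Without the lower bounds the final coordinates could fail to be onto; with them they are
  monotone along suitable lines, with slope bounded away from zero.

  The step from \<open>(DX)\<^sup>2 = 0\<close> to planes rests on
  \<open>X (q + s DX(q) v) = X q\<close>. Where \<open>DX\<close> is nonzero this yields one full
  plane on which \<open>X\<close> is constant. A line of the field transversal to this plane would
  meet it, and two non-parallel lines in a parallel plane would meet each other; both are
  impossible, since \<open>X\<close> is constant along its lines.

  The hypothesis on \<open>X\<close> speaks of integral curves in charts. Local existence of such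
  curves and Koszul's formula turn it into the equation \<open>DX(X) = 0\<close> in Euclidean
  coordinates.\<close>

abbreviation fd :: "('a::euclidean_space \<Rightarrow> 'b::real_normed_vector) \<Rightarrow> 'a \<Rightarrow> 'a \<Rightarrow> 'b"
  where "fd f x \<equiv> frechet_derivative f (at x)"

lemma fd_eqI: "(f has_derivative f') (at x) \<Longrightarrow> fd f x v = f' v"
  using frechet_derivative_at by metis

lemma fd_cong:
  assumes "open S" "x \<in> S" "\<And>y. y \<in> S \<Longrightarrow> f y = g y"
  shows "fd f x = fd g x"
proof -
  have "(f has_derivative h) (at x) \<longleftrightarrow> (g has_derivative h) (at x)" for h
    using has_derivative_transform_within_open[of f h x UNIV S g]
      has_derivative_transform_within_open[of g h x UNIV S f] assms by auto
  then show ?thesis by (simp add: frechet_derivative_def)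
qed

lemma differentiable_cong_open:
  assumes "open S" "x \<in> S" "\<And>y. y \<in> S \<Longrightarrow> f y = g y" "f differentiable (at x)"
  shows "g differentiable (at x)"
  using assms has_derivative_transform_within_open[of f _ x UNIV S g] unfolding differentiable_def by metis

lemma Ck_on_cong_imp:
  assumes "open S" "\<And>x. x \<in> S \<Longrightarrow> f x = g x" "Ck_on k S f"
  shows "Ck_on k S g"
  using assms(2,3)
proof (induction k arbitrary: f g)
  case 0
  then show ?case by (auto intro: continuous_on_eq)
next
  case (Suc k)
  have "Ck_on k S (\<lambda>x. fd g x v)" for v
    by (rule Suc.IH[of "\<lambda>x. fd f x v"]) (use Suc.prems fd_cong[OF assms(1), of _ f g] in auto)
  then show ?case
    using Suc.prems differentiable_cong_open[OF assms(1), of _ f g] by auto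
qed

lemma Ck_on_subset: "Ck_on k S f \<Longrightarrow> T \<subseteq> S \<Longrightarrow> Ck_on k T f"
  by (induction k arbitrary: f) (auto intro: continuous_on_subset)

lemma Ck_on_Suc_imp: "Ck_on (Suc k) S f \<Longrightarrow> Ck_on k S f"
proof (induction k arbitrary: f)
  case 0
  then show ?case
    by (auto intro!: continuous_at_imp_continuous_on dest!: bspec differentiable_imp_continuous_within)
next
  case (Suc k)
  then show ?case by (metis Ck_on.simps(2))
qed

lemma Ck_on_local:
  assumes "\<And>x. x \<in> S \<Longrightarrow> \<exists>T. open T \<and> x \<in> T \<and> Ck_on k T f"
  shows "Ck_on k S f"
  using assms
proof (induction k arbitrary: f)
  case 0
  then show ?case
    by (meson Ck_on.simps(1) continuous_at_imp_continuous_on continuous_on_eq_continuous_at)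
next
  case (Suc k)
  have "Ck_on k S (\<lambda>x. fd f x v)" for v
    by (rule Suc.IH) (use Suc.prems in fastforce)
  moreover have "f differentiable at x" if "x \<in> S" for x using Suc.prems that by fastforce
  ultimately show ?case by simp
qed

lemma Ck_on_const [simp]: "Ck_on k S (\<lambda>x. c)"
  by (induction k arbitrary: c) auto

text \<open>The inductive step of the closure properties: the chosen derivative is replaced by an
  explicit one from the usual rules, and only the regularity of that expression remains to be
  shown.\<close>

lemma Ck_on_SucI:
  assumes "open S" "\<And>x. x \<in> S \<Longrightarrow> (f has_derivative f' x) (at x)" "\<And>v. Ck_on k S (\<lambda>x. f' x v)"
  shows "Ck_on (Suc k) S f"
proof -
  have "Ck_on k S (\<lambda>x. fd f x v)" for v
    by (rule Ck_on_cong_imp[OF assms(1) _ assms(3)[of v]]) (metis fd_eqI assms(2))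
  then show ?thesis using assms(2) by (auto simp: differentiable_def)
qed

lemma Ck_on_SucD:
  assumes "Ck_on (Suc k) S f" "x \<in> S"
  shows "(f has_derivative fd f x) (at x)"
  using assms frechet_derivative_works by auto

lemma Ck_on_bounded_linear:
  assumes "open S" "bounded_linear L" "Ck_on k S f"
  shows "Ck_on k S (\<lambda>x. L (f x))"
proof -
  interpret bounded_linear L by fact
  show ?thesis using assms(3)
  proof (induction k arbitrary: f)
    case 0
    then show ?case by (simp add: continuous_on)
  next
    case (Suc k)
    show ?case
      by (rule Ck_on_SucI[OF assms(1) has_derivative[OF Ck_on_SucD[OF Suc.prems]]])
         (use Suc in auto)
  qed
qed

lemma Ck_on_add:
  assumes "open S" "Ck_on k S f" "Ck_on k S g"
  shows "Ck_on k S (\<lambda>x. f x + g x)"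
  using assms(2,3)
proof (induction k arbitrary: f g)
  case 0
  then show ?case by (auto intro: continuous_intros)
next
  case (Suc k)
  show ?case
    by (rule Ck_on_SucI[OF assms(1) has_derivative_add[OF Ck_on_SucD[OF Suc.prems(1)] Ck_on_SucD[OF Suc.prems(2)]]])
       (use Suc in auto)
qed

lemma Ck_on_sum:
  assumes "open S" "\<And>i. i \<in> I \<Longrightarrow> Ck_on k S (f i)"
  shows "Ck_on k S (\<lambda>x. \<Sum>i\<in>I. f i x)"
  using assms(2) by (induction I rule: infinite_finite_induct) (auto intro: Ck_on_add[OF assms(1)])

lemma Ck_on_bilinear:
  assumes "open S" "bounded_bilinear b" "Ck_on k S f" "Ck_on k S g"
  shows "Ck_on k S (\<lambda>x. b (f x) (g x))"
proof -
  interpret bounded_bilinear b by fact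
  show ?thesis using assms(3,4)
  proof (induction k arbitrary: f g)
    case 0
    then show ?case by (auto intro: continuous_on)
  next
    case (Suc k)
    \<comment> \<open>The product rule keeps one factor undifferentiated, so the induction
      hypothesis is also applied to \<open>f\<close> and \<open>g\<close> themselves, one order
      lower.\<close>
    have *: "Ck_on k S f" "Ck_on k S g" using Suc.prems Ck_on_Suc_imp by blast+
    show ?case
      by (rule Ck_on_SucI[OF assms(1) FDERIV[OF Ck_on_SucD[OF Suc.prems(1)] Ck_on_SucD[OF Suc.prems(2)]]])
         (use Suc * in \<open>auto intro!: Ck_on_add[OF assms(1)]\<close>)
  qed
qed

lemma linear_sum_Basis:
  fixes L :: "'a::euclidean_space \<Rightarrow> 'b::real_vector"
  assumes "linear L"
  shows "L v = (\<Sum>b\<in>Basis. (v \<bullet> b) *\<^sub>R L b)"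
proof -
  have "L v = L (\<Sum>b\<in>Basis. (v \<bullet> b) *\<^sub>R b)" by (simp add: euclidean_representation)
  also have "\<dots> = (\<Sum>b\<in>Basis. (v \<bullet> b) *\<^sub>R L b)"
    using assms by (simp add: linear_sum linear_cmul)
  finally show ?thesis .
qed

lemma Ck_on_compose:
  fixes g :: "'a::euclidean_space \<Rightarrow> 'b::euclidean_space" and f :: "'b \<Rightarrow> 'c::real_normed_vector"
  assumes "open S" "open T" "g ` S \<subseteq> T" "Ck_on k T f" "Ck_on k S g"
  shows "Ck_on k S (\<lambda>x. f (g x))"
  using assms(4,5)
proof (induction k arbitrary: f)
  case 0
  then show ?case using assms(3) by (auto intro: continuous_on_compose2)
next
  case (Suc k)
  have gT: "x \<in> S \<Longrightarrow> g x \<in> T" for x using assms(3) by blast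
  have der: "((\<lambda>x. f (g x)) has_derivative (\<lambda>v. fd f (g x) (fd g x v))) (at x)" if "x \<in> S" for x
    using diff_chain_at[OF Ck_on_SucD[OF Suc.prems(2) that] Ck_on_SucD[OF Suc.prems(1) gT[OF that]]]
    by (simp add: o_def)
  \<comment> \<open>\<open>Ck_on\<close> controls derivatives in fixed directions only, while the
    chain rule has the moving direction \<open>fd g x v\<close>. Expansion in the basis turns the
    expression into a sum of products.\<close>
  have eq: "fd f (g x) w = (\<Sum>b\<in>Basis. (w \<bullet> b) *\<^sub>R fd f (g x) b)" if "x \<in> S" for x w
    by (rule linear_sum_Basis) (use Suc.prems gT that in \<open>auto intro: linear_frechet_derivative\<close>)
  have *: "Ck_on k S (\<lambda>x. \<Sum>b\<in>Basis. (fd g x v \<bullet> b) *\<^sub>R fd f (g x) b)" for v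
    by (intro Ck_on_sum Ck_on_bilinear[OF _ bounded_bilinear_scaleR] Ck_on_bounded_linear[OF _ bounded_linear_inner_left] Suc.IH assms)
       (use Suc.prems Ck_on_Suc_imp in auto)
  have "Ck_on k S (\<lambda>x. fd f (g x) (fd g x v))" for v
    by (rule Ck_on_cong_imp[OF assms(1) _ *[of v]]) (simp add: eq)
  then show ?case using Ck_on_SucI[OF assms(1) der] by blast
qed

lemma smooth_onD: "smooth_on S f \<Longrightarrow> Ck_on k S f" by (simp add: smooth_on_def)

lemma smooth_on_cong:
  assumes "smooth_on S f" "open S" "\<And>x. x \<in> S \<Longrightarrow> g x = f x"
  shows "smooth_on S g"
  using assms Ck_on_cong_imp[of S f g] by (simp add: smooth_on_def)

lemma smooth_on_subset: "smooth_on S f \<Longrightarrow> T \<subseteq> S \<Longrightarrow> smooth_on T f"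
  unfolding smooth_on_def by (blast intro: Ck_on_subset)

lemma smooth_on_local:
  assumes "\<And>x. x \<in> S \<Longrightarrow> \<exists>T. open T \<and> x \<in> T \<and> smooth_on T f"
  shows "smooth_on S f"
  unfolding smooth_on_def using Ck_on_local assms smooth_onD by metis

lemma smooth_on_continuous: "smooth_on S f \<Longrightarrow> continuous_on S f"
  using smooth_onD[of S f 0] by simp

lemma smooth_on_fd: "smooth_on S f \<Longrightarrow> smooth_on S (\<lambda>x. fd f x v)"
  unfolding smooth_on_def by (metis Ck_on.simps(2))

lemma smooth_on_has_derivative: "smooth_on S f \<Longrightarrow> x \<in> S \<Longrightarrow> (f has_derivative fd f x) (at x)"
  using Ck_on_SucD smooth_onD by blast

lemma smooth_on_linear_fd: "smooth_on S f \<Longrightarrow> x \<in> S \<Longrightarrow> linear (fd f x)"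
  using smooth_on_has_derivative has_derivative_linear by blast

lemma smooth_on_const [simp]: "smooth_on S (\<lambda>x. c)"
  by (simp add: smooth_on_def)

lemma smooth_on_bounded_linear:
  "open S \<Longrightarrow> bounded_linear L \<Longrightarrow> smooth_on S f \<Longrightarrow> smooth_on S (\<lambda>x. L (f x))"
  by (simp add: smooth_on_def Ck_on_bounded_linear)

lemma smooth_on_ident [simp]: "smooth_on S (\<lambda>x. x)"
proof -
  have "Ck_on k UNIV (\<lambda>x::'a. x)" for k
    by (cases k) (auto intro: Ck_on_SucI[of _ _ "\<lambda>x v. v"])
  then show ?thesis unfolding smooth_on_def by (blast intro: Ck_on_subset)
qed

lemma smooth_on_linear: "linear L \<Longrightarrow> smooth_on S (L :: 'a::euclidean_space \<Rightarrow> 'b::real_normed_vector)"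
  using smooth_on_bounded_linear[of UNIV L "\<lambda>x. x"] linear_conv_bounded_linear smooth_on_subset
  by (metis open_UNIV smooth_on_ident subset_UNIV)

lemma smooth_on_add: "open S \<Longrightarrow> smooth_on S f \<Longrightarrow> smooth_on S g \<Longrightarrow> smooth_on S (\<lambda>x. f x + g x)"
  by (simp add: smooth_on_def Ck_on_add)

lemma smooth_on_sum: "open S \<Longrightarrow> (\<And>i. i \<in> I \<Longrightarrow> smooth_on S (f i)) \<Longrightarrow> smooth_on S (\<lambda>x. \<Sum>i\<in>I. f i x)"
  by (simp add: smooth_on_def Ck_on_sum)

lemma smooth_on_bilinear:
  "open S \<Longrightarrow> bounded_bilinear b \<Longrightarrow> smooth_on S f \<Longrightarrow> smooth_on S g \<Longrightarrow> smooth_on S (\<lambda>x. b (f x) (g x))"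
  by (simp add: smooth_on_def Ck_on_bilinear)

lemmas smooth_on_scaleR = smooth_on_bilinear[OF _ bounded_bilinear_scaleR]
lemmas smooth_on_inner = smooth_on_bilinear[OF _ bounded_bilinear_inner]

lemma smooth_on_minus: "open S \<Longrightarrow> smooth_on S f \<Longrightarrow> smooth_on S (\<lambda>x. - f x)"
  by (rule smooth_on_bounded_linear[OF _ bounded_linear_minus[OF bounded_linear_ident]])

lemma smooth_on_diff: "open S \<Longrightarrow> smooth_on S f \<Longrightarrow> smooth_on S g \<Longrightarrow> smooth_on S (\<lambda>x. f x - g x)"
  using smooth_on_add[of S f "\<lambda>x. - g x"] smooth_on_minus by auto

lemma smooth_on_compose:
  fixes g :: "'a::euclidean_space \<Rightarrow> 'b::euclidean_space" and f :: "'b \<Rightarrow> 'c::real_normed_vector"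
  shows "smooth_on T f \<Longrightarrow> smooth_on S g \<Longrightarrow> open S \<Longrightarrow> open T \<Longrightarrow> g ` S \<subseteq> T \<Longrightarrow> smooth_on S (\<lambda>x. f (g x))"
  by (simp add: smooth_on_def Ck_on_compose)

text \<open>The derivative of \<open>1 / f\<close> contains only \<open>1 / f\<close> and the
  derivative of \<open>f\<close>, so each order of regularity of \<open>1 / f\<close> yields the
  next one.\<close>

lemma smooth_on_inverse:
  fixes f :: "'a::euclidean_space \<Rightarrow> real"
  assumes "open S" "smooth_on S f" "\<And>x. x \<in> S \<Longrightarrow> f x \<noteq> 0"
  shows "smooth_on S (\<lambda>x. inverse (f x))"
proof -
  have "Ck_on k S (\<lambda>x. inverse (f x))" for k
  proof (induction k)
    case 0
    then show ?case using assms(3) smooth_on_continuous[OF assms(2)] by (auto intro!: continuous_intros)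
  next
    case (Suc k)
    show ?case
    proof (rule Ck_on_SucI[OF assms(1)])
      fix x assume x: "x \<in> S"
      show "((\<lambda>x. inverse (f x)) has_derivative (\<lambda>v. - (inverse (f x) * fd f x v * inverse (f x)))) (at x)"
        by (rule Deriv.has_derivative_inverse[OF assms(3)[OF x] smooth_on_has_derivative[OF assms(2) x]])
    next
      fix v
      show "Ck_on k S (\<lambda>x. - (inverse (f x) * fd f x v * inverse (f x)))"
        by (intro Ck_on_bounded_linear[OF assms(1) bounded_linear_minus[OF bounded_linear_ident]]
            Ck_on_bilinear[OF assms(1) bounded_bilinear_mult] Suc smooth_onD smooth_on_fd assms)
    qed
  qed
  then show ?thesis by (simp add: smooth_on_def)
qed

lemma smooth_on_fd_apply:
  fixes w :: "'a::euclidean_space \<Rightarrow> 'a"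
  assumes "open S" "smooth_on S f" "smooth_on S w"
  shows "smooth_on S (\<lambda>x. fd f x (w x))"
proof (rule smooth_on_cong[OF _ assms(1)])
  show "smooth_on S (\<lambda>x. \<Sum>b\<in>Basis. (w x \<bullet> b) *\<^sub>R fd f x b)"
    using assms by (intro smooth_on_sum smooth_on_scaleR smooth_on_inner smooth_on_fd) auto
  show "fd f x (w x) = (\<Sum>b\<in>Basis. (w x \<bullet> b) *\<^sub>R fd f x b)" if "x \<in> S" for x
    by (intro linear_sum_Basis smooth_on_linear_fd[OF assms(2) that])
qed

lemma smooth_on_vec_lambda:
  fixes f :: "'a::euclidean_space \<Rightarrow> 'n::finite \<Rightarrow> 'b::real_normed_vector"
  assumes "open S" "\<And>i. smooth_on S (\<lambda>x. f x i)"
  shows "smooth_on S (\<lambda>x. \<chi> i. f x i)"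
proof -
  have lin: "bounded_linear (\<lambda>z::'b. (\<chi> j. if j = i then z else 0))" for i :: 'n
  proof (rule bounded_linear_intro[where K=1])
    show "norm (\<chi> j. if j = i then z else 0) \<le> norm z * 1" for z :: 'b
    proof -
      have "(\<chi> j. if j = i then z else 0) = axis i z" by (simp add: axis_def vec_eq_iff)
      moreover have "norm (axis i z) = norm z"
        by (simp add: norm_vec_def L2_set_def axis_def if_distrib[of "\<lambda>t. (norm t)\<^sup>2"] cong: if_cong)
      ultimately show ?thesis by simp
    qed
  qed (auto simp: vec_eq_iff)
  have "(\<lambda>x. \<chi> i. f x i) = (\<lambda>x. \<Sum>i\<in>UNIV. (\<chi> j. if j = i then f x i else 0))"
    by (auto simp: vec_eq_iff fun_eq_iff if_distrib cong: if_cong)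
  then show ?thesis using assms lin
    by (auto intro!: smooth_on_sum smooth_on_bounded_linear[where L="\<lambda>z. (\<chi> j. if j = _ then z else 0)"])
qed

lemma smooth_on_nth:
  "open S \<Longrightarrow> smooth_on S f \<Longrightarrow> smooth_on S (\<lambda>x. f x $ i)"
  by (rule smooth_on_bounded_linear[OF _ bounded_linear_vec_nth])

lemma smooth_on_vec_iff:
  assumes "open S"
  shows "smooth_on S (f :: 'a::euclidean_space \<Rightarrow> 'b::real_normed_vector^'n) \<longleftrightarrow> (\<forall>i. smooth_on S (\<lambda>x. f x $ i))"
  using smooth_on_vec_lambda[OF assms, of "\<lambda>x i. f x $ i"] smooth_on_nth[OF assms] by auto

text \<open>The form in which \<open>inverse_function_theorem\<close> expects a continuous
  derivative; for a finite-dimensional domain the basis vectors can be checked one by one.\<close>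

lemma fd_continuous_blinfun:
  fixes f :: "'a::euclidean_space \<Rightarrow> 'b::euclidean_space"
  assumes "open S" "smooth_on S f"
  shows "continuous_on S (\<lambda>x. Blinfun (fd f x))"
proof (rule continuous_on_blinfun_componentwise)
  fix i :: 'a
  have "blinfun_apply (Blinfun (fd f x)) i = fd f x i" if "x \<in> S" for x
    using smooth_on_has_derivative[OF assms(2) that] by (simp add: bounded_linear_Blinfun_apply has_derivative_bounded_linear)
  then show "continuous_on S (\<lambda>x. blinfun_apply (Blinfun (fd f x)) i)"
    using smooth_on_continuous[OF smooth_on_fd[OF assms(2), of i]] by (simp cong: continuous_on_cong)
qed

lemma has_vector_derivative_line:
  assumes "(f has_derivative f') (at (a + t *\<^sub>R v))"
  shows "((\<lambda>t. f (a + t *\<^sub>R v)) has_vector_derivative f' v) (at t)"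
proof -
  have "((\<lambda>t. a + t *\<^sub>R v) has_derivative (\<lambda>k. k *\<^sub>R v)) (at t)"
    by (auto intro!: derivative_eq_intros)
  from diff_chain_at[OF this assms] show ?thesis
    using linear_cmul[OF has_derivative_linear[OF assms]] by (simp add: has_vector_derivative_def o_def)
qed

text \<open>The second difference of \<open>f\<close> along \<open>u\<close> and \<open>v\<close> is, by two applications of the mean value
  theorem, a value of either mixed derivative.\<close>

lemma second_difference_mvt:
  fixes f :: "'a::euclidean_space \<Rightarrow> real"
  assumes "smooth_on S f" "h > 0" "\<And>s t. 0 \<le> s \<Longrightarrow> s \<le> h \<Longrightarrow> 0 \<le> t \<Longrightarrow> t \<le> h \<Longrightarrow> x + s *\<^sub>R u + t *\<^sub>R v \<in> S"
  obtains s t where "0 < s" "s < h" "0 < t" "t < h"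
    "f (x + h *\<^sub>R u + h *\<^sub>R v) - f (x + h *\<^sub>R u) - f (x + h *\<^sub>R v) + f x
       = h * (h * fd (\<lambda>y. fd f y u) (x + s *\<^sub>R u + t *\<^sub>R v) v)"
proof -
  define \<phi> where "\<phi> s = f (x + s *\<^sub>R u + h *\<^sub>R v) - f (x + s *\<^sub>R u + 0 *\<^sub>R v)" for s
  have d1: "((\<lambda>s. f (x + s *\<^sub>R u + t *\<^sub>R v)) has_field_derivative fd f (x + s *\<^sub>R u + t *\<^sub>R v) u) (at s)"
    if "0 \<le> s" "s \<le> h" "0 \<le> t" "t \<le> h" for s t
    using has_vector_derivative_line[of f _ "x + t *\<^sub>R v" s u] smooth_on_has_derivative[OF assms(1) assms(3)[OF that]]
    by (simp add: has_real_derivative_iff_has_vector_derivative add_ac)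
  have d2: "((\<lambda>t. fd f (x + s *\<^sub>R u + t *\<^sub>R v) u) has_field_derivative fd (\<lambda>y. fd f y u) (x + s *\<^sub>R u + t *\<^sub>R v) v) (at t)"
    if "0 \<le> s" "s \<le> h" "0 \<le> t" "t \<le> h" for s t
    using has_vector_derivative_line[OF smooth_on_has_derivative[OF smooth_on_fd[OF assms(1), of u] assms(3)[OF that]]]
    by (simp add: has_real_derivative_iff_has_vector_derivative)
  have "\<exists>s. 0 < s \<and> s < h \<and> \<phi> h - \<phi> 0 = (h - 0) * (fd f (x + s *\<^sub>R u + h *\<^sub>R v) u - fd f (x + s *\<^sub>R u + 0 *\<^sub>R v) u)"
    unfolding \<phi>_def using assms(2) by (intro MVT2 DERIV_diff d1) auto
  then obtain s where s: "0 < s" "s < h" "\<phi> h - \<phi> 0 = h * (fd f (x + s *\<^sub>R u + h *\<^sub>R v) u - fd f (x + s *\<^sub>R u + 0 *\<^sub>R v) u)"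
    by auto
  have "\<exists>t. 0 < t \<and> t < h \<and> fd f (x + s *\<^sub>R u + h *\<^sub>R v) u - fd f (x + s *\<^sub>R u + 0 *\<^sub>R v) u = (h - 0) * fd (\<lambda>y. fd f y u) (x + s *\<^sub>R u + t *\<^sub>R v) v"
    using assms(2) s by (intro MVT2[of 0 h "\<lambda>t. fd f (x + s *\<^sub>R u + t *\<^sub>R v) u"] d2) auto
  then obtain t where "0 < t" "t < h" "fd f (x + s *\<^sub>R u + h *\<^sub>R v) u - fd f (x + s *\<^sub>R u + 0 *\<^sub>R v) u = h * fd (\<lambda>y. fd f y u) (x + s *\<^sub>R u + t *\<^sub>R v) v"
    by auto
  with s show ?thesis
    by (intro that[of s t]) (auto simp: \<phi>_def algebra_simps)
qed

text \<open>Schwarz's theorem. The second difference is symmetric in \<open>u\<close> and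
  \<open>v\<close>, so arbitrarily close to \<open>x\<close> some value of \<open>F\<close> equals
  some value of \<open>G\<close>; continuity excludes \<open>F x \<noteq> G x\<close>.\<close>

lemma fd_commute_real:
  fixes f :: "'a::euclidean_space \<Rightarrow> real"
  assumes "open S" "smooth_on S f" "x \<in> S"
  shows "fd (\<lambda>y. fd f y u) x v = fd (\<lambda>y. fd f y v) x u"
proof (rule ccontr)
  define F where "F y = fd (\<lambda>y. fd f y u) y v" for y
  define G where "G y = fd (\<lambda>y. fd f y v) y u" for y
  assume "\<not> ?thesis"
  then have ne: "F x \<noteq> G x" by (simp add: F_def G_def)
  define e where "e = \<bar>F x - G x\<bar> / 2"
  have e: "e > 0" using ne by (simp add: e_def)
  have "continuous_on S F" "continuous_on S G"
    unfolding F_def G_def by (intro smooth_on_continuous smooth_on_fd assms)+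
  then have "isCont F x" "isCont G x" using assms continuous_on_eq_continuous_at by blast+
  then have "\<forall>\<^sub>F y in at x. dist (F y) (F x) < e \<and> dist (G y) (G x) < e"
    using e by (auto simp: isCont_def intro: tendstoD eventually_conj)
  then obtain d1 where d1: "d1 > 0" "\<And>y. y \<noteq> x \<Longrightarrow> dist y x < d1 \<Longrightarrow> dist (F y) (F x) < e \<and> dist (G y) (G x) < e"
    unfolding eventually_at by auto
  obtain d2 where d2: "d2 > 0" "ball x d2 \<subseteq> S" using assms openE by blast
  define d where "d = min d1 d2"
  \<comment> \<open>The choice puts the whole parallelogram with sides \<open>h u\<close> and
    \<open>h v\<close> inside the ball of radius \<open>d\<close> about \<open>x\<close>.\<close>
  define h where "h = d / (1 + norm u + norm v) / 2"
  have pos: "1 + norm u + norm v > 0" by (simp add: add_pos_nonneg)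
  have h: "h > 0" using d1 d2 pos by (simp add: h_def d_def)
  have near: "norm (s *\<^sub>R u + t *\<^sub>R v) < d" if "0 \<le> s" "s \<le> h" "0 \<le> t" "t \<le> h" for s t
  proof -
    have "norm (s *\<^sub>R u + t *\<^sub>R v) \<le> s * norm u + t * norm v"
      using norm_triangle_ineq[of "s *\<^sub>R u" "t *\<^sub>R v"] that by simp
    also have "\<dots> \<le> h * norm u + h * norm v" using that by (intro add_mono mult_right_mono) auto
    also have "\<dots> < 2 * (h * (1 + norm u + norm v))"
    proof -
      have "0 \<le> h * norm u" "0 \<le> h * norm v" using h by auto
      then show ?thesis using h unfolding distrib_left by linarith
    qed
    also have "h * (1 + norm u + norm v) = d / 2"
      using pos unfolding h_def by (metis less_irrefl nonzero_eq_divide_eq times_divide_eq_left divide_divide_eq_left mult.commute)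
    finally show ?thesis by simp
  qed
  have inS: "x + s *\<^sub>R u + t *\<^sub>R v \<in> S" if "0 \<le> s" "s \<le> h" "0 \<le> t" "t \<le> h" for s t
    using near[OF that] d2 by (auto simp: d_def dist_norm add.assoc subset_iff norm_minus_commute)
  have inS': "x + s *\<^sub>R v + t *\<^sub>R u \<in> S" if "0 \<le> s" "s \<le> h" "0 \<le> t" "t \<le> h" for s t
    using inS[OF that(3,4,1,2)] by (simp add: add_ac)
  obtain s t where st: "0 < s" "s < h" "0 < t" "t < h"
    "f (x + h *\<^sub>R u + h *\<^sub>R v) - f (x + h *\<^sub>R u) - f (x + h *\<^sub>R v) + f x = h * (h * F (x + s *\<^sub>R u + t *\<^sub>R v))"
    using second_difference_mvt[OF assms(2) h inS] unfolding F_def by blast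
  obtain s' t' where st': "0 < s'" "s' < h" "0 < t'" "t' < h"
    "f (x + h *\<^sub>R v + h *\<^sub>R u) - f (x + h *\<^sub>R v) - f (x + h *\<^sub>R u) + f x = h * (h * G (x + s' *\<^sub>R v + t' *\<^sub>R u))"
    using second_difference_mvt[OF assms(2) h inS'] unfolding G_def by blast
  have "h * (h * F (x + s *\<^sub>R u + t *\<^sub>R v)) = h * (h * G (x + s' *\<^sub>R v + t' *\<^sub>R u))"
    unfolding st(5)[symmetric] st'(5)[symmetric] by (simp add: add_ac)
  then have eq: "F (x + s *\<^sub>R u + t *\<^sub>R v) = G (x + s' *\<^sub>R v + t' *\<^sub>R u)" using h by simp
  define y z where "y = x + s *\<^sub>R u + t *\<^sub>R v" and "z = x + s' *\<^sub>R v + t' *\<^sub>R u"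
  have "y - x = s *\<^sub>R u + t *\<^sub>R v" "z - x = t' *\<^sub>R u + s' *\<^sub>R v" by (simp_all add: y_def z_def)
  then have "dist y x < d" "dist z x < d"
    using near[of s t] near[of t' s'] st st' by (simp_all add: dist_norm)
  then have "dist (F y) (F x) < e" "dist (G z) (G x) < e"
    using d1(2)[of y] d1(2)[of z] e by (cases "y = x"; cases "z = x"; simp add: d_def)+
  moreover have "F y = G z" using eq by (simp add: y_def z_def)
  ultimately have "\<bar>F x - G x\<bar> < 2 * e" by (simp add: dist_real_def)
  then show False by (simp add: e_def)
qed

lemma fd_bounded_linear:
  assumes "bounded_linear L" "(f has_derivative f') (at x)"
  shows "fd (\<lambda>y. L (f y)) x v = L (f' v)"
  by (rule fd_eqI[OF bounded_linear.has_derivative[OF assms]])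

lemma fd_commute:
  fixes f :: "'a::euclidean_space \<Rightarrow> 'b::euclidean_space"
  assumes "open S" "smooth_on S f" "x \<in> S"
  shows "fd (\<lambda>y. fd f y u) x v = fd (\<lambda>y. fd f y v) x u"
proof (rule euclidean_eqI)
  fix b :: 'b
  have sm: "smooth_on S (\<lambda>y. f y \<bullet> b)"
    by (rule smooth_on_bounded_linear[OF assms(1) bounded_linear_inner_left assms(2)])
  have eq: "fd (\<lambda>y. f y \<bullet> b) y w = fd f y w \<bullet> b" if "y \<in> S" for y w
    by (rule fd_bounded_linear[OF bounded_linear_inner_left smooth_on_has_derivative[OF assms(2) that]])
  have "fd (\<lambda>y. fd (\<lambda>y. f y \<bullet> b) y u) x = fd (\<lambda>y. fd f y u \<bullet> b) x" for u
    by (rule fd_cong[OF assms(1,3)]) (simp add: eq)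
  moreover have "fd (\<lambda>y. fd f y u \<bullet> b) x v = fd (\<lambda>y. fd f y u) x v \<bullet> b" for u v
    by (rule fd_bounded_linear[OF bounded_linear_inner_left smooth_on_has_derivative[OF smooth_on_fd[OF assms(2)] assms(3)]])
  ultimately show "fd (\<lambda>y. fd f y u) x v \<bullet> b = fd (\<lambda>y. fd f y v) x u \<bullet> b"
    using fd_commute_real[OF assms(1) sm assms(3), of u v] by simp
qed

lemma fd_compose:
  assumes "(g has_derivative g') (at x)" "(f has_derivative f') (at (g x))"
  shows "fd (\<lambda>x. f (g x)) x v = f' (g' v)"
  using fd_eqI[OF diff_chain_at[OF assms]] by (simp add: o_def)

lemma fd_bilinear:
  assumes "bounded_bilinear b" "(f has_derivative f') (at x)" "(g has_derivative g') (at x)"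
  shows "fd (\<lambda>x. b (f x) (g x)) x v = b (f x) (g' v) + b (f' v) (g x)"
  by (rule fd_eqI[OF bounded_bilinear.FDERIV[OF assms]])

lemmas fd_inner = fd_bilinear[OF bounded_bilinear_inner]

text \<open>A product rule: one term keeps the direction frozen at \<open>w x\<close>, the other
  differentiates the direction field. It serves for Cartan's formula, for rigidity and for the
  geodesic equation.\<close>

lemma fd_fd_apply:
  fixes f :: "'a::euclidean_space \<Rightarrow> 'b::euclidean_space" and w :: "'a \<Rightarrow> 'a"
  assumes "open S" "smooth_on S f" "smooth_on S w" "x \<in> S"
  shows "fd (\<lambda>y. fd f y (w y)) x v = fd (\<lambda>y. fd f y (w x)) x v + fd f x (fd w x v)"
proof -
  define L where "L y = (\<Sum>b\<in>Basis. (w y \<bullet> b) *\<^sub>R fd f y b)" for y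
  have lin: "fd f y z = (\<Sum>b\<in>Basis. (z \<bullet> b) *\<^sub>R fd f y b)" if "y \<in> S" for y z
    by (intro linear_sum_Basis smooth_on_linear_fd[OF assms(2) that])
  note hd = smooth_on_has_derivative[OF smooth_on_fd[OF assms(2)] assms(4)]
    and hw = smooth_on_has_derivative[OF assms(3,4)]
  have "(L has_derivative (\<lambda>v. \<Sum>b\<in>Basis. (w x \<bullet> b) *\<^sub>R fd (\<lambda>y. fd f y b) x v + (fd w x v \<bullet> b) *\<^sub>R fd f x b)) (at x)"
    unfolding L_def by (intro has_derivative_sum has_derivative_scaleR has_derivative_inner_left hd hw)
  from fd_eqI[OF this] have 1: "fd L x v = (\<Sum>b\<in>Basis. (w x \<bullet> b) *\<^sub>R fd (\<lambda>y. fd f y b) x v) + (\<Sum>b\<in>Basis. (fd w x v \<bullet> b) *\<^sub>R fd f x b)"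
    by (simp add: sum.distrib)
  have "((\<lambda>y. \<Sum>b\<in>Basis. (w x \<bullet> b) *\<^sub>R fd f y b) has_derivative (\<lambda>v. \<Sum>b\<in>Basis. (w x \<bullet> b) *\<^sub>R fd (\<lambda>y. fd f y b) x v)) (at x)"
    by (intro has_derivative_sum has_derivative_scaleR_right hd)
  from fd_eqI[OF this] have 2: "fd (\<lambda>y. \<Sum>b\<in>Basis. (w x \<bullet> b) *\<^sub>R fd f y b) x v = (\<Sum>b\<in>Basis. (w x \<bullet> b) *\<^sub>R fd (\<lambda>y. fd f y b) x v)"
    .
  have 3: "fd (\<lambda>y. fd f y (w x)) x = fd (\<lambda>y. \<Sum>b\<in>Basis. (w x \<bullet> b) *\<^sub>R fd f y b) x"
    by (rule fd_cong[OF assms(1,4)]) (rule lin)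
  have 4: "fd (\<lambda>y. fd f y (w y)) x = fd L x" unfolding L_def by (rule fd_cong[OF assms(1,4)]) (rule lin)
  show ?thesis unfolding 4 1 3 2 lin[OF assms(4), of "fd w x v"] ..
qed

section \<open>Inverses of linear maps and of injective immersions of three-space\<close>

lemma smooth_on_cross3:
  "open S \<Longrightarrow> smooth_on S f \<Longrightarrow> smooth_on S g \<Longrightarrow> smooth_on S (\<lambda>x. cross3 (f x) (g x))"
  by (rule smooth_on_bilinear[OF _ bilinear_conv_bounded_bilinear[THEN iffD1, OF bilinear_cross]])

text \<open>Cramer's rule in dimension three.\<close>

definition inv3 :: "(real^3 \<Rightarrow> real^3) \<Rightarrow> real^3 \<Rightarrow> real^3" where
  "inv3 L v = (let a = L (axis 1 1); b = L (axis 2 1); c = L (axis 3 1) in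
     inverse (a \<bullet> cross3 b c) *\<^sub>R vector [v \<bullet> cross3 b c, v \<bullet> cross3 c a, v \<bullet> cross3 a b])"

lemma linear_3:
  fixes L :: "real^3 \<Rightarrow> 'b::real_vector"
  assumes "linear L"
  shows "L v = (v $ 1) *\<^sub>R L (axis 1 1) + (v $ 2) *\<^sub>R L (axis 2 1) + (v $ 3) *\<^sub>R L (axis 3 1)"
proof -
  have "v = (v $ 1) *\<^sub>R axis 1 1 + (v $ 2) *\<^sub>R axis 2 1 + (v $ 3) *\<^sub>R axis 3 1"
    by (simp add: vec_eq_iff forall_3 axis_def)
  then have "L v = L ((v $ 1) *\<^sub>R axis 1 1 + (v $ 2) *\<^sub>R axis 2 1 + (v $ 3) *\<^sub>R axis 3 1)" by simp
  then show ?thesis using assms by (simp add: linear_add linear_cmul)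
qed

lemma triple_product_nonzero:
  fixes L :: "real^3 \<Rightarrow> real^3"
  assumes "linear L" "\<And>v. L v = 0 \<Longrightarrow> v = 0"
  shows "L (axis 1 1) \<bullet> cross3 (L (axis 2 1)) (L (axis 3 1)) \<noteq> 0"
proof -
  have "det (matrix L) \<noteq> 0"
    using assms linear_injective_0[of L] det_nz_iff_inj[of L] by blast
  moreover have "det (matrix L) = L (axis 1 1) \<bullet> cross3 (L (axis 2 1)) (L (axis 3 1))"
    unfolding dot_cross_det by (simp add: matrix_def det_3 vector_3 algebra_simps)
  ultimately show ?thesis by simp
qed

lemma
  fixes L :: "real^3 \<Rightarrow> real^3"
  assumes "linear L" "\<And>v. L v = 0 \<Longrightarrow> v = 0"
  shows inv3_right: "L (inv3 L v) = v" and inv3_left: "inv3 L (L v) = v"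
proof -
  have *: "L (inv3 L v) = v" for v
  proof -
    define a b c where "a = L (axis 1 1)" and "b = L (axis 2 1)" and "c = L (axis 3 1)"
    have nz: "a \<bullet> cross3 b c \<noteq> 0" using triple_product_nonzero[OF assms] by (simp add: a_def b_def c_def)
    have "(v \<bullet> cross3 b c) *\<^sub>R a + (v \<bullet> cross3 c a) *\<^sub>R b + (v \<bullet> cross3 a b) *\<^sub>R c = (a \<bullet> cross3 b c) *\<^sub>R v"
      unfolding vec_eq_iff forall_3 cross3_def inner_vec_def sum_3
      by (simp add: vector_3 algebra_simps)
    then have id: "v = inverse (a \<bullet> cross3 b c) *\<^sub>R ((v \<bullet> cross3 b c) *\<^sub>R a + (v \<bullet> cross3 c a) *\<^sub>R b + (v \<bullet> cross3 a b) *\<^sub>R c)"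
      using nz by simp
    have "L (inv3 L v) = (inv3 L v $ 1) *\<^sub>R a + (inv3 L v $ 2) *\<^sub>R b + (inv3 L v $ 3) *\<^sub>R c"
      unfolding a_def b_def c_def by (rule linear_3[OF assms(1)])
    also have "\<dots> = inverse (a \<bullet> cross3 b c) *\<^sub>R ((v \<bullet> cross3 b c) *\<^sub>R a + (v \<bullet> cross3 c a) *\<^sub>R b + (v \<bullet> cross3 a b) *\<^sub>R c)"
      by (simp add: inv3_def Let_def a_def[symmetric] b_def[symmetric] c_def[symmetric] vector_3 scaleR_add_right)
    also have "\<dots> = v" using id by simp
    finally show ?thesis .
  qed
  show "L (inv3 L v) = v" by (rule *)
  have "L (inv3 L (L v) - v) = 0" using * assms(1) by (simp add: linear_diff)
  then show "inv3 L (L v) = v" using assms(2) by fastforce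
qed

lemma linear_inv3:
  fixes L :: "real^3 \<Rightarrow> real^3"
  assumes "linear L" "\<And>v. L v = 0 \<Longrightarrow> v = 0"
  shows "linear (inv3 L)"
proof (rule linearI)
  show "inv3 L (u + v) = inv3 L u + inv3 L v" for u v
    using inv3_right[OF assms] inv3_left[OF assms] linear_add[OF assms(1)] by metis
  show "inv3 L (r *\<^sub>R u) = r *\<^sub>R inv3 L u" for u r
    using inv3_right[OF assms] inv3_left[OF assms] linear_cmul[OF assms(1)] by metis
qed

lemma smooth_on_vector_3:
  assumes "open S" "smooth_on S f" "smooth_on S g" "smooth_on S h"
  shows "smooth_on S (\<lambda>x. vector [f x, g x, h x] :: real^3)"
  unfolding smooth_on_vec_iff[OF assms(1)] using assms by (simp add: forall_3 vector_3)

lemma smooth_on_inv3: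
  fixes f w :: "real^3 \<Rightarrow> real^3"
  assumes "open S" "smooth_on S f" "smooth_on S w" "\<And>x v. x \<in> S \<Longrightarrow> fd f x v = 0 \<Longrightarrow> v = 0"
  shows "smooth_on S (\<lambda>x. inv3 (fd f x) (w x))"
proof -
  have "fd f x (axis 1 1) \<bullet> cross3 (fd f x (axis 2 1)) (fd f x (axis 3 1)) \<noteq> 0" if "x \<in> S" for x
    using triple_product_nonzero[OF smooth_on_linear_fd[OF assms(2) that]] assms(4)[OF that] by blast
  then show ?thesis unfolding inv3_def Let_def
    by (intro smooth_on_scaleR smooth_on_inverse smooth_on_inner smooth_on_cross3 smooth_on_fd
        smooth_on_vector_3 assms(1-3)) auto
qed

text \<open>Invariance of domain makes the image open. Once \<open>g\<close> is continuous, its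
  derivative at \<open>y\<close> is \<open>inv3 (fd f (g y))\<close>, a smooth expression in
  \<open>g y\<close>, so each order of regularity of \<open>g\<close> gives the next one.\<close>

lemma smooth_on_inverse_function:
  fixes f g :: "real^3 \<Rightarrow> real^3"
  assumes "open S" "smooth_on S f" "inj_on f S" "\<And>x v. x \<in> S \<Longrightarrow> fd f x v = 0 \<Longrightarrow> v = 0"
    and g: "\<And>x. x \<in> S \<Longrightarrow> g (f x) = x"
  shows "open (f ` S)" "smooth_on (f ` S) g"
    "\<And>y v. y \<in> f ` S \<Longrightarrow> fd g y v = inv3 (fd f (g y)) v"
proof -
  show op: "open (f ` S)" by (rule invariance_of_domain[OF smooth_on_continuous[OF assms(2)] assms(1,3)])
  have cont: "continuous_on (f ` S) g"
    by (rule continuous_on_inverse_open[OF assms(1) smooth_on_continuous[OF assms(2)] _ g])  simp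
  have der: "(g has_derivative inv3 (fd f (g y))) (at y)" if "y \<in> f ` S" for y
  proof -
    obtain x where x: "x \<in> S" "y = f x" using \<open>y \<in> f ` S\<close> by blast
    have lin: "linear (fd f x)" by (rule smooth_on_linear_fd[OF assms(2) x(1)])
    note i3 = inv3_right[OF lin assms(4)[OF x(1)]] inv3_left[OF lin assms(4)[OF x(1)]]
    have linv: "linear (inv3 (fd f x))" by (rule linear_inv3[OF lin assms(4)[OF x(1)]])
    have "(g has_derivative inv3 (fd f x)) (at y)"
    proof (rule has_derivative_inverse_basic[where f=f and T="f ` S"])
      show "(f has_derivative fd f x) (at (g y))"
        using smooth_on_has_derivative[OF assms(2) x(1)] g x by simp
      show "bounded_linear (inv3 (fd f x))" using linv by (simp add: linear_conv_bounded_linear)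
      show "inv3 (fd f x) \<circ> fd f x = id" using i3 by (auto simp: fun_eq_iff)
      show "continuous (at y) g" using cont op that continuous_on_eq_continuous_at by blast
      show "open (f ` S)" "y \<in> f ` S" using op that .
      show "f (g z) = z" if "z \<in> f ` S" for z using that g by auto
    qed
    then show ?thesis using g x by simp
  qed
  show "fd g y v = inv3 (fd f (g y)) v" if "y \<in> f ` S" for y v by (rule fd_eqI[OF der[OF that]])
  have "Ck_on k (f ` S) g" for k
  proof (induction k)
    case 0
    then show ?case using cont by simp
  next
    case (Suc k)
    have "Ck_on k (f ` S) (\<lambda>y. inv3 (fd f (g y)) v)" for v
    proof (rule Ck_on_compose[OF op assms(1) _ _ Suc])
      show "g ` f ` S \<subseteq> S" using g by auto
      show "Ck_on k S (\<lambda>x. inv3 (fd f x) v)"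
        by (rule smooth_onD[OF smooth_on_inv3[OF assms(1,2) smooth_on_const assms(4)]])
    qed
    then show ?case using Ck_on_SucI[OF op der] by blast
  qed
  then show "smooth_on (f ` S) g" by (simp add: smooth_on_def)
qed

subsection \<open>Line fields\<close>

lemma cross3_eq_0_imp:
  fixes u a :: "real^3"
  assumes "cross3 u a = 0" "norm a = 1"
  shows "u = (u \<bullet> a) *\<^sub>R a"
proof -
  have "cross3 a (cross3 u a) = (a \<bullet> a) *\<^sub>R u - (a \<bullet> u) *\<^sub>R a" by (rule Lagrange)
  then show ?thesis using assms by (simp add: inner_commute dot_square_norm)
qed

lemma cross3_all_eq_0_imp:
  fixes w :: "real^3"
  assumes "\<And>v. w \<bullet> cross3 a v = 0"
  shows "cross3 w a = 0"
proof -
  have "cross3 w a \<bullet> cross3 w a = 0"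
    using assms[of "cross3 w a"] cross_triple[of w a "cross3 w a"] by (simp add: inner_commute)
  then show ?thesis by simp
qed

lemma plane_decomposition:
  fixes u v w n :: "real^3"
  assumes "n \<noteq> 0" "u \<bullet> n = 0" "v \<bullet> n = 0" "w \<bullet> n = 0" "cross3 u v \<noteq> 0"
  obtains s t where "w = s *\<^sub>R u + t *\<^sub>R v"
proof -
  define m where "m = cross3 u v"
  have "cross3 n m = 0" unfolding m_def Lagrange using assms by (simp add: inner_commute)
  then have "w \<bullet> m = 0"
  proof -
    have "cross3 n (cross3 n m) = (n \<bullet> m) *\<^sub>R n - (n \<bullet> n) *\<^sub>R m" by (rule Lagrange)
    then have "(n \<bullet> n) *\<^sub>R m = (n \<bullet> m) *\<^sub>R n" using \<open>cross3 n m = 0\<close> by simp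
    then have "(n \<bullet> n) * (w \<bullet> m) = 0" using assms(4) by (metis inner_scaleR_right mult_zero_right)
    then show ?thesis using assms(1) by simp
  qed
  \<comment> \<open>Cramer's rule in the basis \<open>u\<close>, \<open>v\<close>, \<open>m\<close>.
    The last coefficient vanishes, because \<open>m\<close> is parallel to \<open>n\<close>.\<close>
  have id: "(m \<bullet> m) *\<^sub>R w = (cross3 w v \<bullet> m) *\<^sub>R u + (cross3 u w \<bullet> m) *\<^sub>R v + (w \<bullet> m) *\<^sub>R m"
    unfolding m_def cross3_def inner_vec_def sum_3 vec_eq_iff forall_3
    by (simp add: vector_3 algebra_simps)
  have "m \<bullet> m \<noteq> 0" using assms(5) by (simp add: m_def)
  then have "w = inverse (m \<bullet> m) *\<^sub>R ((m \<bullet> m) *\<^sub>R w)" by simp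
  also have "\<dots> = (inverse (m \<bullet> m) * (cross3 w v \<bullet> m)) *\<^sub>R u + (inverse (m \<bullet> m) * (cross3 u w \<bullet> m)) *\<^sub>R v"
    unfolding id \<open>w \<bullet> m = 0\<close> by (simp add: scaleR_add_right)
  finally show ?thesis using that by blast
qed

lemma triple_product_plane:
  fixes u v w n :: "real^3"
  assumes "n \<noteq> 0" "u \<bullet> n = 0" "v \<bullet> n = 0" "w \<bullet> n = 0"
  shows "u \<bullet> cross3 v w = 0"
proof -
  have "(u \<bullet> cross3 v w) *\<^sub>R n = (u \<bullet> n) *\<^sub>R cross3 v w + (v \<bullet> n) *\<^sub>R cross3 w u + (w \<bullet> n) *\<^sub>R cross3 u v"
    unfolding cross3_def inner_vec_def sum_3 vec_eq_iff forall_3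
    by (simp add: vector_3 algebra_simps)
  then show ?thesis using assms by simp
qed

text \<open>For \<open>t \<ge> 0\<close> the product of \<open>\<phi>\<close> with
  \<open>exp (- M * t)\<close> does not increase, for \<open>t \<le> 0\<close> the product with
  \<open>exp (M * t)\<close> does not decrease, and both products vanish at 0.\<close>

lemma gronwall_zero:
  fixes \<phi> \<phi>' :: "real \<Rightarrow> real"
  assumes der: "\<And>t. (\<phi> has_real_derivative \<phi>' t) (at t)"
    and bd: "\<And>t. \<bar>\<phi>' t\<bar> \<le> M * \<phi> t" and nn: "\<And>t. 0 \<le> \<phi> t" and z: "\<phi> 0 = 0"
  shows "\<phi> t = 0"
proof -
  have d1: "((\<lambda>t. \<phi> t * exp (- M * t)) has_real_derivative (\<phi>' t - M * \<phi> t) * exp (- M * t)) (at t)" for t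
    by (auto intro!: derivative_eq_intros der simp: algebra_simps)
  have d2: "((\<lambda>t. \<phi> t * exp (M * t)) has_real_derivative (\<phi>' t + M * \<phi> t) * exp (M * t)) (at t)" for t
    by (auto intro!: derivative_eq_intros der simp: algebra_simps)
  show ?thesis
  proof (cases "t \<ge> 0")
    case True
    have "\<phi> t * exp (- M * t) \<le> \<phi> 0 * exp (- M * 0)"
    proof (rule DERIV_nonpos_imp_nonincreasing[OF True, where f="\<lambda>t. \<phi> t * exp (- M * t)"])
      fix x show "\<exists>y. ((\<lambda>t. \<phi> t * exp (- M * t)) has_real_derivative y) (at x) \<and> y \<le> 0"
        by (intro exI conjI, rule d1) (use bd[of x] in \<open>auto intro!: mult_nonpos_nonneg\<close>)
    qed
    then have "\<phi> t * exp (- M * t) \<le> 0" using z by simp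
    then show ?thesis using nn[of t] by (simp add: mult_le_0_iff)
  next
    case False
    have "\<phi> t * exp (M * t) \<le> \<phi> 0 * exp (M * 0)"
    proof (rule DERIV_nonneg_imp_nondecreasing[where f="\<lambda>t. \<phi> t * exp (M * t)"])
      show "t \<le> 0" using False by simp
      fix x show "\<exists>y. ((\<lambda>t. \<phi> t * exp (M * t)) has_real_derivative y) (at x) \<and> y \<ge> 0"
        by (intro exI conjI, rule d2) (use bd[of x] in \<open>auto intro!: mult_nonneg_nonneg\<close>)
    qed
    then have "\<phi> t * exp (M * t) \<le> 0" using z by simp
    then show ?thesis using nn[of t] by (simp add: mult_le_0_iff)
  qed
qed

text \<open>Comparing \<open>t\<close> with \<open>- t\<close> isolates the linear term; inserting
  \<open>sqrt t\<close> then makes the remaining quadratic term grow linearly. Linear growth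
  contradicts the bound in both cases.\<close>

lemma bounded_quadratic:
  fixes a b c :: real
  assumes "\<And>t. \<bar>a + t * b + t\<^sup>2 * c\<bar> \<le> C"
  shows "b = 0 \<and> c = 0"
proof -
  have key: "d = 0" if "\<And>t. t > 0 \<Longrightarrow> t * \<bar>d\<bar> \<le> E" for d E :: real
  proof (rule ccontr)
    assume "d \<noteq> 0"
    then have "(\<bar>E\<bar> + 1) / \<bar>d\<bar> * \<bar>d\<bar> \<le> E" by (intro that) (auto intro!: divide_pos_pos)
    then show False using \<open>d \<noteq> 0\<close> by simp
  qed
  have b: "b = 0"
  proof (rule key)
    fix t :: real assume "t > 0"
    have "\<bar>(a + t * b + t\<^sup>2 * c) - (a + (-t) * b + (-t)\<^sup>2 * c)\<bar> \<le> 2 * C" using assms[of t] assms[of "-t"] by linarith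
    then show "t * \<bar>b\<bar> \<le> C" using \<open>t > 0\<close> by (simp add: abs_mult mult.commute)
  qed
  have "c = 0"
  proof (rule key)
    fix t :: real assume "t > 0"
    have "\<bar>a + sqrt t * b + (sqrt t)\<^sup>2 * c\<bar> \<le> C" by (rule assms)
    then have "\<bar>t * c\<bar> \<le> C + \<bar>a\<bar>" using b \<open>t > 0\<close> by simp
    then show "t * \<bar>c\<bar> \<le> C + \<bar>a\<bar>" using \<open>t > 0\<close> by (simp add: abs_mult)
  qed
  with b show ?thesis by simp
qed

text \<open>The curl of the vector field dual to the 1-form. In dimension three it encodes the
  2-form \<open>da\<close> through the cross product, so that the kernel of a nonzero
  \<open>da\<close> is the line of the curl.\<close>

definition curl3 :: "(real^3 \<Rightarrow> real^3) \<Rightarrow> real^3 \<Rightarrow> real^3" where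
  "curl3 a q = vector [ext_deriv a q (axis 2 1) (axis 3 1), ext_deriv a q (axis 3 1) (axis 1 1), ext_deriv a q (axis 1 1) (axis 2 1)]"

lemma ext_deriv_curl3:
  assumes "linear (fd a q)"
  shows "ext_deriv a q u v = curl3 a q \<bullet> cross3 u v"
proof -
  define A B C where "A = fd a q (axis 1 1)" and "B = fd a q (axis 2 1)" and "C = fd a q (axis 3 1)"
  have L: "fd a q w = (w $ 1) *\<^sub>R A + (w $ 2) *\<^sub>R B + (w $ 3) *\<^sub>R C" for w
    unfolding A_def B_def C_def by (rule linear_3[OF assms])
  have curl: "curl3 a q = vector [B $ 3 - C $ 2, C $ 1 - A $ 3, A $ 2 - B $ 1]"
    unfolding curl3_def ext_deriv_def A_def[symmetric] B_def[symmetric] C_def[symmetric]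
    by (simp add: inner_axis)
  show ?thesis
    unfolding curl ext_deriv_def L cross3_def inner_vec_def sum_3 by (simp add: vector_3 algebra_simps)
qed

text \<open>The mean value inequality is applied first to the derivative in the fixed direction
  \<open>h\<close>, and then to the function along the segment, where the first estimate controls
  the deviation of the derivative from \<open>fd f q\<close>.\<close>

lemma taylor2_bound:
  fixes f :: "'a::euclidean_space \<Rightarrow> 'b::euclidean_space"
  assumes sm: "smooth_on UNIV f" and K: "\<And>q u v. norm (fd (\<lambda>y. fd f y u) q v) \<le> K * norm u * norm v"
  shows "norm (fd f p h - fd f q h) \<le> K * norm h * norm (p - q)"
    and "norm (f (q + h) - f q - fd f q h) \<le> K * (norm h)\<^sup>2"
proof -
  have *: "norm (fd f p h - fd f q h) \<le> K * norm h * norm (p - q)" for p q h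
  proof (rule differentiable_bound[where S=UNIV and f="\<lambda>y. fd f y h" and f'="fd (\<lambda>y. fd f y h)"])
    show "((\<lambda>y. fd f y h) has_derivative fd (\<lambda>y. fd f y h) x) (at x)" for x
      by (rule smooth_on_has_derivative[OF smooth_on_fd[OF sm]]) simp
    show "onorm (fd (\<lambda>y. fd f y h) x) \<le> K * norm h" for x by (rule onorm_le) (rule K)
  qed auto
  show "norm (fd f p h - fd f q h) \<le> K * norm h * norm (p - q)" by (rule *)
  have hd: "(f has_derivative fd f x) (at x)" for x by (rule smooth_on_has_derivative[OF sm]) simp
  obtain b :: 'a where b: "norm b = 1" by (rule vector_choose_size[of 1]) auto
  \<comment> \<open>The sign of \<open>K\<close> is forced by the bound, evaluated at a unit
    vector.\<close>
  have "0 \<le> K" using order_trans[OF norm_ge_zero K[of b q b]] b by simp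
  have "norm (f (q + h) - f q - fd f q ((q + h) - q)) \<le> norm ((q + h) - q) * (K * norm h)"
  proof (rule differentiable_bound_linearization[where S="closed_segment q (q + h)" and f'="fd f"])
    show "q + t *\<^sub>R (q + h - q) \<in> closed_segment q (q + h)" if "t \<in> {0..1}" for t
      unfolding closed_segment_def using that by (auto intro!: exI[of _ t] simp: algebra_simps)
    show "(f has_derivative fd f x) (at x within closed_segment q (q + h))" for x
      using hd has_derivative_at_withinI by blast
    show "onorm (fd f x - fd f q) \<le> K * norm h" if x: "x \<in> closed_segment q (q + h)" for x
    proof (rule onorm_le)
      fix v
      obtain t where t: "0 \<le> t" "t \<le> 1" "x = q + t *\<^sub>R h"
        using x unfolding closed_segment_def by (auto simp: algebra_simps)
      then have "norm (x - q) \<le> norm h" using mult_right_mono[of t 1 "norm h"] by simp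
      have "norm ((fd f x - fd f q) v) \<le> K * norm v * norm (x - q)" using * by simp
      also have "\<dots> \<le> K * norm v * norm h"
        using \<open>norm (x - q) \<le> norm h\<close> \<open>0 \<le> K\<close> by (intro mult_left_mono) auto
      finally show "norm ((fd f x - fd f q) v) \<le> K * norm h * norm v" by (simp add: mult_ac)
    qed
  qed simp
  then show "norm (f (q + h) - f q - fd f q h) \<le> K * (norm h)\<^sup>2"
    by (simp add: power2_eq_square mult_ac)
qed

text \<open>\<open>straight\<close> says that the acceleration along the field vanishes. The bounds
  are global: \<open>L\<close> feeds Gronwall's inequality along complete lines, \<open>K\<close>
  the Taylor estimates at points that may be far away.\<close>

locale straight_field =
  fixes X :: "real^3 \<Rightarrow> real^3" and L K :: real
  assumes smX: "smooth_on UNIV X" and unit: "norm (X q) = 1" and straight: "fd X q (X q) = 0"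
    and L: "norm (fd X q v) \<le> L * norm v"
    and K: "norm (fd (\<lambda>y. fd X y u) q v) \<le> K * norm u * norm v"
begin

lemma derX: "(X has_derivative fd X q) (at q)"
  by (rule smooth_on_has_derivative[OF smX]) simp

lemma linX: "linear (fd X q)"
  using derX has_derivative_linear by blast

lemma contX: "continuous_on S X"
  using smooth_on_continuous[OF smX] continuous_on_subset by blast

text \<open>Uniqueness for a linear equation: the difference \<open>u\<close> satisfies
  \<open>u' = - DX(u)\<close> along the line, because \<open>DX\<close> kills the value of
  \<open>X\<close> at the moving point, and \<open>u\<close> starts at 0.\<close>

lemma X_line: "X (q + t *\<^sub>R X q) = X q"
proof -
  define u where "u t = X (q + t *\<^sub>R X q) - X q" for t
  have du: "(u has_vector_derivative - fd X (q + t *\<^sub>R X q) (u t)) (at t)" for t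
  proof -
    have "(u has_vector_derivative fd X (q + t *\<^sub>R X q) (X q) - 0) (at t)"
      unfolding u_def[abs_def] by (intro has_vector_derivative_diff has_vector_derivative_line derX has_vector_derivative_const)
    moreover have "fd X (q + t *\<^sub>R X q) (X q) = - fd X (q + t *\<^sub>R X q) (u t)"
      using straight[of "q + t *\<^sub>R X q"] by (simp add: u_def linear_diff[OF linX])
    ultimately show ?thesis by simp
  qed
  have "u t \<bullet> u t = 0"
  proof (rule gronwall_zero[where \<phi>="\<lambda>t. u t \<bullet> u t" and M="2 * L"])
    fix t
    have "((\<lambda>t. u t \<bullet> u t) has_derivative (\<lambda>h. u t \<bullet> (h *\<^sub>R - fd X (q + t *\<^sub>R X q) (u t)) + (h *\<^sub>R - fd X (q + t *\<^sub>R X q) (u t)) \<bullet> u t)) (at t)"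
      by (intro has_derivative_inner du[unfolded has_vector_derivative_def])
    then show "((\<lambda>t. u t \<bullet> u t) has_real_derivative (- 2 * (fd X (q + t *\<^sub>R X q) (u t) \<bullet> u t))) (at t)"
      unfolding has_field_derivative_def
      by (rule has_derivative_eq_rhs) (auto simp: fun_eq_iff inner_commute algebra_simps)
    have "\<bar>fd X (q + t *\<^sub>R X q) (u t) \<bullet> u t\<bar> \<le> (L * norm (u t)) * norm (u t)"
      using Cauchy_Schwarz_ineq2 L mult_right_mono norm_ge_zero order_trans by meson
    then show "\<bar>- 2 * (fd X (q + t *\<^sub>R X q) (u t) \<bullet> u t)\<bar> \<le> 2 * L * (u t \<bullet> u t)"
      by (simp add: abs_mult dot_square_norm power2_eq_square mult_ac)
  qed (auto simp: u_def)
  then show ?thesis by (simp add: u_def)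
qed

text \<open>The derivative of \<open>X_line\<close> in \<open>q\<close>: the flow for the time
  \<open>t\<close> has differential \<open>1 + t DX(q)\<close>.\<close>

lemma fd_X_line: "fd X (q + t *\<^sub>R X q) (v + t *\<^sub>R fd X q v) = fd X q v"
proof -
  have d: "((\<lambda>q. q + t *\<^sub>R X q) has_derivative (\<lambda>v. v + t *\<^sub>R fd X q v)) (at q)"
    by (intro has_derivative_add has_derivative_ident has_derivative_scaleR_right derX)
  have "fd (\<lambda>q. X (q + t *\<^sub>R X q)) q v = fd X (q + t *\<^sub>R X q) (v + t *\<^sub>R fd X q v)"
    by (rule fd_compose[OF d derX])
  moreover have "(\<lambda>q. X (q + t *\<^sub>R X q)) = X" by (simp add: X_line)
  ultimately show ?thesis by (metis (no_types))
qed

lemma X_orth: "X q \<bullet> fd X q v = 0"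
proof -
  have "fd (\<lambda>q. X q \<bullet> X q) q v = X q \<bullet> fd X q v + fd X q v \<bullet> X q" by (rule fd_inner[OF derX derX])
  moreover have "(\<lambda>q. X q \<bullet> X q) = (\<lambda>q. 1)" using unit by (simp add: dot_square_norm)
  ultimately show ?thesis by (simp add: inner_commute)
qed

end

locale nilpotent_field = straight_field +
  assumes nil: "fd X q (fd X q v) = 0"
begin

text \<open>As \<open>DX(q)\<close> has square zero, \<open>1 - t DX(q)\<close> inverts
  \<open>1 + t DX(q)\<close>; so \<open>fd_X_line\<close> says that \<open>DX\<close> itself is
  constant along each line.\<close>

lemma fd_X_line_const: "fd X (q + t *\<^sub>R X q) v = fd X q v"
  using fd_X_line[of q t "v - t *\<^sub>R fd X q v"] nil by (simp add: linear_diff[OF linX] linear_cmul[OF linX])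

text \<open>Follow the line through \<open>p = q + \<epsilon> v\<close> for the time \<open>s / \<epsilon>\<close>, step back by \<open>\<epsilon> v\<close>, and then follow
  the line through the point reached backwards for the same time. The value of \<open>X\<close> there is within
  \<open>O(\<epsilon>\<^sup>2)\<close> of \<open>X q\<close>, and the point tends to \<open>q + s DX(q) v\<close>.\<close>

lemma X_image_direction: "X (q + s *\<^sub>R fd X q v) = X q"
proof -
  define z where "z = fd X q v"
  define C where "C = K * (norm v)\<^sup>2"
  define c where "c e = X (q + e *\<^sub>R v)" for e :: real
  define r where "r e = q + (s / e) *\<^sub>R c e" for e :: real
  define w where "w e = r e - (s / e) *\<^sub>R X (r e)" for e :: real
  have n3: "norm (x - y + z) \<le> norm x + norm y + norm z" for x y z :: "real^3"
    using norm_triangle_ineq[of "x - y" z] norm_triangle_ineq4[of x y] by linarith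
  have est: "norm (X (r e) - X q) \<le> 3 * C * e\<^sup>2 \<and> norm (w e - (q + s *\<^sub>R z)) \<le> \<bar>s\<bar> * 3 * C * e \<and> X (w e) = X (r e)"
    if e: "e > 0" for e
  proof -
    define p where "p = q + e *\<^sub>R v"
    define y where "y = p + (s / e) *\<^sub>R c e"
    have Xy: "X y = c e" unfolding y_def c_def p_def[symmetric] by (rule X_line)
    \<comment> \<open>The point \<open>y\<close> is at distance \<open>\<bar>s\<bar> / e\<close>
      from \<open>p\<close>, yet \<open>DX\<close> has the same value on \<open>v\<close> at both.
      This keeps the Taylor estimate for the step back of order \<open>e\<^sup>2\<close> with a
      constant independent of \<open>e\<close>.\<close>
    have Ny: "fd X y v = fd X p v" unfolding y_def c_def p_def[symmetric] by (rule fd_X_line_const)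
    have ry: "r e = y + (- e) *\<^sub>R v" by (simp add: r_def y_def p_def)
    have 1: "norm (X (r e) - c e + e *\<^sub>R fd X p v) \<le> C * e\<^sup>2"
      using taylor2_bound(2)[OF smX K, of y "(- e) *\<^sub>R v"] e
      unfolding ry[symmetric] Xy linear_cmul[OF linX] Ny C_def by (simp add: power_mult_distrib mult_ac)
    have 2: "norm (fd X p v - z) \<le> C * e"
      using taylor2_bound(1)[OF smX K, of p v q] e unfolding z_def C_def p_def
      by (simp add: power2_eq_square mult_ac)
    have 2: "norm (e *\<^sub>R fd X p v - e *\<^sub>R z) \<le> C * e\<^sup>2"
      using mult_left_mono[OF 2, of e] e by (simp add: power2_eq_square mult_ac flip: scaleR_diff_right)
    have 3: "norm (c e - X q - e *\<^sub>R z) \<le> C * e\<^sup>2"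
      using taylor2_bound(2)[OF smX K, of q "e *\<^sub>R v"] e
      unfolding c_def linear_cmul[OF linX] z_def C_def by (simp add: power_mult_distrib mult_ac)
    have a: "X (r e) - X q = (X (r e) - c e + e *\<^sub>R fd X p v) - (e *\<^sub>R fd X p v - e *\<^sub>R z) + (c e - X q - e *\<^sub>R z)"
      by simp
    have A: "norm (X (r e) - X q) \<le> 3 * C * e\<^sup>2"
      unfolding a using 1 2 3 n3[of "X (r e) - c e + e *\<^sub>R fd X p v" "e *\<^sub>R fd X p v - e *\<^sub>R z" "c e - X q - e *\<^sub>R z"]
      by linarith
    \<comment> \<open>By definition \<open>w e\<close> is \<open>q\<close> plus \<open>s / e\<close>
      times \<open>c e - X (r e)\<close>, and this difference is \<open>e\<close> times
      \<open>z\<close> up to second order; the division by \<open>e\<close> leaves an error of first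
      order.\<close>
    have b: "w e - (q + s *\<^sub>R z) = - (s / e) *\<^sub>R ((X (r e) - c e + e *\<^sub>R fd X p v) - (e *\<^sub>R fd X p v - e *\<^sub>R z))"
      using e by (simp add: w_def r_def algebra_simps)
    have "norm ((X (r e) - c e + e *\<^sub>R fd X p v) - (e *\<^sub>R fd X p v - e *\<^sub>R z)) \<le> 3 * C * e\<^sup>2"
      using 1 2 order_trans[OF norm_ge_zero 3] norm_triangle_ineq4[of "X (r e) - c e + e *\<^sub>R fd X p v" "e *\<^sub>R fd X p v - e *\<^sub>R z"]
      by linarith
    then have "norm (w e - (q + s *\<^sub>R z)) \<le> \<bar>s\<bar> / e * (3 * C * e\<^sup>2)"
      unfolding b norm_scaleR using e by (intro mult_mono) auto
    also have "\<dots> = \<bar>s\<bar> * 3 * C * e" using e by (simp add: power2_eq_square)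
    finally have B: "norm (w e - (q + s *\<^sub>R z)) \<le> \<bar>s\<bar> * 3 * C * e" .
    have "X (w e) = X (r e)" using X_line[of "r e" "- (s / e)"] by (simp add: w_def)
    with A B show ?thesis by simp
  qed
  have ev: "\<forall>\<^sub>F e in at_right (0::real). e > 0" by (simp add: eventually_at_right_less)
  have wlim: "(w \<longlongrightarrow> q + s *\<^sub>R z) (at_right 0)"
  proof (rule Lim_null_comparison[THEN LIM_zero_cancel])
    show "\<forall>\<^sub>F e in at_right 0. norm (w e - (q + s *\<^sub>R z)) \<le> \<bar>s\<bar> * 3 * C * e"
      using ev by eventually_elim (use est in auto)
    show "((\<lambda>e. \<bar>s\<bar> * 3 * C * e) \<longlongrightarrow> 0) (at_right 0)" by (auto intro!: tendsto_eq_intros)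
  qed
  have rlim: "((\<lambda>e. X (w e)) \<longlongrightarrow> X q) (at_right 0)"
  proof (rule Lim_null_comparison[THEN LIM_zero_cancel])
    show "\<forall>\<^sub>F e in at_right 0. norm (X (w e) - X q) \<le> 3 * C * e\<^sup>2"
      using ev by eventually_elim (use est in auto)
    show "((\<lambda>e. 3 * C * e\<^sup>2) \<longlongrightarrow> 0) (at_right 0)" by (auto intro!: tendsto_eq_intros)
  qed
  have "isCont X (q + s *\<^sub>R z)" using contX[of UNIV] continuous_on_eq_continuous_at by blast
  then have "((\<lambda>e. X (w e)) \<longlongrightarrow> X (q + s *\<^sub>R z)) (at_right 0)"
    using wlim isCont_tendsto_compose by blast
  then have "X (q + s *\<^sub>R z) = X q" using rlim tendsto_unique by (metis trivial_limit_at_right_real)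
  then show ?thesis by (simp add: z_def)
qed

text \<open>If \<open>DX\<close> vanishes everywhere, \<open>X\<close> is constant and any unit
  vector orthogonal to it serves as \<open>n\<close>. Otherwise a value \<open>z \<noteq> 0\<close>
  of \<open>DX\<close> and the field span a plane on which \<open>X\<close> is constant, and lines
  of the field that meet must have the same direction.\<close>

lemma planar: "\<exists>n. norm n = 1 \<and> (\<forall>q. X q \<bullet> n = 0) \<and> (\<forall>q q'. q \<bullet> n = q' \<bullet> n \<longrightarrow> X q = X q')"
proof (cases "\<forall>q v. fd X q v = 0")
  case True
  obtain y where y: "y \<noteq> 0" "orthogonal (X 0) y" by (rule orthogonal_to_vector_exists[of "X 0"]) auto
  have "\<exists>c. \<forall>x\<in>UNIV. X x = c"
  proof (rule has_derivative_zero_constant[OF convex_UNIV])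
    show "(X has_derivative (\<lambda>h. 0)) (at x)" for x using derX[of x] True by (metis (no_types, lifting) ext)
  qed
  then have c: "X q = X 0" for q by auto
  show ?thesis
  proof (intro exI[of _ "y /\<^sub>R norm y"] conjI allI impI)
    show "norm (y /\<^sub>R norm y) = 1" using y by simp
    show "X q \<bullet> (y /\<^sub>R norm y) = 0" for q using y c[of q] by (simp add: orthogonal_def)
    show "X q = X q'" for q q' using c[of q] c[of q'] by simp
  qed
next
  case False
  then obtain q0 v0 where v0: "fd X q0 v0 \<noteq> 0" by blast
  define z a where "z = fd X q0 v0" and "a = X q0"
  have za: "a \<bullet> z = 0" by (simp add: z_def a_def X_orth)
  have na: "norm a = 1" by (simp add: a_def unit)
  define m where "m = cross3 a z"
  have m: "m \<noteq> 0"
  proof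
    assume "m = 0"
    then have "(norm (cross3 a z))\<^sup>2 + (a \<bullet> z)\<^sup>2 = 0" by (simp add: m_def za)
    then show False using v0 unfolding norm_cross_dot by (simp add: na z_def)
  qed
  define n where "n = m /\<^sub>R norm m"
  have n1: "norm n = 1" using m by (simp add: n_def)
  then have n0: "n \<noteq> 0" by auto
  have an: "a \<bullet> n = 0" "z \<bullet> n = 0" by (simp_all add: n_def m_def dot_cross_self)
  \<comment> \<open>\<open>DX\<close> takes the same value \<open>z\<close> on \<open>v0\<close> at
    every point of the line through \<open>q0\<close>, so the direction \<open>z\<close> can be
    followed from each of these points.\<close>
  have plane: "X (q0 + t *\<^sub>R a + s *\<^sub>R z) = a" for t s
  proof -
    have "X (q0 + t *\<^sub>R a + s *\<^sub>R fd X (q0 + t *\<^sub>R a) v0) = X (q0 + t *\<^sub>R a)" by (rule X_image_direction)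
    then show ?thesis using X_line[of q0 t] fd_X_line_const[of q0 t v0] by (simp add: a_def z_def)
  qed
  \<comment> \<open>A line not parallel to the plane would meet it at a point where the field is
    \<open>a\<close>. The field, constant along the line, would then be \<open>a\<close> at
    \<open>q\<close> too, and \<open>a\<close> is tangent to the plane.\<close>
  have orth: "X q \<bullet> n = 0" for q
  proof (rule ccontr)
    assume ne: "X q \<bullet> n \<noteq> 0"
    define t where "t = ((q0 - q) \<bullet> n) / (X q \<bullet> n)"
    have "(q + t *\<^sub>R X q - q0) \<bullet> n = 0" using ne by (simp add: t_def inner_diff_left inner_add_left)
    then obtain s' t' where "q + t *\<^sub>R X q - q0 = s' *\<^sub>R a + t' *\<^sub>R z"
      using plane_decomposition[OF n0 an(1) an(2)] m unfolding m_def by metis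
    then have "q + t *\<^sub>R X q = q0 + s' *\<^sub>R a + t' *\<^sub>R z" by (simp add: algebra_simps)
    then have "X q = a" using X_line plane by metis
    then show False using an ne by simp
  qed
  have "X q = X q'" if h: "q \<bullet> n = q' \<bullet> n" for q q'
  proof -
    \<comment> \<open>Two non-parallel lines in one plane intersect, and each carries its value of
      the field to the intersection.\<close>
    have parallel: "cross3 (X q1) (X q2) = 0" if "q1 \<bullet> n = q2 \<bullet> n" for q1 q2
    proof (rule ccontr)
      assume ne: "cross3 (X q1) (X q2) \<noteq> 0"
      have "(q2 - q1) \<bullet> n = 0" using that by (simp add: inner_diff_left)
      then obtain s t where "q2 - q1 = s *\<^sub>R X q1 + t *\<^sub>R X q2"
        using plane_decomposition[OF n0 orth orth _ ne] by metis
      then have "q1 + s *\<^sub>R X q1 = q2 + (- t) *\<^sub>R X q2" by (simp add: algebra_simps)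
      then have "X q1 = X q2" using X_line by metis
      then show False using ne by simp
    qed
    \<comment> \<open>Parallel unit vectors agree up to sign. The segment stays in the plane, so
      \<open>g\<close> is continuous with values 1 and -1 only, and its value at 0 fixes the
      sign.\<close>
    define g where "g t = X (q + t *\<^sub>R (q' - q)) \<bullet> X q" for t :: real
    have gsq: "g t = 1 \<or> g t = -1" for t
    proof -
      have "cross3 (X (q + t *\<^sub>R (q' - q))) (X q) = 0"
        by (rule parallel) (simp add: inner_add_left inner_diff_left h)
      then have "(g t)\<^sup>2 = 1"
        using norm_cross_dot[of "X (q + t *\<^sub>R (q' - q))" "X q"] by (simp add: g_def unit)
      then show ?thesis by (simp add: power2_eq_1_iff)
    qed
    have "continuous_on {0..1} g"
      unfolding g_def by (intro continuous_intros continuous_on_compose2[OF contX[of UNIV]]) auto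
    then have conn: "connected (g ` {0..1})" by (rule connected_continuous_image) simp
    have "g 1 = 1"
    proof (rule ccontr)
      assume "g 1 \<noteq> 1"
      then have "g 1 = -1" using gsq by blast
      moreover have "g 0 = 1" by (simp add: g_def dot_square_norm unit)
      ultimately have "-1 \<in> g ` {0..1}" "1 \<in> g ` {0..1}" by (metis atLeastAtMost_iff imageI order_refl zero_le_one)+
      then have "0 \<in> g ` {0..1}" using conn connectedD_interval[of "g ` {0..1}" "-1" 1 0] by simp
      then obtain t where "g t = 0" by auto
      then show False using gsq[of t] by simp
    qed
    then have "X q' \<bullet> X q = 1" by (simp add: g_def)
    then show ?thesis using dot_norm_neg[of "X q'" "X q"] by (simp add: unit)
  qed
  then show ?thesis using n1 orth by blast
qed

end

subsection \<open>Darboux coordinates\<close>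

text \<open>\<open>m\<close> and \<open>C\<close> together bound the distortion of area by the flow.
  Later \<open>c\<close> makes \<open>W\<close> onto along the lines of the field, and
  \<open>m\<close> makes \<open>x\<close> onto across them.\<close>

locale reeb_line_field = straight_field X L K for X :: "real^3 \<Rightarrow> real^3" and L K :: real +
  fixes a :: "real^3 \<Rightarrow> real^3" and c m C :: real
  assumes sma: "smooth_on UNIV a" and ker: "ext_deriv a q (X q) v = 0"
    and c: "c > 0" "c \<le> a q \<bullet> X q"
    and m: "m > 0" "m \<le> \<bar>curl3 a q \<bullet> X q\<bar>" "\<bar>curl3 a q \<bullet> X q\<bar> \<le> C"
begin

lemma dera: "(a has_derivative fd a q) (at q)"
  by (rule smooth_on_has_derivative[OF sma]) simp

lemma lina: "linear (fd a q)"
  using dera has_derivative_linear by blast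

text \<open>The kernel condition says that the curl is parallel to \<open>X\<close>. So
  \<open>da\<close> is a multiple of the area form orthogonal to \<open>X\<close>, with the density
  \<open>curl3 a q \<bullet> X q\<close>.\<close>

lemma ext_deriv_X: "ext_deriv a q u v = (curl3 a q \<bullet> X q) * (X q \<bullet> cross3 u v)"
proof -
  have "curl3 a q = (curl3 a q \<bullet> X q) *\<^sub>R X q"
    using cross3_eq_0_imp[OF cross3_all_eq_0_imp unit] ker ext_deriv_curl3[OF lina] by metis
  then show ?thesis unfolding ext_deriv_curl3[OF lina] by (metis inner_scaleR_left)
qed

lemma smooth_fd_a: "smooth_on UNIV (\<lambda>z. fd a z u)"
  by (rule smooth_on_fd[OF sma])

lemma der_fd_a: "((\<lambda>z. fd a z u) has_derivative fd (\<lambda>z. fd a z u) q) (at q)"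
  by (rule smooth_on_has_derivative[OF smooth_fd_a]) simp

lemma der_ext_deriv:
  "((\<lambda>y. ext_deriv a y u v) has_derivative
    (\<lambda>w. fd (\<lambda>z. fd a z u) y w \<bullet> v - fd (\<lambda>z. fd a z v) y w \<bullet> u)) (at y)"
  unfolding ext_deriv_def
  by (intro has_derivative_diff has_derivative_inner_left der_fd_a)

lemma ext_deriv_add: "ext_deriv a q (u + u') v = ext_deriv a q u v + ext_deriv a q u' v"
    "ext_deriv a q u (v + v') = ext_deriv a q u v + ext_deriv a q u v'"
  and ext_deriv_scale: "ext_deriv a q (t *\<^sub>R u) v = t * ext_deriv a q u v"
    "ext_deriv a q u (t *\<^sub>R v) = t * ext_deriv a q u v"
  by (simp_all add: ext_deriv_def linear_add[OF lina] linear_cmul[OF lina] algebra_simps inner_add)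

text \<open>Cartan's formula \<open>L\<^sub>X da = 0\<close>, spelled out.\<close>

lemma lie_derivative:
  "fd (\<lambda>y. ext_deriv a y u v) y (X y) = - ext_deriv a y (fd X y u) v - ext_deriv a y u (fd X y v)"
proof -
  define A where "A u w = fd (\<lambda>z. fd a z u) y w" for u w
  have sym: "A u w = A w u" for u w
    unfolding A_def by (rule fd_commute[OF open_UNIV sma]) simp
  have eq: "A (X y) u \<bullet> v - A v u \<bullet> X y = - ext_deriv a y (fd X y u) v" for u v
  proof -
    have 1: "fd (\<lambda>z. fd a z (X z)) y u = A (X y) u + fd a y (fd X y u)"
      unfolding A_def by (rule fd_fd_apply[OF open_UNIV sma smX]) simp
    have "smooth_on UNIV (\<lambda>z. fd a z (X z))" by (rule smooth_on_fd_apply[OF open_UNIV sma smX])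
    then have 2: "((\<lambda>z. fd a z (X z)) has_derivative fd (\<lambda>z. fd a z (X z)) y) (at y)"
      by (rule smooth_on_has_derivative) simp
    have "((\<lambda>z. fd a z (X z) \<bullet> v - fd a z v \<bullet> X z) has_derivative
        (\<lambda>h. fd (\<lambda>z. fd a z (X z)) y h \<bullet> v - (fd a y v \<bullet> fd X y h + fd (\<lambda>z. fd a z v) y h \<bullet> X y))) (at y)"
      by (intro has_derivative_diff has_derivative_inner_left has_derivative_inner 2 derX der_fd_a)
    from fd_eqI[OF this, of u]
    have "fd (\<lambda>z. ext_deriv a z (X z) v) y u = (A (X y) u + fd a y (fd X y u)) \<bullet> v - (fd a y v \<bullet> fd X y u + A v u \<bullet> X y)"
      unfolding ext_deriv_def 1 A_def .
    then show ?thesis unfolding ker by (simp add: ext_deriv_def algebra_simps inner_add)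
  qed
  have "fd (\<lambda>y. ext_deriv a y u v) y (X y) = A u (X y) \<bullet> v - A v (X y) \<bullet> u"
    unfolding A_def by (rule fd_eqI[OF der_ext_deriv])
  also have "\<dots> = (A (X y) u \<bullet> v - A v u \<bullet> X y) - (A (X y) v \<bullet> u - A u v \<bullet> X y)"
    unfolding sym[of u v] sym[of u "X y"] sym[of v "X y"] by simp
  also have "\<dots> = - ext_deriv a y (fd X y u) v + ext_deriv a y (fd X y v) u" unfolding eq by simp
  finally show ?thesis by (simp add: ext_deriv_def)
qed

text \<open>Invariance of \<open>da\<close> under the flow, whose differential is
  \<open>1 + t DX(q)\<close>. By bilinearity the left side is a quadratic expression in
  \<open>t\<close> whose coefficients depend on the moving point, and its derivative vanishes by
  \<open>lie_derivative\<close>.\<close>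

lemma ext_deriv_flow:
  "ext_deriv a (q + t *\<^sub>R X q) (u + t *\<^sub>R fd X q u) (v + t *\<^sub>R fd X q v) = ext_deriv a q u v"
proof -
  define x Nu Nv where "x = X q" and "Nu = fd X q u" and "Nv = fd X q v"
  define l where "l t = q + t *\<^sub>R x" for t
  define G where "G u v t = ext_deriv a (l t) u v" for u v t
  define G' where "G' u v t = fd (\<lambda>y. ext_deriv a y u v) (l t) x" for u v t
  have dG: "(G u v has_vector_derivative G' u v t) (at t)" for u v t
    unfolding G_def[abs_def] G'_def l_def
    by (rule has_vector_derivative_line[OF der_ext_deriv[THEN has_derivative_eq_rhs]])
      (rule sym, rule ext, rule fd_eqI[OF der_ext_deriv])
  have Xl: "X (l t) = x" for t unfolding l_def x_def by (rule X_line)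
  define g where "g t = G u v t + t * (G Nu v t + G u Nv t) + t^2 * G Nu Nv t" for t
  have g_eq: "g t = ext_deriv a (l t) (u + t *\<^sub>R Nu) (v + t *\<^sub>R Nv)" for t
    by (simp add: g_def G_def ext_deriv_add ext_deriv_scale algebra_simps power2_eq_square)
  have dG': "(G u v has_real_derivative G' u v t) (at t)" for u v t
    using dG by (simp add: has_real_derivative_iff_has_vector_derivative)
  have "(g has_real_derivative 0) (at t)" for t
  proof -
    have d: "(g has_real_derivative G' u v t + (G Nu v t + G u Nv t) + t * (G' Nu v t + G' u Nv t)
        + 2 * t * G Nu Nv t + t^2 * G' Nu Nv t) (at t)"
      unfolding g_def[abs_def] by (rule derivative_eq_intros dG' refl)+ (simp add: algebra_simps)
    define N where "N = fd X (l t)"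
    have lie: "G' u v t = - G (N u) v t - G u (N v) t" for u v
      using lie_derivative[of u v "l t"] unfolding Xl G'_def G_def N_def .
    \<comment> \<open>The Lie derivative brings in \<open>DX\<close> at the moving point
      \<open>l t\<close>; \<open>fd_X_line\<close> relates it to \<open>DX\<close> at
      \<open>q\<close>, and then all terms cancel.\<close>
    have NU: "N u + t *\<^sub>R N Nu = Nu" "N v + t *\<^sub>R N Nv = Nv"
      using fd_X_line[of q t u] fd_X_line[of q t v]
      unfolding N_def l_def x_def Nu_def Nv_def linear_add[OF linX] linear_cmul[OF linX] .
    have e1: "G Nu w t = G (N u) w t + t * G (N Nu) w t" for w
      unfolding G_def by (subst NU(1)[symmetric]) (simp only: ext_deriv_add ext_deriv_scale)
    have e2: "G w Nv t = G w (N v) t + t * G w (N Nv) t" for w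
      unfolding G_def by (subst NU(2)[symmetric]) (simp only: ext_deriv_add ext_deriv_scale)
    have "G' u v t + (G Nu v t + G u Nv t) + t * (G' Nu v t + G' u Nv t)
        + 2 * t * G Nu Nv t + t^2 * G' Nu Nv t = 0"
      unfolding lie e1[of v] e2[of u]
      using e1[of Nv] e2[of Nu] by algebra
    with d show ?thesis by simp
  qed
  then have "g t = g 0" using DERIV_const_ratio_const[of t 0 g 0] DERIV_isconst_all by blast
  then show ?thesis unfolding g_eq by (simp add: l_def x_def Nu_def Nv_def)
qed

lemma nilpotent: "fd X q (fd X q w) = 0"
proof -
  define N where "N = fd X q"
  define \<omega> where "\<omega> u v = X q \<bullet> cross3 u v" for u v
  \<comment> \<open>In polarised form these are the trace and the determinant of \<open>N\<close> on
    the quotient by \<open>X\<close>. Invariance of \<open>da\<close> and the bounds on its density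
    confine \<open>\<omega>\<close> of the transported vectors to \<open>C / m\<close> times its
    initial size, for all \<open>t\<close> of either sign.\<close>
  have skew: "\<omega> (N u) v + \<omega> u (N v) = 0 \<and> \<omega> (N u) (N v) = 0" for u v
  proof (rule bounded_quadratic)
    fix t
    let ?q = "q + t *\<^sub>R X q"
    have "(curl3 a ?q \<bullet> X ?q) * \<omega> (u + t *\<^sub>R N u) (v + t *\<^sub>R N v) = (curl3 a q \<bullet> X q) * \<omega> u v"
      using ext_deriv_flow[of q t u v] unfolding ext_deriv_X[of q u v] ext_deriv_X[of ?q] X_line \<omega>_def N_def .
    then have "\<bar>curl3 a ?q \<bullet> X ?q\<bar> * \<bar>\<omega> (u + t *\<^sub>R N u) (v + t *\<^sub>R N v)\<bar> = \<bar>curl3 a q \<bullet> X q\<bar> * \<bar>\<omega> u v\<bar>"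
      by (simp flip: abs_mult)
    also have "\<dots> \<le> C * \<bar>\<omega> u v\<bar>" using m by (intro mult_right_mono) auto
    finally have "m * \<bar>\<omega> (u + t *\<^sub>R N u) (v + t *\<^sub>R N v)\<bar> \<le> C * \<bar>\<omega> u v\<bar>"
      using m(2)[of ?q] by (meson abs_ge_zero mult_right_mono order_trans)
    moreover have "\<omega> (u + t *\<^sub>R N u) (v + t *\<^sub>R N v) = \<omega> u v + t * (\<omega> (N u) v + \<omega> u (N v)) + t\<^sup>2 * \<omega> (N u) (N v)"
      by (simp add: \<omega>_def cross_add_left cross_add_right cross_mult_left cross_mult_right inner_add_right
          power2_eq_square algebra_simps)
    ultimately show "\<bar>\<omega> u v + t * (\<omega> (N u) v + \<omega> u (N v)) + t\<^sup>2 * \<omega> (N u) (N v)\<bar> \<le> C * \<bar>\<omega> u v\<bar> / m"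
      using m(1) by (simp add: field_simps)
  qed
  \<comment> \<open>Skewness moves one \<open>N\<close> to the other slot, where the determinant
    condition applies; hence \<open>N (N w)\<close> is parallel to \<open>X\<close>. Like every
    value of \<open>N\<close> it is also orthogonal to \<open>X\<close>, and so it vanishes.\<close>
  have "cross3 (X q) (N (N w)) = 0"
  proof -
    have "\<omega> (N (N w)) v = 0" for v using skew[of "N w" v] skew[of w v] by simp
    then have "cross3 (X q) (N (N w)) \<bullet> v = 0" for v
      using cross_triple[of "X q" "N (N w)" v] by (simp add: \<omega>_def inner_commute)
    then show ?thesis using inner_eq_zero_iff by blast
  qed
  then have "cross3 (N (N w)) (X q) = 0" using cross_skew[of "N (N w)" "X q"] by simp
  then have "N (N w) = (N (N w) \<bullet> X q) *\<^sub>R X q" using cross3_eq_0_imp unit by blast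
  then show ?thesis unfolding N_def using X_orth by (simp add: inner_commute)
qed

sublocale nilpotent_field
  by unfold_locales (rule nilpotent)

end

text \<open>For a unit vector \<open>n\<close>, the dilation by \<open>t\<close> about the axis
  spanned by \<open>n\<close> within the orthogonal planes: the projection to the axis at
  \<open>t = 0\<close>, the identity at \<open>t = 1\<close>.\<close>

definition ray_map :: "real^3 \<Rightarrow> real \<Rightarrow> real^3 \<Rightarrow> real^3" where
  "ray_map n t q = (q \<bullet> n) *\<^sub>R n + t *\<^sub>R (q - (q \<bullet> n) *\<^sub>R n)"

lemma continuous_ray_map: "continuous_on S (\<lambda>(q, t). ray_map n t q)"
  unfolding ray_map_def split_beta by (intro continuous_intros)

text \<open>The weight \<open>t ^ j\<close> makes the family closed under differentiation, as each
  derivative across the axis brings out a factor \<open>t\<close>.\<close>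

definition ray_integral :: "real^3 \<Rightarrow> nat \<Rightarrow> (real^3 \<Rightarrow> 'b::euclidean_space) \<Rightarrow> real^3 \<Rightarrow> 'b" where
  "ray_integral n j f q = integral (cbox 0 1) (\<lambda>t. t ^ j *\<^sub>R f (ray_map n t q))"

lemma continuous_ray_integrand:
  fixes f :: "real^3 \<Rightarrow> 'b::euclidean_space"
  assumes "continuous_on UNIV f"
  shows "continuous_on S (\<lambda>(q, t). t ^ j *\<^sub>R f (ray_map n t q))"
  unfolding split_beta
  by (intro continuous_intros continuous_on_compose2[OF assms] continuous_ray_map[unfolded split_beta]) auto

lemma ray_integrable:
  fixes f :: "real^3 \<Rightarrow> 'b::euclidean_space"
  assumes "continuous_on UNIV f"
  shows "(\<lambda>t. t ^ j *\<^sub>R f (ray_map n t q)) integrable_on cbox 0 (1::real)"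
  unfolding ray_map_def
  by (intro integrable_continuous continuous_intros continuous_on_compose2[OF assms]) auto

lemma continuous_ray_integral:
  fixes f :: "real^3 \<Rightarrow> 'b::euclidean_space"
  assumes "continuous_on UNIV f"
  shows "continuous_on UNIV (ray_integral n j f)"
  unfolding ray_integral_def[abs_def]
  by (rule integral_continuous_on_param) (rule continuous_ray_integrand[OF assms])

text \<open>\<open>ray_map n t\<close> is linear in the point, hence its own derivative. It keeps
  the part of the direction along \<open>n\<close> and multiplies the rest by \<open>t\<close>,
  which raises the weight by one.\<close>

lemma ray_integral_has_derivative:
  fixes f :: "real^3 \<Rightarrow> 'b::euclidean_space"
  assumes "Ck_on (Suc 0) UNIV f"
  shows "(ray_integral n j f has_derivative
    (\<lambda>v. ray_integral n j (\<lambda>y. fd f y ((v \<bullet> n) *\<^sub>R n)) q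
       + ray_integral n (Suc j) (\<lambda>y. fd f y (v - (v \<bullet> n) *\<^sub>R n)) q)) (at q)"
proof -
  have der: "(f has_derivative fd f y) (at y)" for y by (rule Ck_on_SucD[OF assms]) simp
  have cf: "continuous_on UNIV f" using Ck_on_Suc_imp[OF assms] by simp
  have cd: "continuous_on UNIV (\<lambda>y. fd f y v)" for v using assms by simp
  define D where "D q t = Blinfun (\<lambda>v. t ^ j *\<^sub>R fd f (ray_map n t q) (ray_map n t v))" for q t
  have lin_ray: "bounded_linear (ray_map n t)" for t
    unfolding ray_map_def by (intro bounded_linear_intros)
  have bl: "bounded_linear (\<lambda>v. t ^ j *\<^sub>R fd f (ray_map n t q) (ray_map n t v))" for q t
    by (intro bounded_linear_const_scaleR bounded_linear_compose[OF has_derivative_bounded_linear[OF der] lin_ray])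
  have D: "blinfun_apply (D q t) v = t ^ j *\<^sub>R fd f (ray_map n t q) (ray_map n t v)" for q t v
    unfolding D_def using bounded_linear_Blinfun_apply[OF bl] by simp
  have split: "fd f y (ray_map n t v) = fd f y ((v \<bullet> n) *\<^sub>R n) + t *\<^sub>R fd f y (v - (v \<bullet> n) *\<^sub>R n)" for y t v
    using has_derivative_linear[OF der[of y]] by (simp add: ray_map_def linear_add linear_cmul)
  have cD: "continuous_on (UNIV \<times> cbox 0 1) (\<lambda>(q, t). D q t)"
    unfolding split_beta
  proof (rule continuous_on_blinfun_componentwise)
    fix v :: "real^3"
    show "continuous_on (UNIV \<times> cbox 0 1) (\<lambda>x. blinfun_apply (D (fst x) (snd x)) v)"
      unfolding D split
      by (intro continuous_intros continuous_on_compose2[OF cd] continuous_ray_map[unfolded split_beta]) auto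
  qed
  have "((\<lambda>q. integral (cbox 0 1) (\<lambda>t. t ^ j *\<^sub>R f (ray_map n t q))) has_derivative integral (cbox 0 1) (D q)) (at q within UNIV)"
  proof (rule leibniz_rule[OF _ _ cD])
    show "((\<lambda>q. t ^ j *\<^sub>R f (ray_map n t q)) has_derivative blinfun_apply (D q t)) (at q within UNIV)" for q t
      unfolding D
      by (intro has_derivative_scaleR_right
          has_derivative_compose[OF bounded_linear.has_derivative[OF lin_ray has_derivative_ident] der])
    show "(\<lambda>t. t ^ j *\<^sub>R f (ray_map n t q)) integrable_on cbox 0 1" for q by (rule ray_integrable[OF cf])
  qed auto
  moreover have "blinfun_apply (integral (cbox 0 1) (D q)) = (\<lambda>v. ray_integral n j (\<lambda>y. fd f y ((v \<bullet> n) *\<^sub>R n)) q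
       + ray_integral n (Suc j) (\<lambda>y. fd f y (v - (v \<bullet> n) *\<^sub>R n)) q)"
  proof
    fix v
    have "continuous_on (cbox 0 1) (D q)"
      by (rule continuous_on_compose2[OF cD, of _ "\<lambda>t. (q, t)", unfolded split_beta fst_conv snd_conv]) (auto intro!: continuous_intros)
    then have "D q integrable_on cbox 0 1" by (rule integrable_continuous)
    then have "blinfun_apply (integral (cbox 0 1) (D q)) v = integral (cbox 0 1) (\<lambda>t. blinfun_apply (D q t) v)"
      by (rule blinfun_apply_integral)
    also have "\<dots> = integral (cbox 0 1) (\<lambda>t. t ^ j *\<^sub>R fd f (ray_map n t q) ((v \<bullet> n) *\<^sub>R n)
        + t ^ Suc j *\<^sub>R fd f (ray_map n t q) (v - (v \<bullet> n) *\<^sub>R n))"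
      unfolding D split by (simp add: scaleR_add_right mult.commute)
    also have "\<dots> = ray_integral n j (\<lambda>y. fd f y ((v \<bullet> n) *\<^sub>R n)) q
       + ray_integral n (Suc j) (\<lambda>y. fd f y (v - (v \<bullet> n) *\<^sub>R n)) q"
      unfolding ray_integral_def by (rule Henstock_Kurzweil_Integration.integral_add) (rule ray_integrable[OF cd])+
    finally show "blinfun_apply (integral (cbox 0 1) (D q)) v = \<dots>" .
  qed
  ultimately show ?thesis by (simp add: ray_integral_def[abs_def])
qed

lemma Ck_on_antimono: "Ck_on k S f \<Longrightarrow> j \<le> k \<Longrightarrow> Ck_on j S f"
  by (induction k) (auto simp: le_Suc_eq simp del: Ck_on.simps dest: Ck_on_Suc_imp)

lemma Ck_on_ray_integral: "Ck_on k UNIV f \<Longrightarrow> Ck_on k UNIV (ray_integral n j f)"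
proof (induction k arbitrary: j f)
  case 0
  then show ?case using continuous_ray_integral by simp
next
  case (Suc k)
  have "Ck_on (Suc 0) UNIV f" by (rule Ck_on_antimono[OF Suc.prems]) simp
  then show ?case
    by (intro Ck_on_SucI[OF open_UNIV ray_integral_has_derivative] Ck_on_add[OF open_UNIV] Suc.IH) (use Suc.prems in auto)
qed

lemma smooth_on_ray_integral: "smooth_on UNIV f \<Longrightarrow> smooth_on UNIV (ray_integral n j f)"
  by (simp add: smooth_on_def Ck_on_ray_integral)

section \<open>Bijections of the line with slope bounded away from zero\<close>

lemma bij_real_derivative_ge:
  fixes g g' :: "real \<Rightarrow> real"
  assumes der: "\<And>t. (g has_real_derivative g' t) (at t)" and m: "m > 0" "\<And>t. m \<le> g' t"
  shows "bij g"
proof (rule bijI)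
  have "g s < g t" if "s < t" for s t
    by (rule DERIV_pos_imp_increasing[OF that]) (use der m less_le_trans in blast)
  then show "inj g" by (metis injI linorder_neqE_linordered_idom less_irrefl)
  have cont: "isCont g t" for t using der DERIV_isCont by blast
  have lin: "m * (t - s) \<le> g t - g s" if "s \<le> t" for s t
  proof (cases "s = t")
    case False
    then have "s < t" using that by simp
    then obtain z where "g t - g s = (t - s) * g' z" using MVT2[of s t g g'] der by blast
    then show ?thesis using m(2)[of z] that mult_right_mono[of m "g' z" "t - s"] by (simp add: mult.commute)
  qed simp
  show "surj g"
  proof (unfold surj_def, intro allI)
    fix y
    \<comment> \<open>With slope at least \<open>m\<close> the value \<open>y\<close> is attained
      within distance \<open>T\<close> of 0.\<close>
    define T where "T = \<bar>y - g 0\<bar> / m"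
    have T: "T \<ge> 0" "m * T = \<bar>y - g 0\<bar>" using m by (auto simp: T_def)
    have "g (-T) \<le> y" "y \<le> g T" using lin[of "-T" 0] lin[of 0 T] T by auto
    then show "\<exists>x. y = g x" using IVT[of g "-T" y T] cont T by auto
  qed
qed

text \<open>The derivative is continuous and avoids 0, so by connectedness it keeps one
  sign.\<close>

lemma bij_real_derivative:
  fixes g g' :: "real \<Rightarrow> real"
  assumes der: "\<And>t. (g has_real_derivative g' t) (at t)" and cont: "continuous_on UNIV g'"
    and m: "m > 0" "\<And>t. m \<le> \<bar>g' t\<bar>"
  shows "bij g"
proof -
  have "(\<forall>t. g' t > 0) \<or> (\<forall>t. g' t < 0)"
  proof (rule ccontr)
    assume "\<not> ?thesis"
    then obtain s t where "g' s \<le> 0" "g' t \<ge> 0" by (meson not_le_imp_less less_imp_le not_less)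
    moreover have "connected (range g')" by (rule connected_continuous_image[OF cont]) simp
    ultimately have "0 \<in> range g'" using connectedD_interval[of "range g'" "g' s" "g' t" 0] by auto
    then show False using m by (metis abs_zero imageE not_less)
  qed
  then show ?thesis
  proof
    assume "\<forall>t. g' t > 0"
    then show ?thesis using bij_real_derivative_ge[OF der m(1)] m(2) by (metis abs_of_pos)
  next
    assume neg: "\<forall>t. g' t < 0"
    have "bij (\<lambda>t. - g t)"
    proof (rule bij_real_derivative_ge[where g'="\<lambda>t. - g' t" and m=m])
      show "((\<lambda>t. - g t) has_real_derivative - g' t) (at t)" for t by (rule DERIV_minus[OF der])
      show "m \<le> - g' t" for t using m(2)[of t] neg abs_of_neg by metis
    qed (rule m)
    then have "bij (uminus \<circ> (\<lambda>t. - g t))" using bij_comp bij_uminus by blast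
    then show ?thesis by (simp add: o_def)
  qed
qed

lemma vec3_expand: "(q :: real^3) = vector [q $ 1, q $ 2, q $ 3]"
  by (simp add: vec_eq_iff forall_3 vector_3)

lemma has_derivative_vector_3:
  fixes f g h :: "'a::euclidean_space \<Rightarrow> real"
  assumes "(f has_derivative f') F" "(g has_derivative g') F" "(h has_derivative h') F"
  shows "((\<lambda>x. vector [f x, g x, h x] :: real^3) has_derivative (\<lambda>v. vector [f' v, g' v, h' v])) F"
proof -
  have "(\<lambda>x. vector [f x, g x, h x] :: real^3) = (\<lambda>x. f x *\<^sub>R axis 1 1 + g x *\<^sub>R axis 2 1 + h x *\<^sub>R axis 3 1)" for f g h :: "'a \<Rightarrow> real"
    by (simp add: fun_eq_iff vec_eq_iff forall_3 vector_3 axis_def)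
  then show ?thesis
    by (simp only:) (intro has_derivative_add has_derivative_scaleR_left assms)
qed

section \<open>Global Darboux coordinates\<close>

context reeb_line_field
begin

lemma darboux:
  "\<exists>f. diffeomorphism f \<and> (\<forall>q v. std_contact_form (f q) \<bullet> fd f q v = a q \<bullet> v)"
proof -
  obtain n where n: "norm n = 1" and Xn: "\<And>q. X q \<bullet> n = 0" and const: "\<And>q q'. q \<bullet> n = q' \<bullet> n \<Longrightarrow> X q = X q'"
    using planar by blast
  have nn: "n \<bullet> n = 1" using n by (simp add: dot_square_norm)
  have n0: "n \<noteq> 0" using n by auto
  \<comment> \<open>\<open>da\<close> is a multiple of the triple product with \<open>X\<close>, and
    \<open>X\<close> is tangent to the planes; the triple product of three vectors of one plane
    vanishes.\<close>
  have plane_closed: "fd a y u \<bullet> v = fd a y v \<bullet> u" if "u \<bullet> n = 0" "v \<bullet> n = 0" for y u v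
    using ext_deriv_X[of y u v] triple_product_plane[OF n0 Xn that] by (simp add: ext_deriv_def)
  define P where "P q = q - (q \<bullet> n) *\<^sub>R n" for q
  have P: "bounded_linear P" unfolding P_def by (intro bounded_linear_intros)
  have Pn: "P q \<bullet> n = 0" for q by (simp add: P_def inner_diff_left nn)
  define I where "I = ray_integral n 0 a"
  \<comment> \<open>The primitive of the Poincare lemma: the integral of the form along the ray from
    the axis to \<open>q\<close>, whose velocity is \<open>P q\<close>.\<close>
  define W where "W q = I q \<bullet> P q" for q
  have smW: "smooth_on UNIV W"
    unfolding W_def I_def by (intro smooth_on_inner smooth_on_ray_integral smooth_on_linear sma open_UNIV bounded_linear.linear[OF P])
  have a1: "Ck_on (Suc 0) UNIV a" by (rule smooth_onD[OF sma])
  have ca: "continuous_on UNIV a" "continuous_on UNIV (\<lambda>y. fd a y v)" for v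
    using smooth_on_continuous sma smooth_fd_a by blast+
  have W_plane: "fd W q v = a q \<bullet> v" if v: "v \<bullet> n = 0" for q v
  proof -
    have Pv: "P v = v" using v by (simp add: P_def)
    have "fd W q v = I q \<bullet> P v + (ray_integral n 0 (\<lambda>y. fd a y ((v \<bullet> n) *\<^sub>R n)) q
       + ray_integral n (Suc 0) (\<lambda>y. fd a y (v - (v \<bullet> n) *\<^sub>R n)) q) \<bullet> P q"
      unfolding W_def I_def
      by (rule fd_inner[OF ray_integral_has_derivative[OF a1] bounded_linear.has_derivative[OF P has_derivative_ident]])
    also have "\<dots> = I q \<bullet> v + ray_integral n (Suc 0) (\<lambda>y. fd a y v) q \<bullet> P q"
      using v Pv linear_0[OF lina] by (simp add: ray_integral_def)
    also have "\<dots> = integral {0..1} (\<lambda>t. a (ray_map n t q) \<bullet> v + t * (fd a (ray_map n t q) v \<bullet> P q))"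
    proof -
      have i1: "(\<lambda>t. a (ray_map n t q)) integrable_on {0..1}" and i2: "(\<lambda>t. t *\<^sub>R fd a (ray_map n t q) v) integrable_on {0..1}"
        using ray_integrable[OF ca(1), of 0 n q] ray_integrable[OF ca(2), of 1 n q v] by (simp_all add: cbox_interval)
      have e1: "I q \<bullet> v = integral {0..1} (\<lambda>t. a (ray_map n t q) \<bullet> v)"
        using integral_linear[OF i1 bounded_linear_inner_left[of v]] by (simp add: I_def ray_integral_def o_def cbox_interval)
      have e2: "ray_integral n (Suc 0) (\<lambda>y. fd a y v) q \<bullet> P q = integral {0..1} (\<lambda>t. t * (fd a (ray_map n t q) v \<bullet> P q))"
        using integral_linear[OF i2 bounded_linear_inner_left[of "P q"]] by (simp add: ray_integral_def o_def cbox_interval)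
      have j1: "(\<lambda>t. a (ray_map n t q) \<bullet> v) integrable_on {0..1}"
        using integrable_linear[OF i1 bounded_linear_inner_left[of v]] by (simp add: o_def)
      have j2: "(\<lambda>t. t * (fd a (ray_map n t q) v \<bullet> P q)) integrable_on {0..1}"
        using integrable_linear[OF i2 bounded_linear_inner_left[of "P q"]] by (simp add: o_def)
      show ?thesis unfolding e1 e2 by (rule Henstock_Kurzweil_Integration.integral_add[OF j1 j2, symmetric])
    qed
    also have "\<dots> = a q \<bullet> v"
    proof (rule integral_unique)
      \<comment> \<open>By closedness along the planes the integrand is the derivative of
        \<open>t * (a (ray_map n t q) \<bullet> v)\<close>, whose boundary values are 0 and
        \<open>a q \<bullet> v\<close>.\<close>
      have "((\<lambda>t. a (ray_map n t q) \<bullet> v + t * (fd a (ray_map n t q) v \<bullet> P q)) has_integral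
          1 * (a (ray_map n 1 q) \<bullet> v) - 0 * (a (ray_map n 0 q) \<bullet> v)) {0..1}"
      proof (rule fundamental_theorem_of_calculus)
        fix t :: real
        have "((\<lambda>t. a (ray_map n t q)) has_vector_derivative fd a (ray_map n t q) (P q)) (at t)"
          unfolding ray_map_def P_def by (rule has_vector_derivative_line[OF dera])
        then have "((\<lambda>t. a (ray_map n t q) \<bullet> v) has_vector_derivative fd a (ray_map n t q) (P q) \<bullet> v) (at t)"
          by (rule bounded_linear.has_vector_derivative[OF bounded_linear_inner_left])
        then have "((\<lambda>t. a (ray_map n t q) \<bullet> v) has_real_derivative fd a (ray_map n t q) v \<bullet> P q) (at t)"
          using plane_closed[OF Pn v] by (simp add: has_real_derivative_iff_has_vector_derivative)
        then have "((\<lambda>t. t * (a (ray_map n t q) \<bullet> v)) has_real_derivative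
            a (ray_map n t q) \<bullet> v + t * (fd a (ray_map n t q) v \<bullet> P q)) (at t)"
          by (auto intro!: derivative_eq_intros)
        then show "((\<lambda>t. t * (a (ray_map n t q) \<bullet> v)) has_vector_derivative
            a (ray_map n t q) \<bullet> v + t * (fd a (ray_map n t q) v \<bullet> P q)) (at t within {0..1})"
          by (simp add: has_real_derivative_iff_has_vector_derivative has_vector_derivative_at_within)
      qed simp
      then show "((\<lambda>t. a (ray_map n t q) \<bullet> v + t * (fd a (ray_map n t q) v \<bullet> P q)) has_integral a q \<bullet> v) {0..1}"
        by (simp add: ray_map_def)
    qed
    finally show ?thesis .
  qed
  define x where "x q = a q \<bullet> n - fd W q n" for q
  have smx: "smooth_on UNIV x"
    unfolding x_def by (intro smooth_on_diff smooth_on_inner smooth_on_fd sma smW open_UNIV smooth_on_const)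
  have derW: "(W has_derivative fd W q) (at q)" and derx: "(x has_derivative fd x q) (at q)" for q
    by (rule smooth_on_has_derivative[OF smW] smooth_on_has_derivative[OF smx]; simp)+
  have decomp: "a q \<bullet> v = fd W q v + x q * (v \<bullet> n)" for q v
  proof -
    have v: "P v + (v \<bullet> n) *\<^sub>R n = v" by (simp add: P_def)
    have "fd W q (P v + (v \<bullet> n) *\<^sub>R n) = fd W q (P v) + (v \<bullet> n) * fd W q n"
      using has_derivative_linear[OF derW[of q]] by (simp add: linear_add linear_cmul)
    moreover have "a q \<bullet> (P v + (v \<bullet> n) *\<^sub>R n) = a q \<bullet> P v + (v \<bullet> n) * (a q \<bullet> n)"
      by (simp only: inner_add_right inner_scaleR_right)
    ultimately show ?thesis unfolding v using W_plane[OF Pn] by (simp add: x_def algebra_simps)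
  qed
  \<comment> \<open>That is, \<open>da\<close> is the wedge product of \<open>dx\<close> and
    \<open>dy\<close>, by \<open>a = dW + x dy\<close>; the second derivatives of \<open>W\<close>
    cancel by symmetry.\<close>
  have da: "ext_deriv a q u v = fd x q u * (v \<bullet> n) - fd x q v * (u \<bullet> n)" for q u v
  proof -
    have *: "fd a q u \<bullet> v = fd (\<lambda>y. fd W y v) q u + fd x q u * (v \<bullet> n)" for u v
    proof -
      have "fd (\<lambda>y. a y \<bullet> v) q u = fd a q u \<bullet> v"
        by (rule fd_bounded_linear[OF bounded_linear_inner_left dera])
      moreover have "fd (\<lambda>y. fd W y v + x y * (v \<bullet> n)) q u = fd (\<lambda>y. fd W y v) q u + fd x q u * (v \<bullet> n)"
        by (rule fd_eqI) (intro has_derivative_add has_derivative_mult_left derx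
            smooth_on_has_derivative[OF smooth_on_fd[OF smW]] UNIV_I)
      ultimately show ?thesis by (simp add: decomp)
    qed
    show ?thesis unfolding ext_deriv_def * using fd_commute[OF open_UNIV smW, of q u v] by simp
  qed
  define f where "f q = (vector [x q, q \<bullet> n, W q] :: real^3)" for q
  have smf: "smooth_on UNIV f"
    unfolding f_def by (intro smooth_on_vector_3 smx smW smooth_on_inner smooth_on_ident smooth_on_const open_UNIV)
  have fdf: "fd f q v = vector [fd x q v, v \<bullet> n, fd W q v]" for q v
    unfolding f_def
    by (rule fd_eqI, rule has_derivative_vector_3[OF derx has_derivative_inner_left[OF has_derivative_ident] derW])
  have pull: "std_contact_form (f q) \<bullet> fd f q v = a q \<bullet> v" for q v
    unfolding fdf decomp std_contact_form_def f_def by (simp add: inner_vec_def sum_3 vector_3)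
  \<comment> \<open>A vector killed by \<open>dx\<close> and \<open>dy\<close> lies in the kernel of
    \<open>da\<close>, that is, on the line of \<open>X\<close>. It is killed by
    \<open>a = dW + x dy\<close> too, and \<open>a\<close> is positive on \<open>X\<close>.\<close>
  have imm: "v = 0" if "fd f q v = 0" for q v
  proof -
    have z: "fd x q v = 0" "v \<bullet> n = 0" "fd W q v = 0"
      using arg_cong[OF that, of "\<lambda>w. w $ 1"] arg_cong[OF that, of "\<lambda>w. w $ 2"] arg_cong[OF that, of "\<lambda>w. w $ 3"]
      by (simp_all add: fdf vector_3)
    have "X q \<bullet> cross3 v u = 0" for u
      using ext_deriv_X[of q v u] da[of q v u] z m(1) m(2)[of q] by auto
    then have "cross3 (X q) v = 0" by (rule cross3_all_eq_0_imp)
    then have "v = (v \<bullet> X q) *\<^sub>R X q" using cross3_eq_0_imp[OF _ unit] cross_skew[of v "X q"] by simp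
    moreover have "a q \<bullet> v = 0" using decomp[of q v] z by simp
    ultimately have "(v \<bullet> X q) * (a q \<bullet> X q) = 0" by (metis inner_scaleR_right)
    moreover have "a q \<bullet> X q \<noteq> 0" using c by (metis not_less)
    ultimately show ?thesis using \<open>v = (v \<bullet> X q) *\<^sub>R X q\<close> by (metis mult_eq_0_iff scaleR_zero_left)
  qed
  have "bij f"
  proof -
    \<comment> \<open>Coordinates adapted to the field: the height \<open>z\<close> along the axis,
      and in the plane at this height the direction \<open>e z\<close> of the field and the
      direction \<open>j z\<close> orthogonal to it.\<close>
    define e where "e z = X (z *\<^sub>R n)" for z
    define j where "j z = cross3 n (e z)" for z
    have en: "e z \<bullet> n = 0" "norm (e z) = 1" for z by (simp_all add: e_def Xn unit)
    have jn: "j z \<bullet> n = 0" "j z \<bullet> e z = 0" for z by (simp_all add: j_def dot_cross_self)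
    have jcross: "cross3 (j z) n = e z" for z
      using Lagrange[of n n "e z"] cross_skew[of "j z" n] en by (simp add: j_def inner_commute nn)
    have ecross: "cross3 (j z) (e z) \<noteq> 0" for z
    proof -
      have "cross3 (e z) (j z) = n" unfolding j_def Lagrange using en by (simp add: dot_square_norm)
      then show ?thesis using n0 cross_skew[of "j z" "e z"] by simp
    qed
    define pt where "pt z w s = z *\<^sub>R n + w *\<^sub>R j z + s *\<^sub>R e z" for z w s
    have pt_n: "pt z w s \<bullet> n = z" for z w s by (simp add: pt_def inner_add_left jn en nn)
    have Xpt: "X (pt z w s) = e z" for z w s unfolding e_def by (rule const) (simp add: pt_n nn)
    \<comment> \<open>Inserting \<open>X\<close> and \<open>n\<close> into \<open>da\<close> shows
      that \<open>x\<close> is constant along the lines of the field.\<close>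
    have xe: "fd x q (X q) = 0" for q using da[of q "X q" n] ker[of q n] Xn nn by simp
    have x_const: "x (pt z w s) = x (pt z w 0)" for z w s
    proof -
      have "((\<lambda>s. x (z *\<^sub>R n + w *\<^sub>R j z + s *\<^sub>R e z)) has_vector_derivative fd x (pt z w s) (e z)) (at s)" for s
        unfolding pt_def by (rule has_vector_derivative_line[OF derx])
      then have "((\<lambda>s. x (z *\<^sub>R n + w *\<^sub>R j z + s *\<^sub>R e z)) has_real_derivative 0) (at s)" for s
        using xe Xpt by (metis has_real_derivative_iff_has_vector_derivative)
      then show ?thesis unfolding pt_def
        using DERIV_isconst_all[of "\<lambda>s. x (z *\<^sub>R n + w *\<^sub>R j z + s *\<^sub>R e z)" s 0] by blast
    qed
    \<comment> \<open>Across the lines the slope of \<open>x\<close> is \<open>da\<close> on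
      \<open>j z\<close> and \<open>n\<close>, which is the density of \<open>da\<close> because
      \<open>cross3 (j z) n = e z\<close>. Its sign is not known, only that its size is at least
      \<open>m\<close>. For \<open>W\<close> below, the slope along the lines is \<open>a\<close> on
      the field, at least \<open>c\<close>.\<close>
    have bijx: "bij (\<lambda>w. x (pt z w 0))" for z
    proof (rule bij_real_derivative)
      show "((\<lambda>w. x (pt z w 0)) has_real_derivative curl3 a (pt z w 0) \<bullet> e z) (at w)" for w
      proof -
        have "((\<lambda>w. x (z *\<^sub>R n + w *\<^sub>R j z)) has_vector_derivative fd x (z *\<^sub>R n + w *\<^sub>R j z) (j z)) (at w)"
          by (rule has_vector_derivative_line[OF derx])
        moreover have "fd x (pt z w 0) (j z) = curl3 a (pt z w 0) \<bullet> e z"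
          using da[of "pt z w 0" "j z" n] ext_deriv_curl3[OF lina, of "pt z w 0" "j z" n] by (simp add: jn jcross nn)
        ultimately show ?thesis by (simp add: pt_def has_real_derivative_iff_has_vector_derivative)
      qed
      have curl: "continuous_on UNIV (curl3 a)"
        unfolding curl3_def ext_deriv_def
        by (intro smooth_on_continuous smooth_on_vector_3 smooth_on_diff smooth_on_inner smooth_fd_a smooth_on_const open_UNIV)
      have "continuous_on UNIV (\<lambda>w. pt z w 0)" unfolding pt_def by (intro continuous_intros)
      then show "continuous_on UNIV (\<lambda>w. curl3 a (pt z w 0) \<bullet> e z)"
        by (intro continuous_on_inner continuous_on_const continuous_on_compose2[OF curl]) auto
      show "m > 0" by (rule m)
      show "m \<le> \<bar>curl3 a (pt z w 0) \<bullet> e z\<bar>" for w using m(2)[of "pt z w 0"] by (simp add: Xpt)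
    qed
    have bijW: "bij (\<lambda>s. W (pt z w s))" for z w
    proof (rule bij_real_derivative_ge)
      show "((\<lambda>s. W (pt z w s)) has_real_derivative a (pt z w s) \<bullet> e z) (at s)" for s
      proof -
        have "((\<lambda>s. W (z *\<^sub>R n + w *\<^sub>R j z + s *\<^sub>R e z)) has_vector_derivative fd W (pt z w s) (e z)) (at s)"
          unfolding pt_def by (rule has_vector_derivative_line[OF derW])
        then show ?thesis using W_plane[OF en(1)] by (simp add: pt_def has_real_derivative_iff_has_vector_derivative)
      qed
      show "c > 0" by (rule c)
      show "c \<le> a (pt z w s) \<bullet> e z" for s using c(2)[of "pt z w s"] by (simp add: Xpt)
    qed
    \<comment> \<open>A triangular shape: the second coordinate determines \<open>z\<close>, then
      the first determines \<open>w\<close>, then the third determines \<open>s\<close>, each time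
      by a bijection of the line.\<close>
    have fpt: "f (pt z w s) = vector [x (pt z w 0), z, W (pt z w s)]" for z w s
      by (simp add: f_def pt_n x_const[of z w s])
    have pt_ex: "\<exists>w s. q = pt (q \<bullet> n) w s" for q
    proof -
      have "(q - (q \<bullet> n) *\<^sub>R n) \<bullet> n = 0" by (simp add: inner_diff_left nn)
      then obtain w s where "q - (q \<bullet> n) *\<^sub>R n = w *\<^sub>R j (q \<bullet> n) + s *\<^sub>R e (q \<bullet> n)"
        using plane_decomposition[OF n0 jn(1) en(1) _ ecross] by metis
      then have "q = pt (q \<bullet> n) w s" unfolding pt_def by (simp add: algebra_simps)
      then show ?thesis by blast
    qed
    show "bij f"
    proof (rule bijI)
      show "inj f"
      proof (rule injI)
        fix q q' assume eq: "f q = f q'"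
        obtain w s w' s' where q: "q = pt (q \<bullet> n) w s" "q' = pt (q' \<bullet> n) w' s'" using pt_ex by metis
        have h: "q \<bullet> n = q' \<bullet> n" using arg_cong[OF eq, of "\<lambda>v. v $ 2"] by (simp add: f_def vector_3)
        define z where "z = q \<bullet> n"
        have q: "q = pt z w s" "q' = pt z w' s'" using q h by (simp_all add: z_def)
        have "x (pt z w 0) = x (pt z w' 0)"
          using arg_cong[OF eq, of "\<lambda>v. v $ 1"] by (simp add: q fpt vector_3)
        then have w: "w = w'" using bij_is_inj[OF bijx] by (meson injD)
        have "W (pt z w s) = W (pt z w s')"
          using arg_cong[OF eq, of "\<lambda>v. v $ 3"] by (simp add: q fpt w vector_3)
        then have "s = s'" using bij_is_inj[OF bijW] by (meson injD)
        then show "q = q'" using q w by simp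
      qed
      show "surj f"
        unfolding surj_def
      proof
        fix y :: "real^3"
        obtain w where w: "y $ 1 = x (pt (y $ 2) w 0)"
          using surjD[OF bij_is_surj[OF bijx[of "y $ 2"]], of "y $ 1"] by blast
        obtain s where s: "y $ 3 = W (pt (y $ 2) w s)"
          using surjD[OF bij_is_surj[OF bijW[of "y $ 2" w]], of "y $ 3"] by blast
        have "y = f (pt (y $ 2) w s)" unfolding fpt w[symmetric] s[symmetric] by (rule vec3_expand)
        then show "\<exists>q. y = f q" by blast
      qed
    qed
  qed
  moreover have "smooth_on UNIV (inv f)"
    using smooth_on_inverse_function(2)[OF open_UNIV smf _ imm, where g="inv f"] \<open>bij f\<close>
    by (simp add: bij_is_inj bij_is_surj)
  ultimately have "diffeomorphism f" using smf by (simp add: diffeomorphism_def)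
  then show ?thesis using pull by blast
qed

end

subsection \<open>Developing maps of flat metrics\<close>

type_synonym metric3 = "real^3 \<Rightarrow> real^3 \<Rightarrow> real^3 \<Rightarrow> real"

text \<open>Local isometries into Euclidean space, not necessarily injective: partial developing
  maps.\<close>

definition isometric_on :: "metric3 \<Rightarrow> (real^3) set \<Rightarrow> (real^3 \<Rightarrow> real^3) \<Rightarrow> bool" where
  "isometric_on H U \<psi> \<longleftrightarrow> open U \<and> smooth_on U \<psi> \<and> (\<forall>x\<in>U. \<forall>u v. fd \<psi> x u \<bullet> fd \<psi> x v = H x u v)"

definition rigid :: "(real^3 \<Rightarrow> real^3) \<Rightarrow> bool" where
  "rigid \<tau> \<longleftrightarrow> (\<exists>Q b. orthogonal_transformation Q \<and> \<tau> = (\<lambda>x. Q x + b))"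

lemma isometric_onD:
  assumes "isometric_on H U \<psi>"
  shows "open U" "smooth_on U \<psi>" "x \<in> U \<Longrightarrow> fd \<psi> x u \<bullet> fd \<psi> x v = H x u v"
    "x \<in> U \<Longrightarrow> (\<psi> has_derivative fd \<psi> x) (at x)" "x \<in> U \<Longrightarrow> linear (fd \<psi> x)"
  using assms smooth_on_has_derivative smooth_on_linear_fd unfolding isometric_on_def by blast+

lemma isometric_on_subset: "isometric_on H U \<psi> \<Longrightarrow> open V \<Longrightarrow> V \<subseteq> U \<Longrightarrow> isometric_on H V \<psi>"
  using smooth_on_subset unfolding isometric_on_def by blast

lemma isometric_on_cong:
  assumes "isometric_on H U \<psi>" "\<And>x. x \<in> U \<Longrightarrow> \<phi> x = \<psi> x"
  shows "isometric_on H U \<phi>"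
proof -
  have U: "open U" using assms(1) by (simp add: isometric_on_def)
  have "fd \<phi> x = fd \<psi> x" if "x \<in> U" for x by (rule fd_cong[OF U that assms(2)])
  moreover have "smooth_on U \<phi>" by (rule smooth_on_cong[OF _ U assms(2)]) (use assms(1) in \<open>simp_all add: isometric_on_def\<close>)
  ultimately show ?thesis using assms(1) by (simp add: isometric_on_def)
qed

lemma isometric_on_local:
  assumes "\<And>x. x \<in> U \<Longrightarrow> \<exists>V \<psi>. x \<in> V \<and> isometric_on H V \<psi> \<and> (\<forall>y\<in>V. \<phi> y = \<psi> y)" "open U"
  shows "isometric_on H U \<phi>"
proof -
  have *: "\<exists>V. x \<in> V \<and> isometric_on H V \<phi>" if "x \<in> U" for x
    using assms(1)[OF that] isometric_on_cong by blast
  show ?thesis unfolding isometric_on_def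
    using * assms(2) smooth_on_local[of U \<phi>] unfolding isometric_on_def by blast
qed

lemma rigid_isometric:
  assumes "isometric_on H U \<psi>" "rigid \<tau>"
  shows "isometric_on H U (\<lambda>x. \<tau> (\<psi> x))"
proof -
  obtain Q b where Q: "orthogonal_transformation Q" "\<tau> = (\<lambda>x. Q x + b)" using assms(2) by (auto simp: rigid_def)
  have lin: "linear Q" using Q orthogonal_transformation_linear by blast
  then have bl: "bounded_linear Q" by (simp add: linear_conv_bounded_linear)
  note U = isometric_onD[OF assms(1)]
  have sm: "smooth_on U (\<lambda>x. \<tau> (\<psi> x))"
    unfolding Q(2) by (intro smooth_on_add smooth_on_bounded_linear[OF _ bl] U(1,2) smooth_on_const)
  have "fd (\<lambda>x. \<tau> (\<psi> x)) x v = Q (fd \<psi> x v)" if "x \<in> U" for x v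
  proof (rule fd_eqI)
    have "((\<lambda>x. Q (\<psi> x) + b) has_derivative (\<lambda>v. Q (fd \<psi> x v) + 0)) (at x)"
      by (intro has_derivative_add bounded_linear.has_derivative[OF bl] U(4) that has_derivative_const)
    then show "((\<lambda>x. \<tau> (\<psi> x)) has_derivative (\<lambda>v. Q (fd \<psi> x v))) (at x)" by (simp add: Q(2))
  qed
  then show ?thesis
    using U sm Q(1) unfolding isometric_on_def by (simp add: orthogonal_transformation_def)
qed

lemma isometric_immersion:
  assumes "isometric_on H U \<psi>" "\<And>u. H x u u = 0 \<Longrightarrow> u = 0" "x \<in> U" "fd \<psi> x u = 0"
  shows "u = 0"
  using assms isometric_onD(3)[OF assms(1,3), of u u] by simp

text \<open>Koszul's formula: the metric determines the second derivative of an isometry.\<close>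

lemma koszul:
  assumes "isometric_on H U \<psi>" "x \<in> U"
  shows "2 * (fd (\<lambda>y. fd \<psi> y u) x v \<bullet> fd \<psi> x w)
    = fd (\<lambda>y. H y u w) x v + fd (\<lambda>y. H y v w) x u - fd (\<lambda>y. H y u v) x w"
proof -
  note U = isometric_onD[OF assms(1)]
  define S where "S u v = fd (\<lambda>y. fd \<psi> y u) x v" for u v
  have sym: "S u v = S v u" for u v unfolding S_def by (rule fd_commute[OF U(1,2) assms(2)])
  have d: "((\<lambda>y. fd \<psi> y u) has_derivative S u) (at x)" for u
    unfolding S_def by (rule smooth_on_has_derivative[OF smooth_on_fd[OF U(2)] assms(2)])
  have "fd (\<lambda>y. H y u v) x w = fd \<psi> x u \<bullet> S v w + S u w \<bullet> fd \<psi> x v" for u v w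
  proof -
    have "fd (\<lambda>y. H y u v) x = fd (\<lambda>y. fd \<psi> y u \<bullet> fd \<psi> y v) x"
      by (rule fd_cong[OF U(1) assms(2)]) (simp add: U(3))
    then show ?thesis using fd_inner[OF d[of u] d[of v]] by simp
  qed
  then show ?thesis
    unfolding S_def[symmetric] using sym[of u v] sym[of u w] sym[of v w] by (simp add: inner_commute)
qed

text \<open>By Koszul's formula the second derivatives of \<open>\<psi>\<close> and
  \<open>\<phi>\<close>, measured in their own frames, depend on \<open>H\<close> only and so agree.
  Hence the linear map that takes the frame of \<open>\<psi>\<close> to that of
  \<open>\<phi>\<close> is constant over the connected set \<open>U\<close>.\<close>

lemma rigidity:
  assumes \<psi>: "isometric_on H U \<psi>" and \<phi>: "isometric_on H U \<phi>" and "connected U"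
    and pos: "\<And>x u. x \<in> U \<Longrightarrow> H x u u = 0 \<Longrightarrow> u = 0"
  shows "\<exists>\<tau>. rigid \<tau> \<and> (\<forall>x\<in>U. \<phi> x = \<tau> (\<psi> x))"
proof (cases "U = {}")
  case True
  have "rigid (\<lambda>x. x + 0)" unfolding rigid_def using orthogonal_transformation_id by blast
  then show ?thesis using True by blast
next
  case False
  then obtain x0 where x0: "x0 \<in> U" by blast
  note P = isometric_onD[OF \<psi>] and F = isometric_onD[OF \<phi>]
  have imm: "u = 0" if "x \<in> U" "fd \<psi> x u = 0" for x u
    by (rule isometric_immersion[OF \<psi> pos that]) (use that in auto)
  have imm': "u = 0" if "x \<in> U" "fd \<phi> x u = 0" for x u
    by (rule isometric_immersion[OF \<phi> pos that]) (use that in auto)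
  note right = inv3_right[OF P(5) imm] and left = inv3_left[OF P(5) imm]
  define G where "G l x = fd \<phi> x (inv3 (fd \<psi> x) l)" for l x
  define Q where "Q l = G l x0" for l
  have G: "G l x = Q l" if x: "x \<in> U" for l x
    unfolding Q_def
  proof (rule has_derivative_zero_unique_connected[OF P(1) assms(3) _ x x0])
    fix x assume x: "x \<in> U"
    define w where "w x = inv3 (fd \<psi> x) l" for x
    have smw: "smooth_on U w" unfolding w_def by (rule smooth_on_inv3[OF P(1,2) smooth_on_const imm])
    have Gw: "G l = (\<lambda>x. fd \<phi> x (w x))" by (simp add: G_def w_def fun_eq_iff)
    have sm: "smooth_on U (G l)" unfolding Gw by (rule smooth_on_fd_apply[OF P(1) F(2) smw])
    have "fd (G l) x u = 0" for u
    proof -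
      have e1: "fd (G l) x u = fd (\<lambda>y. fd \<phi> y (w x)) x u + fd \<phi> x (fd w x u)"
        unfolding Gw by (rule fd_fd_apply[OF P(1) F(2) smw x])
      have "fd (\<lambda>y. fd \<psi> y (w y)) x u = fd (\<lambda>y. fd \<psi> y (w x)) x u + fd \<psi> x (fd w x u)"
        by (rule fd_fd_apply[OF P(1,2) smw x])
      moreover have "fd (\<lambda>y. fd \<psi> y (w y)) x = fd (\<lambda>y. l) x"
        by (rule fd_cong[OF P(1) x]) (simp add: w_def right)
      ultimately have e2: "fd (\<lambda>y. fd \<psi> y (w x)) x u + fd \<psi> x (fd w x u) = 0" by simp
      \<comment> \<open>The derivative of \<open>G l\<close> is tested against the vectors
        \<open>fd \<phi> x z\<close>, which fill the space. Each product is transferred to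
        \<open>\<psi>\<close>, where the analogue of \<open>G l\<close> is the constant
        \<open>l\<close>.\<close>
      have "fd (G l) x u \<bullet> fd \<phi> x z = 0" for z
      proof -
        have "2 * (fd (\<lambda>y. fd \<phi> y (w x)) x u \<bullet> fd \<phi> x z) = 2 * (fd (\<lambda>y. fd \<psi> y (w x)) x u \<bullet> fd \<psi> x z)"
          unfolding koszul[OF \<psi> x] koszul[OF \<phi> x] ..
        moreover have "fd \<phi> x (fd w x u) \<bullet> fd \<phi> x z = fd \<psi> x (fd w x u) \<bullet> fd \<psi> x z" using P(3) F(3) x by simp
        moreover have "(fd (\<lambda>y. fd \<psi> y (w x)) x u + fd \<psi> x (fd w x u)) \<bullet> fd \<psi> x z = 0" by (simp add: e2)
        ultimately show ?thesis unfolding e1 by (simp add: inner_add_left)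
      qed
      then have "fd (G l) x u \<bullet> fd (G l) x u = 0" using inv3_right[OF F(5)[OF x] imm'[OF x]] by metis
      then show ?thesis by simp
    qed
    then show "(G l has_derivative (\<lambda>x. 0)) (at x)" using smooth_on_has_derivative[OF sm x] by (metis ext)
  qed
  have Q: "fd \<phi> x v = Q (fd \<psi> x v)" if "x \<in> U" for x v
    using G[OF that, of "fd \<psi> x v"] left[OF that that] by (simp add: G_def)
  have orth: "orthogonal_transformation Q"
  proof -
    have "linear Q"
    proof (rule linearI)
      show "Q (u + v) = Q u + Q v" for u v
        using Q[OF x0] linear_add[OF P(5)[OF x0]] linear_add[OF F(5)[OF x0]] right[OF x0 x0] by metis
      show "Q (r *\<^sub>R u) = r *\<^sub>R Q u" for r u
        using Q[OF x0] linear_cmul[OF P(5)[OF x0]] linear_cmul[OF F(5)[OF x0]] right[OF x0 x0] by metis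
    qed
    moreover have "Q u \<bullet> Q v = u \<bullet> v" for u v
      using Q[OF x0] P(3)[OF x0] F(3)[OF x0] right[OF x0 x0] by metis
    ultimately show ?thesis by (simp add: orthogonal_transformation_def)
  qed
  define b where "b = \<phi> x0 - Q (\<psi> x0)"
  have "\<phi> x - Q (\<psi> x) = b" if x: "x \<in> U" for x
    unfolding b_def
  proof (rule has_derivative_zero_unique_connected[OF P(1) assms(3) _ x x0])
    fix x assume x: "x \<in> U"
    have bl: "bounded_linear Q" using orth orthogonal_transformation_linear linear_conv_bounded_linear by blast
    have "((\<lambda>x. \<phi> x - Q (\<psi> x)) has_derivative (\<lambda>v. fd \<phi> x v - Q (fd \<psi> x v))) (at x)"
      by (intro has_derivative_diff bounded_linear.has_derivative[OF bl] P(4) F(4) x)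
    then show "((\<lambda>x. \<phi> x - Q (\<psi> x)) has_derivative (\<lambda>x. 0)) (at x)" by (simp add: Q[OF x])
  qed
  then have "\<phi> x = Q (\<psi> x) + b" if "x \<in> U" for x using that by (metis diff_add_cancel add.commute)
  then show ?thesis using orth unfolding rigid_def by blast
qed

text \<open>The two maps differ by a rigid motion. Comparing derivatives at a point of
  \<open>V\<close>, its linear part fixes all values of an invertible map, and then its translation
  part vanishes.\<close>

lemma rigidity_unique:
  assumes \<psi>: "isometric_on H U \<psi>" and \<phi>: "isometric_on H U \<phi>" and "connected U"
    and pos: "\<And>x u. x \<in> U \<Longrightarrow> H x u u = 0 \<Longrightarrow> u = 0"
    and V: "open V" "V \<subseteq> U" "V \<noteq> {}" "\<And>x. x \<in> V \<Longrightarrow> \<phi> x = \<psi> x" and x: "x \<in> U"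
  shows "\<phi> x = \<psi> x"
proof -
  obtain Q b where Q: "orthogonal_transformation Q" and eq: "\<And>x. x \<in> U \<Longrightarrow> \<phi> x = Q (\<psi> x) + b"
    using rigidity[OF assms(1-3)] pos unfolding rigid_def by blast
  obtain x0 where x0: "x0 \<in> V" using V by blast
  then have "x0 \<in> U" using V by blast
  note P = isometric_onD[OF \<psi>] and imm = isometric_immersion[OF \<psi> pos[OF \<open>x0 \<in> U\<close>] \<open>x0 \<in> U\<close>]
  have bl: "bounded_linear Q" using Q orthogonal_transformation_linear linear_conv_bounded_linear by blast
  have Qd: "Q (fd \<psi> x0 v) = fd \<psi> x0 v" for v
  proof -
    have "((\<lambda>x. Q (\<psi> x) + b) has_derivative (\<lambda>v. Q (fd \<psi> x0 v) + 0)) (at x0)"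
      by (intro has_derivative_add bounded_linear.has_derivative[OF bl] P(4) \<open>x0 \<in> U\<close> has_derivative_const)
    then have "fd (\<lambda>x. Q (\<psi> x) + b) x0 v = Q (fd \<psi> x0 v)" using fd_eqI by fastforce
    moreover have "fd (\<lambda>x. Q (\<psi> x) + b) x0 = fd \<psi> x0"
      by (rule fd_cong[OF V(1) x0]) (metis V(2,4) eq subsetD)
    ultimately show ?thesis by simp
  qed
  have "Q v = v" for v using Qd inv3_right[OF P(5)[OF \<open>x0 \<in> U\<close>] imm] by metis
  moreover have "b = 0" using eq[OF \<open>x0 \<in> U\<close>] V(4)[OF x0] \<open>\<And>v. Q v = v\<close> by simp
  ultimately show ?thesis using eq[OF x] by simp
qed

section \<open>Gluing local isometries to a developing map\<close>

locale locally_flat =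
  fixes H :: metric3
  assumes pos: "H x u u = 0 \<Longrightarrow> u = 0"
    and loc: "\<exists>U \<psi>. x \<in> U \<and> isometric_on H U \<psi>"
begin

text \<open>One rigid motion matches two local isometries if their common domain is connected.
  Thickening both compact sets by the same \<open>d\<close> makes the overlap the
  \<open>d\<close>-neighbourhood of the convex set \<open>S1 \<inter> S2\<close>, which is
  convex.\<close>

lemma glue:
  assumes 1: "isometric_on H U1 \<psi>1" "S1 \<subseteq> U1" "compact S1" "convex S1"
    and 2: "isometric_on H U2 \<psi>2" "S2 \<subseteq> U2" "compact S2" "convex S2"
    and seg: "\<And>x y. x \<in> S1 \<Longrightarrow> y \<in> S2 \<Longrightarrow> closed_segment x y \<inter> S1 \<inter> S2 \<noteq> {}"
  shows "\<exists>U \<psi>. S1 \<union> S2 \<subseteq> U \<and> isometric_on H U \<psi>"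
proof -
  have op: "open U1" "open U2" using 1 2 isometric_onD by blast+
  obtain d1 where d1: "d1 > 0" "(\<Union>x\<in>S1. ball x d1) \<subseteq> U1"
    using compact_subset_open_imp_ball_epsilon_subset[OF 1(3) op(1) 1(2)] by blast
  obtain d2 where d2: "d2 > 0" "(\<Union>x\<in>S2. ball x d2) \<subseteq> U2"
    using compact_subset_open_imp_ball_epsilon_subset[OF 2(3) op(2) 2(2)] by blast
  define d where "d = min d1 d2"
  have d: "d > 0" "d \<le> d1" "d \<le> d2" using d1 d2 by (auto simp: d_def)
  define V1 V2 N where "V1 = (\<Union>x\<in>S1. ball x d)" and "V2 = (\<Union>x\<in>S2. ball x d)" and "N = (\<Union>x\<in>S1 \<inter> S2. ball x d)"
  have V1: "open V1" "V1 \<subseteq> U1" "S1 \<subseteq> V1"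
    using d1 d subset_ball[OF d(2)] by (auto simp: V1_def)
  have V2: "open V2" "V2 \<subseteq> U2" "S2 \<subseteq> V2"
    using d2 d subset_ball[OF d(3)] by (auto simp: V2_def)
  have NV: "N = V1 \<inter> V2"
  proof
    show "V1 \<inter> V2 \<subseteq> N"
    proof
      \<comment> \<open>Both centres lie in the ball of radius \<open>d\<close> about
        \<open>x\<close>; the segment between them stays there and, by \<open>seg\<close>, meets
        \<open>S1 \<inter> S2\<close>.\<close>
      fix x assume "x \<in> V1 \<inter> V2"
      then obtain s1 s2 where s: "s1 \<in> S1" "s2 \<in> S2" "s1 \<in> ball x d" "s2 \<in> ball x d"
        by (auto simp: V1_def V2_def dist_commute)
      obtain f where f: "f \<in> closed_segment s1 s2" "f \<in> S1" "f \<in> S2" using seg[OF s(1,2)] by blast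
      then have "f \<in> ball x d" using closed_segment_subset[OF s(3,4) convex_ball] by blast
      then show "x \<in> N" using f by (auto simp: N_def dist_commute)
    qed
  qed (auto simp: N_def V1_def V2_def)
  have "convex N"
  proof -
    have "N = (\<Union>x\<in>S1 \<inter> S2. \<Union>y\<in>ball 0 d. {x + y})"
    proof (intro equalityI subsetI)
      fix z assume "z \<in> N"
      then obtain x where "x \<in> S1 \<inter> S2" "dist x z < d" by (auto simp: N_def)
      then show "z \<in> (\<Union>x\<in>S1 \<inter> S2. \<Union>y\<in>ball 0 d. {x + y})"
        by (intro UN_I[of x] UN_I[of "z - x"]) (auto simp: dist_norm norm_minus_commute)
    next
      fix z assume "z \<in> (\<Union>x\<in>S1 \<inter> S2. \<Union>y\<in>ball 0 d. {x + y})"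
      then obtain x y where "z = x + y" "x \<in> S1 \<inter> S2" "norm y < d" by auto
      then show "z \<in> N" unfolding N_def by (intro UN_I[of x]) (auto simp: dist_norm)
    qed
    then show ?thesis using convex_sums[OF convex_Int[OF 1(4) 2(4)] convex_ball] by metis
  qed
  then have "connected N" by (rule convex_connected)
  moreover have "open N" using V1 V2 NV by blast
  ultimately obtain \<tau> where \<tau>: "rigid \<tau>" "\<And>x. x \<in> N \<Longrightarrow> \<psi>1 x = \<tau> (\<psi>2 x)"
    using rigidity[of H N \<psi>2 \<psi>1] isometric_on_subset[OF 1(1), of N] isometric_on_subset[OF 2(1), of N] V1 V2 NV pos by blast
  define \<psi> where "\<psi> x = (if x \<in> V1 then \<psi>1 x else \<tau> (\<psi>2 x))" for x
  have "isometric_on H (V1 \<union> V2) \<psi>"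
  proof (rule isometric_on_local)
    fix x assume "x \<in> V1 \<union> V2"
    then show "\<exists>V \<phi>. x \<in> V \<and> isometric_on H V \<phi> \<and> (\<forall>y\<in>V. \<psi> y = \<phi> y)"
    proof
      assume "x \<in> V1"
      then show ?thesis using isometric_on_subset[OF 1(1) V1(1,2)] by (intro exI[of _ V1] exI[of _ \<psi>1]) (auto simp: \<psi>_def)
    next
      assume "x \<in> V2"
      then show ?thesis using rigid_isometric[OF isometric_on_subset[OF 2(1) V2(1,2)] \<tau>(1)] \<tau>(2) NV
        by (intro exI[of _ V2] exI[of _ "\<lambda>x. \<tau> (\<psi>2 x)"]) (auto simp: \<psi>_def)
    qed
  qed (rule open_Un[OF V1(1) V2(1)])
  moreover have "S1 \<union> S2 \<subseteq> V1 \<union> V2" using V1(3) V2(3) by blast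
  ultimately show ?thesis by blast
qed

text \<open>The admissible side length is doubled one coordinate at a time: a box is halved across
  one side and the halves are glued. The start is a Lebesgue number for the domains of the local
  isometries.\<close>

lemma isometric_box: "\<exists>U \<psi>. cbox a b \<subseteq> U \<and> isometric_on H U \<psi>"
proof -
  define P where "P a b \<longleftrightarrow> (\<exists>U \<psi>. cbox a b \<subseteq> U \<and> isometric_on H U \<psi>)" for a b
  define R where "R h \<longleftrightarrow> (\<forall>a' b'. cbox a' b' \<subseteq> cbox a b \<longrightarrow> (\<forall>i. b' $ i - a' $ i \<le> h i) \<longrightarrow> P a' b')" for h :: "3 \<Rightarrow> real"
  have step: "R (h(i := 2 * h i))" if "R h" for h i
    unfolding R_def
  proof (intro allI impI)
    fix a' b' assume sub: "cbox a' b' \<subseteq> cbox a b" and w: "\<forall>j. b' $ j - a' $ j \<le> (h(i := 2 * h i)) j"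
    show "P a' b'"
    proof (cases "cbox a' b' = {}")
      case True
      then show ?thesis unfolding P_def using loc by blast
    next
      case False
      then have le: "a' $ j \<le> b' $ j" for j unfolding interval_ne_empty_cart by blast
      define c where "c = (a' $ i + b' $ i) / 2"
      have c: "a' $ i \<le> c" "c \<le> b' $ i" using le[of i] by (auto simp: c_def)
      define b1 a2 where "b1 = (\<chi> j. if j = i then c else b' $ j)" and "a2 = (\<chi> j. if j = i then c else a' $ j)"
      have mem1: "x \<in> cbox a' b1 \<longleftrightarrow> x \<in> cbox a' b' \<and> x $ i \<le> c" for x
      proof
        assume L: "x \<in> cbox a' b1"
        have "a' $ j \<le> x $ j \<and> x $ j \<le> b' $ j" for j
          using L[unfolded mem_box_cart, rule_format, of j] c by (cases "j = i") (auto simp: b1_def)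
        moreover have "x $ i \<le> c" using L[unfolded mem_box_cart, rule_format, of i] by (simp add: b1_def)
        ultimately show "x \<in> cbox a' b' \<and> x $ i \<le> c" by (simp add: mem_box_cart)
      qed (auto simp: mem_box_cart b1_def)
      have mem2: "x \<in> cbox a2 b' \<longleftrightarrow> x \<in> cbox a' b' \<and> c \<le> x $ i" for x
      proof
        assume L: "x \<in> cbox a2 b'"
        have "a' $ j \<le> x $ j \<and> x $ j \<le> b' $ j" for j
          using L[unfolded mem_box_cart, rule_format, of j] c by (cases "j = i") (auto simp: a2_def)
        moreover have "c \<le> x $ i" using L[unfolded mem_box_cart, rule_format, of i] by (simp add: a2_def)
        ultimately show "x \<in> cbox a' b' \<and> c \<le> x $ i" by (simp add: mem_box_cart)
      qed (auto simp: mem_box_cart a2_def)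
      have "P a' b1" "P a2 b'"
      proof -
        have "b1 $ j - a' $ j \<le> h j \<and> b' $ j - a2 $ j \<le> h j" for j
          using w[rule_format, of j] by (cases "j = i") (auto simp: b1_def a2_def c_def field_simps)
        then have "\<forall>j. b1 $ j - a' $ j \<le> h j" "\<forall>j. b' $ j - a2 $ j \<le> h j" by blast+
        then show "P a' b1" "P a2 b'" using that sub mem1 mem2 unfolding R_def by blast+
      qed
      then obtain U1 \<psi>1 U2 \<psi>2 where U: "cbox a' b1 \<subseteq> U1" "isometric_on H U1 \<psi>1" "cbox a2 b' \<subseteq> U2" "isometric_on H U2 \<psi>2"
        unfolding P_def by blast
      have "\<exists>U \<psi>. cbox a' b1 \<union> cbox a2 b' \<subseteq> U \<and> isometric_on H U \<psi>"
      proof (rule glue[OF U(2,1) compact_cbox convex_box(1) U(4,3) compact_cbox convex_box(1)])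
        fix x y assume x: "x \<in> cbox a' b1" and y: "y \<in> cbox a2 b'"
        have xy: "x \<in> cbox a' b'" "y \<in> cbox a' b'" "x $ i \<le> c" "c \<le> y $ i" using x y mem1 mem2 by auto
        \<comment> \<open>The parameter of the point of the segment on the cutting plane; if the two
          coordinates agree, both equal \<open>c\<close> and every \<open>t\<close> will do.\<close>
        define t where "t = (if x $ i = y $ i then 0 else (c - x $ i) / (y $ i - x $ i))"
        have t: "0 \<le> t" "t \<le> 1" "x $ i + t * (y $ i - x $ i) = c"
          using xy by (auto simp: t_def divide_simps)
        define f where "f = (1 - t) *\<^sub>R x + t *\<^sub>R y"
        have "f \<in> closed_segment x y" unfolding closed_segment_def f_def using t by blast
        moreover have "f \<in> cbox a' b'" using calculation closed_segment_subset[OF xy(1,2) convex_box(1)] by blast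
        moreover have "f $ i = c" using t(3) by (simp add: f_def algebra_simps)
        ultimately show "closed_segment x y \<inter> cbox a' b1 \<inter> cbox a2 b' \<noteq> {}" using mem1 mem2 by auto
      qed
      moreover have "cbox a' b1 \<union> cbox a2 b' = cbox a' b'" using mem1 mem2 by auto
      ultimately show ?thesis unfolding P_def by simp
    qed
  qed
  have dbl: "R (\<lambda>_. 2 * e)" if "R (\<lambda>_. e)" for e
  proof -
    have "R ((\<lambda>_. e)(1 := 2 * e, 2 := 2 * e, 3 := 2 * e))"
      using step[OF step[OF step[OF that, of 1], of 2], of 3] by (simp add: fun_upd_def)
    moreover have "(\<lambda>_. e)(1 := 2 * e, 2 := 2 * e, 3 := 2 * e) = (\<lambda>_::3. 2 * e)"
      by (simp add: fun_eq_iff forall_3)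
    ultimately show ?thesis by simp
  qed
  have pow: "R (\<lambda>_. 2 ^ n * e)" if "R (\<lambda>_. e)" for e n
    using that by (induction n) (auto dest: dbl simp: mult.assoc)
  show ?thesis
  proof (cases "cbox a b = {}")
    case True
    then show ?thesis using loc by blast
  next
    case False
    obtain Us \<psi>s where loc': "\<And>x. x \<in> Us x \<and> isometric_on H (Us x) (\<psi>s x)" using loc by metis
    obtain d where d: "d > 0" "\<And>T. T \<subseteq> cbox a b \<Longrightarrow> diameter T < d \<Longrightarrow> \<exists>B\<in>range Us. T \<subseteq> B"
    proof (rule Lebesgue_number_lemma[OF compact_cbox, of "range Us" a b])
      show "cbox a b \<subseteq> \<Union> (range Us)" using loc' by blast
      show "open B" if "B \<in> range Us" for B using that loc' isometric_onD(1) by blast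
    qed blast+
    \<comment> \<open>By the sum norm a box in three-space with sides at most \<open>d / 6\<close>
      has diameter at most \<open>d / 2\<close>, strictly below the Lebesgue number.\<close>
    have "R (\<lambda>_. d / 6)"
      unfolding R_def
    proof (intro allI impI)
      fix a' b' assume sub: "cbox a' b' \<subseteq> cbox a b" and w: "\<forall>i. b' $ i - a' $ i \<le> d / 6"
      have "diameter (cbox a' b') < d"
      proof (cases "cbox a' b' = {}")
        case False
        have "diameter (cbox a' b') \<le> d / 2"
        proof (rule diameter_le)
          fix x y assume "x \<in> cbox a' b'" "y \<in> cbox a' b'"
          then have "a' $ i \<le> x $ i" "x $ i \<le> b' $ i" "a' $ i \<le> y $ i" "y $ i \<le> b' $ i" for i
            by (simp_all add: mem_box_cart)
          then have xy: "\<bar>x $ i - y $ i\<bar> \<le> b' $ i - a' $ i" for i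
            unfolding abs_le_iff by (simp add: diff_mono)
          have "\<bar>(x - y) $ i\<bar> \<le> d / 6" for i
            using order_trans[OF xy[of i] w[rule_format, of i]] by simp
          then have "(\<Sum>i\<in>UNIV. \<bar>(x - y) $ i\<bar>) \<le> (\<Sum>i\<in>(UNIV::3 set). d / 6)" by (intro sum_mono) auto
          then show "norm (x - y) \<le> d / 2" using norm_le_l1_cart[of "x - y"] by simp
        qed (use d in auto)
        then show ?thesis using d by simp
      qed (use d in simp)
      then show "P a' b'" using d(2)[OF sub] loc' unfolding P_def by blast
    qed
    moreover obtain n where n: "(\<Sum>i\<in>UNIV. \<bar>b $ i - a $ i\<bar>) / (d / 6) < 2 ^ n" using real_arch_pow[of 2] by auto
    ultimately have Rn: "R (\<lambda>_. 2 ^ n * (d / 6))" using pow by blast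
    have "b $ i - a $ i \<le> 2 ^ n * (d / 6)" for i
    proof -
      have "\<bar>b $ i - a $ i\<bar> \<le> (\<Sum>i\<in>UNIV. \<bar>b $ i - a $ i\<bar>)"
        by (rule member_le_sum) auto
      moreover have "(\<Sum>i\<in>UNIV. \<bar>b $ i - a $ i\<bar>) < 2 ^ n * (d / 6)"
        using n d(1) by (simp add: divide_less_eq)
      ultimately show ?thesis by linarith
    qed
    then have "P a b" using Rn[unfolded R_def, rule_format, of a b] by simp
    then show ?thesis by (simp only: P_def)
  qed
qed

text \<open>Isometries of an exhausting sequence of balls are normalised to agree on the smallest
  one; by \<open>rigidity_unique\<close> each of them then extends its predecessors.\<close>

lemma developing_map: "\<exists>D. isometric_on H UNIV D"
proof -
  \<comment> \<open>The radius \<open>Suc n\<close> makes \<open>B 0\<close> nonempty, as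
    \<open>rigidity_unique\<close> demands.\<close>
  define B where "B n = ball (0::real^3) (real (Suc n))" for n
  have B: "open (B n)" "connected (B n)" for n by (simp_all add: B_def)
  have Bmono: "B m \<subseteq> B n" if "m \<le> n" for m n using that by (auto simp: B_def)
  have ex: "\<exists>\<psi>. isometric_on H (B n) \<psi>" for n
  proof -
    obtain a where "B n \<subseteq> cbox (-a) a" using bounded_subset_cbox_symmetric[of "B n"] by (auto simp: B_def)
    then show ?thesis using isometric_box[of "-a" a] isometric_on_subset[OF _ B(1)] by blast
  qed
  obtain \<psi> where \<psi>: "isometric_on H (B 0) \<psi>" using ex by blast
  have "\<exists>\<phi>. isometric_on H (B n) \<phi> \<and> (\<forall>x\<in>B 0. \<phi> x = \<psi> x)" for n
  proof -
    obtain \<phi> where \<phi>: "isometric_on H (B n) \<phi>" using ex by blast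
    have "isometric_on H (B 0) \<phi>" by (rule isometric_on_subset[OF \<phi> B(1) Bmono]) simp
    then obtain \<tau> where "rigid \<tau>" "\<forall>x\<in>B 0. \<psi> x = \<tau> (\<phi> x)"
      using rigidity[OF _ \<psi> B(2)] pos by blast
    then show ?thesis using rigid_isometric[OF \<phi>] by (intro exI[of _ "\<lambda>x. \<tau> (\<phi> x)"]) auto
  qed
  then obtain \<Phi> where \<Phi>: "\<And>n. isometric_on H (B n) (\<Phi> n)" "\<And>n x. x \<in> B 0 \<Longrightarrow> \<Phi> n x = \<psi> x" by metis
  have agree: "\<Phi> n x = \<Phi> m x" if "m \<le> n" "x \<in> B m" for m n x
  proof (rule rigidity_unique[of H "B m" "\<Phi> m" "\<Phi> n" "B 0"])
    show "isometric_on H (B m) (\<Phi> n)" by (rule isometric_on_subset[OF \<Phi>(1) B(1) Bmono[OF that(1)]])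
    show "B 0 \<subseteq> B m" by (rule Bmono) simp
    show "B 0 \<noteq> {}" by (simp add: B_def)
    show "\<Phi> n z = \<Phi> m z" if "z \<in> B 0" for z using \<Phi>(2)[OF that] by simp
  qed (rule \<Phi>(1) B pos that, assumption?)+
  define k where "k x = (LEAST n. x \<in> B n)" for x
  have kB: "x \<in> B (k x)" for x
  proof -
    obtain n where "norm x < real n" using reals_Archimedean2 by blast
    then have "x \<in> B n" by (simp add: B_def)
    then show ?thesis unfolding k_def by (rule LeastI)
  qed
  define D where "D x = \<Phi> (k x) x" for x
  have D: "D y = \<Phi> n y" if "y \<in> B n" for n y
  proof -
    have "k y \<le> n" unfolding k_def by (rule Least_le) (rule that)
    then show ?thesis unfolding D_def using agree[OF _ kB] by metis
  qed
  have "isometric_on H UNIV D"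
  proof (rule isometric_on_local)
    show "\<exists>V \<psi>. x \<in> V \<and> isometric_on H V \<psi> \<and> (\<forall>y\<in>V. D y = \<psi> y)" for x
      by (intro exI[of _ "B (k x)"] exI[of _ "\<Phi> (k x)"] conjI ballI kB \<Phi>(1) D)
  qed simp
  then show ?thesis by blast
qed

end

text \<open>
  \<open>E k x\<close> stands for \<open>p k = p x\<close>, where \<open>p\<close> is the covering map, and \<open>\<delta>\<close> is the change of sheets
  over an evenly covered set. That \<open>W\<close> is the same for all pairs of sheets makes the radius of
  the local inverses of a developing map uniform.
\<close>

definition locally_related_isometrically :: "metric3 \<Rightarrow> (real^3 \<Rightarrow> real^3 \<Rightarrow> bool) \<Rightarrow> bool" where
  "locally_related_isometrically H E \<longleftrightarrow> (\<forall>x0. \<exists>W. open W \<and> x0 \<in> W \<and> (\<forall>k\<in>W. \<forall>x. E k x \<longrightarrow>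
    (\<exists>\<delta>. smooth_on W \<delta> \<and> \<delta> k = x \<and> (\<forall>y\<in>W. E y (\<delta> y) \<and> (\<forall>u v. H (\<delta> y) (fd \<delta> y u) (fd \<delta> y v) = H y u v)))))"

section \<open>Completeness and bijectivity of the developing map\<close>

lemma local_inverse:
  fixes f :: "real^3 \<Rightarrow> real^3"
  assumes "open U" "smooth_on U f" "x \<in> U" and imm: "\<And>y v. y \<in> U \<Longrightarrow> fd f y v = 0 \<Longrightarrow> v = 0"
  obtains U' g where "open U'" "U' \<subseteq> U" "x \<in> U'" "open (f ` U')" "smooth_on (f ` U') g" "\<And>y. y \<in> U' \<Longrightarrow> g (f y) = y"
proof -
  have lin: "linear (fd f y)" if "y \<in> U" for y by (rule smooth_on_linear_fd[OF assms(2) that])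
  have bl: "bounded_linear (fd f y)" if "y \<in> U" for y using lin[OF that] linear_conv_bounded_linear by blast
  have linv: "linear (inv3 (fd f x))" by (rule linear_inv3[OF lin imm]) (use assms(3) in auto)
  have "Blinfun (inv3 (fd f x)) o\<^sub>L Blinfun (fd f x) = id_blinfun"
    using inv3_left[OF lin imm] assms(3) linv bl
    by (intro blinfun_eqI) (simp add: bounded_linear_Blinfun_apply linear_conv_bounded_linear)
  then obtain U' V g where U': "open U'" "U' \<subseteq> U" "x \<in> U'" "homeomorphism U' V f g"
    using inverse_function_theorem[of U f "\<lambda>y. Blinfun (fd f y)" x "Blinfun (inv3 (fd f x))"]
      assms(1,3) fd_continuous_blinfun[OF assms(1,2)] smooth_on_has_derivative[OF assms(2)] bl
    by (metis bounded_linear_Blinfun_apply)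
  have gf: "g (f y) = y" if "y \<in> U'" for y using U'(4) that by (simp add: homeomorphism_def)
  then have inj: "inj_on f U'" by (metis inj_onI)
  have imm': "v = 0" if "y \<in> U'" "fd f y v = 0" for y v using imm U'(2) that by blast
  note inv = smooth_on_inverse_function[OF U'(1) smooth_on_subset[OF assms(2) U'(2)] inj imm' gf]
  show ?thesis by (rule that[OF U'(1-3) inv(1) inv(2) gf])
qed

lemma isometric_on_id: "open U \<Longrightarrow> isometric_on (\<lambda>x u v. u \<bullet> v) U (\<lambda>x. x)"
  by (simp add: isometric_on_def)

lemma rigid_bij:
  assumes "rigid \<tau>"
  obtains \<sigma> where "rigid \<sigma>" "\<And>x. \<sigma> (\<tau> x) = x" "\<And>x. \<tau> (\<sigma> x) = x" "\<And>x y. dist (\<tau> x) (\<tau> y) = dist x y"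
proof -
  obtain Q b where Q: "orthogonal_transformation Q" "\<tau> = (\<lambda>x. Q x + b)" using assms by (auto simp: rigid_def)
  define R where "R = inv Q"
  have R: "orthogonal_transformation R" "\<And>x. R (Q x) = x" "\<And>x. Q (R x) = x"
    using Q(1) orthogonal_transformation_inv orthogonal_transformation_bij
    unfolding R_def by (blast, metis inv_f_f bij_is_inj, metis surj_f_inv_f bij_is_surj)
  have lR: "linear R" using R(1) orthogonal_transformation_linear by blast
  show ?thesis
  proof (rule that[of "\<lambda>x. R x + - R b"])
    show "rigid (\<lambda>x. R x + - R b)" unfolding rigid_def using R(1) by blast
    show "R (\<tau> x) + - R b = x" for x by (simp add: Q(2) linear_add[OF lR] R)
    show "\<tau> (R x + - R b) = x" for x
      using orthogonal_transformation_linear[OF Q(1)] by (simp add: Q(2) linear_diff R)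
    show "dist (\<tau> x) (\<tau> y) = dist x y" for x y
      using Q(1)[unfolded orthogonal_transformation_isometry] by (simp add: Q(2))
  qed
qed

text \<open>\<open>K\<close> meets every class of \<open>E\<close>: this is compactness of the
  quotient, expressed on the cover and through local changes of sheets instead of a group
  action.\<close>

locale complete_flat = locally_flat +
  fixes E :: "real^3 \<Rightarrow> real^3 \<Rightarrow> bool" and K :: "(real^3) set"
  assumes K: "compact K" "\<exists>k\<in>K. E k x"
    and E: "locally_related_isometrically H E"
begin

text \<open>A local inverse \<open>g\<close> of \<open>D\<close> near \<open>x0\<close> is carried
  to every related point \<open>x\<close>: the map \<open>D \<circ> \<delta> \<circ> g\<close> is a
  Euclidean isometry, hence a rigid motion \<open>\<tau>\<close>, and with its inverse
  \<open>\<sigma>\<close> the map \<open>\<delta> \<circ> g \<circ> \<sigma>\<close> is a local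
  inverse on a ball of the same radius about \<open>D x\<close>. By compactness of \<open>K\<close>
  finitely many \<open>x0\<close> suffice.\<close>

lemma uniform_sections:
  assumes D: "isometric_on H UNIV D"
  shows "\<exists>e>0. \<forall>x. \<exists>s. smooth_on (ball (D x) e) s \<and> s (D x) = x \<and> (\<forall>y\<in>ball (D x) e. D (s y) = y)"
proof -
  note DD = isometric_onD[OF D]
  have imm: "v = 0" if "fd D y v = 0" for y v by (rule isometric_immersion[OF D pos _ that]) auto
  have local: "\<exists>N e. open N \<and> x0 \<in> N \<and> e > 0 \<and> (\<forall>k\<in>N. \<forall>x. E k x \<longrightarrow>
      (\<exists>s. smooth_on (ball (D x) e) s \<and> s (D x) = x \<and> (\<forall>y\<in>ball (D x) e. D (s y) = y)))" for x0
  proof -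
    obtain W where W: "open W" "x0 \<in> W" and \<delta>: "\<And>k x. k \<in> W \<Longrightarrow> E k x \<Longrightarrow>
      \<exists>\<delta>. smooth_on W \<delta> \<and> \<delta> k = x \<and> (\<forall>y\<in>W. E y (\<delta> y) \<and> (\<forall>u v. H (\<delta> y) (fd \<delta> y u) (fd \<delta> y v) = H y u v))"
      using E unfolding locally_related_isometrically_def by metis
    obtain U g where U: "open U" "U \<subseteq> W" "x0 \<in> U" "open (D ` U)" "smooth_on (D ` U) g" "\<And>y. y \<in> U \<Longrightarrow> g (D y) = y"
      using local_inverse[OF W(1) smooth_on_subset[OF DD(2) subset_UNIV] W(2)] imm by metis
    obtain r where r: "r > 0" "ball (D x0) r \<subseteq> D ` U" using U(3,4) openE by blast
    \<comment> \<open>Half the radius, so that the ball of radius \<open>e\<close> about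
      \<open>D k\<close> stays in the domain of \<open>g\<close> for every \<open>k\<close> in
      \<open>N\<close>.\<close>
    define e where "e = r / 2"
    define N where "N = U \<inter> D -` ball (D x0) e"
    have "open N"
      unfolding N_def using U(1) DD(2) smooth_on_continuous by (intro open_Int open_vimage) auto
    moreover have "x0 \<in> N" "e > 0" using r U by (auto simp: N_def e_def)
    moreover have "\<exists>s. smooth_on (ball (D x) e) s \<and> s (D x) = x \<and> (\<forall>y\<in>ball (D x) e. D (s y) = y)"
      if k: "k \<in> N" and kx: "E k x" for k x
    proof -
      have kU: "k \<in> U" and kd: "dist (D x0) (D k) < e" using k by (auto simp: N_def)
      have sub: "ball (D k) e \<subseteq> D ` U"
      proof
        fix y assume "y \<in> ball (D k) e"
        then have "dist (D x0) y < r" using kd dist_triangle[of "D x0" y "D k"] by (simp add: e_def)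
        then show "y \<in> D ` U" using r by auto
      qed
      have gU: "g y \<in> U" "D (g y) = y" if "y \<in> D ` U" for y using that U(6) by auto
      obtain \<delta> where d: "smooth_on W \<delta>" "\<delta> k = x" "\<And>y u v. y \<in> W \<Longrightarrow> H (\<delta> y) (fd \<delta> y u) (fd \<delta> y v) = H y u v"
        using \<delta>[of k x] kU U(2) kx by blast
      define B where "B = ball (D k) e"
      have B: "open B" "connected B" "D k \<in> B" using \<open>e > 0\<close> by (simp_all add: B_def)
      have smg: "smooth_on B g" by (rule smooth_on_subset[OF U(5) sub[folded B_def]])
      define h where "h y = \<delta> (g y)" for y
      have smh: "smooth_on B h"
        unfolding h_def
        by (rule smooth_on_compose[OF d(1) smg B(1) W(1)]) (use gU(1) sub[folded B_def] U(2) in blast)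
      have smDh: "smooth_on B (\<lambda>y. D (h y))" by (rule smooth_on_compose[OF DD(2) smh B(1)]) auto
      have iso: "isometric_on (\<lambda>x u v. u \<bullet> v) B (\<lambda>y. D (h y))"
        unfolding isometric_on_def
      proof (intro conjI ballI allI B smDh)
        fix y u v assume y: "y \<in> B"
        have "y \<in> D ` U" using sub y unfolding B_def by blast
        then have gy: "g y \<in> U" "g y \<in> W" "D (g y) = y" using gU U(2) by blast+
        have dg: "(g has_derivative fd g y) (at y)" by (rule smooth_on_has_derivative[OF smg y])
        have dd: "(\<delta> has_derivative fd \<delta> (g y)) (at (g y))" by (rule smooth_on_has_derivative[OF d(1) gy(2)])
        have dD: "(D has_derivative fd D z) (at z)" for z by (rule DD(4)) simp
        have 1: "fd h y w = fd \<delta> (g y) (fd g y w)" for w unfolding h_def by (rule fd_compose[OF dg dd])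
        have dh: "(h has_derivative fd h y) (at y)" by (rule smooth_on_has_derivative[OF smh y])
        have 2: "fd (\<lambda>y. D (h y)) y w = fd D (h y) (fd h y w)" for w by (rule fd_compose[OF dh dD])
        have 3: "fd D (g y) (fd g y w) = w" for w
        proof -
          have "fd (\<lambda>y. D (g y)) y w = fd D (g y) (fd g y w)" by (rule fd_compose[OF dg dD])
          moreover have "fd (\<lambda>y. D (g y)) y = fd (\<lambda>y. y) y"
            by (rule fd_cong[OF B(1) y]) (use gU sub[folded B_def] in blast)
          ultimately show ?thesis by simp
        qed
        have "fd (\<lambda>y. D (h y)) y u \<bullet> fd (\<lambda>y. D (h y)) y v = H (h y) (fd h y u) (fd h y v)"
          unfolding 2 by (rule DD(3)) simp
        also have "\<dots> = H (g y) (fd g y u) (fd g y v)" unfolding 1 h_def by (rule d(3)[OF gy(2)])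
        also have "\<dots> = u \<bullet> v" using DD(3)[of "g y" "fd g y u" "fd g y v"] 3 by simp
        finally show "fd (\<lambda>y. D (h y)) y u \<bullet> fd (\<lambda>y. D (h y)) y v = u \<bullet> v" .
      qed
      obtain \<tau> where \<tau>: "rigid \<tau>" "\<And>y. y \<in> B \<Longrightarrow> D (h y) = \<tau> y"
        using rigidity[OF isometric_on_id[OF B(1)] iso B(2)] by auto
      obtain \<sigma> where \<sigma>: "rigid \<sigma>" "\<And>x. \<sigma> (\<tau> x) = x" "\<And>x. \<tau> (\<sigma> x) = x" "\<And>x y. dist (\<tau> x) (\<tau> y) = dist x y"
        using rigid_bij[OF \<tau>(1)] by metis
      have hk: "h (D k) = x" using U(6)[OF kU] d(2) by (simp add: h_def)
      then have Dx: "D x = \<tau> (D k)" using \<tau>(2)[OF B(3)] by simp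
      have \<sigma>B: "\<sigma> y \<in> B" if "y \<in> ball (D x) e" for y
        using that \<sigma>(4)[of "D k" "\<sigma> y"] by (simp add: B_def Dx \<sigma>(3))
      show ?thesis
      proof (intro exI[of _ "\<lambda>y. h (\<sigma> y)"] conjI ballI)
        have "isometric_on (\<lambda>x u v. u \<bullet> v) UNIV \<sigma>"
          using rigid_isometric[OF isometric_on_id[OF open_UNIV] \<sigma>(1)] .
        then have "smooth_on (ball (D x) e) \<sigma>" using isometric_onD(2) smooth_on_subset by blast
        then show "smooth_on (ball (D x) e) (\<lambda>y. h (\<sigma> y))"
          by (rule smooth_on_compose[OF smh _ open_ball B(1)]) (use \<sigma>B in auto)
        show "h (\<sigma> (D x)) = x" by (simp add: Dx \<sigma>(2) hk)
        show "D (h (\<sigma> y)) = y" if "y \<in> ball (D x) e" for y using \<tau>(2)[OF \<sigma>B[OF that]] \<sigma>(3) by simp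
      qed
    qed
    ultimately show ?thesis by blast
  qed
  then obtain N e where Ne: "\<And>x. open (N x) \<and> x \<in> N x \<and> e x > (0::real)"
    "\<And>x0 k x. k \<in> N x0 \<Longrightarrow> E k x \<Longrightarrow>
      (\<exists>s. smooth_on (ball (D x) (e x0)) s \<and> s (D x) = x \<and> (\<forall>y\<in>ball (D x) (e x0). D (s y) = y))"
    by metis
  obtain C where C: "C \<subseteq> K" "finite C" "K \<subseteq> (\<Union>c\<in>C. N c)"
    using compactE_image[OF K(1), of K N] Ne(1) by (metis UN_I subsetI)
  have "C \<noteq> {}" using C K(2) by blast
  define \<epsilon> where "\<epsilon> = Min (e ` C)"
  have \<epsilon>: "\<epsilon> > 0" "\<And>c. c \<in> C \<Longrightarrow> \<epsilon> \<le> e c" using C \<open>C \<noteq> {}\<close> Ne(1) by (auto simp: \<epsilon>_def)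
  have "\<exists>s. smooth_on (ball (D x) \<epsilon>) s \<and> s (D x) = x \<and> (\<forall>y\<in>ball (D x) \<epsilon>. D (s y) = y)" for x
  proof -
    obtain k c where kc: "E k x" "c \<in> C" "k \<in> N c" using K(2)[of x] C(3) by blast
    obtain s where s: "smooth_on (ball (D x) (e c)) s" "s (D x) = x" "\<forall>y\<in>ball (D x) (e c). D (s y) = y"
      using Ne(2)[OF kc(3,1)] by blast
    have "ball (D x) \<epsilon> \<subseteq> ball (D x) (e c)" using \<epsilon>(2)[OF kc(2)] by auto
    then show ?thesis using s smooth_on_subset by blast
  qed
  then show ?thesis using \<epsilon>(1) by blast
qed

text \<open>Uniqueness of sections of a local homeomorphism: the set of agreement is closed by
  continuity, and open because \<open>D\<close> is injective near the common value.\<close>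

lemma sections_agree:
  fixes s s' :: "real^3 \<Rightarrow> real^3"
  assumes D: "isometric_on H UNIV D" and T: "connected T" "continuous_on T s" "continuous_on T s'"
    and sec: "\<And>y. y \<in> T \<Longrightarrow> D (s y) = y" "\<And>y. y \<in> T \<Longrightarrow> D (s' y) = y"
    and a: "a \<in> T" "s a = s' a" and y: "y \<in> T"
  shows "s y = s' y"
proof -
  define Z where "Z = {y \<in> T. s y = s' y}"
  have imm: "v = 0" if "fd D y v = 0" for y v by (rule isometric_immersion[OF D pos _ that]) auto
  have "closedin (top_of_set T) Z"
  proof -
    have "Z = {y \<in> T. s y - s' y = 0}" by (auto simp: Z_def)
    then show ?thesis
      using continuous_closedin_preimage_constant[OF continuous_on_diff[OF T(2,3)], of 0] by metis
  qed
  moreover have "openin (top_of_set T) Z"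
  proof (subst openin_subopen, intro ballI)
    fix z assume z: "z \<in> Z"
    obtain U g where U: "open U" "s z \<in> U" "\<And>y. y \<in> U \<Longrightarrow> g (D y) = y"
      using local_inverse[OF open_UNIV isometric_onD(2)[OF D] UNIV_I] imm by metis
    have "openin (top_of_set T) (T \<inter> s -` U \<inter> (T \<inter> s' -` U))"
      by (intro openin_Int continuous_openin_preimage_gen T U)
    moreover have "z \<in> T \<inter> s -` U \<inter> (T \<inter> s' -` U)" using z U(2) by (auto simp: Z_def)
    moreover have "T \<inter> s -` U \<inter> (T \<inter> s' -` U) \<subseteq> Z"
    proof
      fix w assume w: "w \<in> T \<inter> s -` U \<inter> (T \<inter> s' -` U)"
      then have "s w = g w" "s' w = g w" using U(3)[of "s w"] U(3)[of "s' w"] sec by auto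
      then show "w \<in> Z" using w by (simp add: Z_def)
    qed
    ultimately show "\<exists>W. openin (top_of_set T) W \<and> z \<in> W \<and> W \<subseteq> Z" by blast
  qed
  ultimately have "Z = {} \<or> Z = T" using T(1) by (simp add: connected_clopen)
  then show ?thesis using a y by (auto simp: Z_def)
qed

lemma covering_developing_map:
  assumes D: "isometric_on H UNIV D"
  shows "covering_space UNIV D UNIV"
proof -
  obtain e S where e: "e > 0" and S: "\<And>x. smooth_on (ball (D x) e) (S x)" "\<And>x. S x (D x) = x"
    "\<And>x y. y \<in> ball (D x) e \<Longrightarrow> D (S x y) = y"
    using uniform_sections[OF D] by metis
  have contD: "continuous_on UNIV D" by (rule smooth_on_continuous[OF isometric_onD(2)[OF D]])
  have contS: "continuous_on T (S x)" if "T \<subseteq> ball (D x) e" for T x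
    using smooth_on_continuous[OF S(1)] continuous_on_subset that by blast
  show ?thesis
  proof (rule covering_spaceI[OF contD])
    \<comment> \<open>Distance is symmetric: if \<open>D x\<close> were within \<open>e\<close> of
      \<open>y\<close>, the section at \<open>x\<close> would be defined at \<open>y\<close> and put
      \<open>y\<close> into the range.\<close>
    have "open (- range D)"
      unfolding open_contains_ball
    proof (intro ballI)
      fix y assume y: "y \<in> - range D"
      have "D x \<notin> ball y e" for x
      proof
        assume "D x \<in> ball y e"
        then have "D (S x y) = y" using S(3) by (simp add: dist_commute)
        then show False using y by (metis ComplD rangeI)
      qed
      then show "\<exists>e>0. ball y e \<subseteq> - range D" using e by blast
    qed
    then have "closed (range D)" by (simp add: closed_def)
    moreover have "open (range D)"
      unfolding open_contains_ball
    proof (intro ballI)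
      fix y assume "y \<in> range D"
      then obtain x where "y = D x" by blast
      have "ball y e \<subseteq> range D"
      proof
        fix z assume "z \<in> ball y e"
        then have "z = D (S x z)" using S(3)[of z x] \<open>y = D x\<close> by simp
        then show "z \<in> range D" by (rule range_eqI)
      qed
      then show "\<exists>e>0. ball y e \<subseteq> range D" using e by blast
    qed
    ultimately show "range D = UNIV" using clopen by blast
  next
    fix y :: "real^3"
    \<comment> \<open>With half the radius, \<open>T\<close> lies in the ball of radius
      \<open>e\<close> about each of its points, so the section through any point over
      \<open>T\<close> is defined on all of \<open>T\<close>.\<close>
    define T where "T = ball y (e / 2)"
    have T: "y \<in> T" "open T" "connected T" using e by (simp_all add: T_def)
    have sub: "T \<subseteq> ball (D z) e" if "D z \<in> T" for z
    proof
      fix w assume "w \<in> T"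
      then have "dist y w < e / 2" "dist y (D z) < e / 2" using that by (auto simp: T_def)
      then show "w \<in> ball (D z) e" using dist_triangle[of "D z" w y] by (simp add: dist_commute)
    qed
    define F where "F = {x. D x = y}"
    have F: "T \<subseteq> ball (D x) e" if "x \<in> F" for x using sub[of x] that T(1) by (simp add: F_def)
    have agree: "S x t = S z t" if "D x \<in> T" "D z \<in> T" "S x a = S z a" "a \<in> T" "t \<in> T" for x z a t
      by (rule sections_agree[OF D T(3) contS[OF sub[OF that(1)]] contS[OF sub[OF that(2)]] _ _ that(4,3,5)])
        (use S(3) sub that in blast)+
    have DS: "D (S x t) = t" if "x \<in> F" "t \<in> T" for x t using S(3) F that by blast
    show "\<exists>T. y \<in> T \<and> openin (top_of_set UNIV) T \<and>
        (\<exists>v. \<Union>v = UNIV \<inter> D -` T \<and> (\<forall>u\<in>v. openin (top_of_set UNIV) u) \<and>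
           pairwise disjnt v \<and> (\<forall>u\<in>v. \<exists>q. homeomorphism u T D q))"
    proof (rule exI[of _ T], intro conjI exI[of _ "(\<lambda>x. S x ` T) ` F"])
      show "\<Union> ((\<lambda>x. S x ` T) ` F) = UNIV \<inter> D -` T"
      proof (intro equalityI subsetI)
        fix z assume "z \<in> UNIV \<inter> D -` T"
        then have z: "D z \<in> T" by simp
        define x where "x = S z y"
        have x: "x \<in> F" using S(3)[of y z] sub[OF z] T(1) by (auto simp: F_def x_def)
        have "S x y = S z y" using S(2)[of x] x by (simp add: F_def x_def)
        then have "S x (D z) = S z (D z)" using agree[OF _ z _ T(1) z] x T(1) by (simp add: F_def)
        then have "z = S x (D z)" using S(2) by simp
        then show "z \<in> \<Union> ((\<lambda>x. S x ` T) ` F)" using x z by blast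
      qed (use DS in auto)
      show "\<forall>u\<in>(\<lambda>x. S x ` T) ` F. openin (top_of_set UNIV) u"
      proof (clarsimp)
        fix x assume x: "x \<in> F"
        have "inj_on (S x) T" using DS[OF x] by (metis inj_onI)
        then show "open (S x ` T)" using invariance_of_domain[OF contS[OF F[OF x]] T(2)] by blast
      qed
      show "pairwise disjnt ((\<lambda>x. S x ` T) ` F)"
      proof (clarsimp simp: pairwise_def)
        fix x x' assume x: "x \<in> F" "x' \<in> F" and ne: "S x ` T \<noteq> S x' ` T"
        show "disjnt (S x ` T) (S x' ` T)"
        proof (rule ccontr)
          assume "\<not> disjnt (S x ` T) (S x' ` T)"
          then obtain t t' where t: "t \<in> T" "t' \<in> T" "S x t = S x' t'" by (auto simp: disjnt_def)
          then have "t = t'" using DS x by metis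
          then have "S x w = S x' w" if "w \<in> T" for w
            using agree[of x x' t w] x t that T(1) by (simp add: F_def)
          then show False using ne by (simp add: image_def)
        qed
      qed
      show "\<forall>u\<in>(\<lambda>x. S x ` T) ` F. \<exists>q. homeomorphism u T D q"
      proof (clarsimp)
        fix x assume x: "x \<in> F"
        have "homeomorphism (S x ` T) T D (S x)"
          unfolding homeomorphism_def
          using DS[OF x] contS[OF F[OF x]] continuous_on_subset[OF contD subset_UNIV] by (auto simp: image_image)
        then show "\<exists>q. homeomorphism (S x ` T) T D q" by blast
      qed
    qed (use T in simp_all)
  qed
qed

text \<open>Euclidean space is simply connected, so the identity lifts to a section \<open>g\<close>
  with \<open>g (D 0) = 0\<close>. Then \<open>g \<circ> D\<close> and the identity are lifts of
  \<open>D\<close> that agree at 0, hence everywhere.\<close>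

lemma bij_developing_map:
  assumes D: "isometric_on H UNIV D"
  shows "bij D"
proof -
  note cov = covering_developing_map[OF D]
  have contD: "continuous_on UNIV D" by (rule smooth_on_continuous[OF isometric_onD(2)[OF D]])
  obtain g where g: "continuous_on UNIV g" "g (D 0) = 0" "\<And>y. D (g y) = y"
  proof (rule covering_space_lift_strong[OF cov, of 0 "D 0" UNIV "\<lambda>y. y"])
    show "simply_connected (UNIV :: (real^3) set)" by (rule convex_imp_simply_connected[OF convex_UNIV])
    show "locally path_connected (UNIV :: (real^3) set)" by (rule convex_imp_locally_path_connected[OF convex_UNIV])
  qed (auto intro: continuous_on_id)
  have "(\<lambda>z. g (D z)) x = (\<lambda>z. z) x" for x
    by (rule covering_space_lift_unique[OF cov, of _ 0 _ UNIV D])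
      (use g contD in \<open>auto intro: continuous_on_compose2[OF g(1) contD]\<close>)
  then show ?thesis using g(3) by (intro bij_betw_byWitness[of _ g]) auto
qed

lemma developing_diffeomorphism:
  obtains D where "isometric_on H UNIV D" "diffeomorphism D"
proof -
  obtain D where D: "isometric_on H UNIV D" using developing_map by blast
  have imm: "v = 0" if "fd D y v = 0" for y v by (rule isometric_immersion[OF D pos _ that]) auto
  have b: "bij D" by (rule bij_developing_map[OF D])
  have "smooth_on (range D) (inv D)"
    by (rule smooth_on_inverse_function(2)[OF open_UNIV isometric_onD(2)[OF D] bij_is_inj[OF b]])
      (use imm b in \<open>auto simp: bij_is_inj\<close>)
  then have "diffeomorphism D"
    using b isometric_onD(2)[OF D] by (simp add: diffeomorphism_def bij_is_surj)
  then show ?thesis using that D by blast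
qed

end

subsection \<open>Pulling back tensor fields from a manifold\<close>

lemma linear_eq_zero_imp_surj:
  fixes L :: "real^3 \<Rightarrow> real^3"
  assumes "linear L" "\<And>v. L v = 0 \<Longrightarrow> v = 0"
  obtains v where "L v = w"
  using inv3_right[OF assms] by blast

text \<open>Naturality of the exterior derivative: the terms with second derivatives of
  \<open>h\<close> are symmetric in \<open>u\<close> and \<open>v\<close> and cancel.\<close>

lemma ext_deriv_pullback:
  assumes S: "open S" "smooth_on S h" "y \<in> S" and T: "smooth_on T \<alpha>" "h ` S \<subseteq> T"
    and a: "(a has_derivative a') (at y)" "\<And>z v. z \<in> S \<Longrightarrow> a z \<bullet> v = \<alpha> (h z) \<bullet> fd h z v"
  shows "ext_deriv a y u v = ext_deriv \<alpha> (h y) (fd h y u) (fd h y v)"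
proof -
  have fa: "fd a y u \<bullet> v = fd \<alpha> (h y) (fd h y u) \<bullet> fd h y v + \<alpha> (h y) \<bullet> fd (\<lambda>z. fd h z v) y u" for u v
  proof -
    have dh: "(h has_derivative fd h y) (at y)" by (rule smooth_on_has_derivative[OF S(2,3)])
    have d\<alpha>: "(\<alpha> has_derivative fd \<alpha> (h y)) (at (h y))"
      by (rule smooth_on_has_derivative[OF T(1)]) (use S T in blast)
    have dhh: "((\<lambda>z. fd h z v) has_derivative fd (\<lambda>z. fd h z v) y) (at y)"
      by (rule smooth_on_has_derivative[OF smooth_on_fd[OF S(2)] S(3)])
    have "fd a y u \<bullet> v = fd (\<lambda>z. a z \<bullet> v) y u"
      using fd_bounded_linear[OF bounded_linear_inner_left a(1)] fd_eqI[OF a(1)] by metis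
    also have "fd (\<lambda>z. a z \<bullet> v) y = fd (\<lambda>z. \<alpha> (h z) \<bullet> fd h z v) y"
      by (rule fd_cong[OF S(1,3) a(2)])
    also have "fd (\<lambda>z. \<alpha> (h z) \<bullet> fd h z v) y u
        = \<alpha> (h y) \<bullet> fd (\<lambda>z. fd h z v) y u + fd \<alpha> (h y) (fd h y u) \<bullet> fd h y v"
      by (rule fd_inner[OF diff_chain_at[OF dh d\<alpha>, unfolded o_def] dhh])
    finally show ?thesis by simp
  qed
  show ?thesis
    unfolding ext_deriv_def fa using fd_commute[OF S(1,2,3), of u v] by simp
qed

section \<open>Charts and local diffeomorphisms into the manifold\<close>

lemma is_chartD:
  assumes "is_chart M c"
  shows "openin (top_of_set M) (cdom c)" "open (cran c)" "homeomorphism (cdom c) (cran c) (cmap c) (cinv c)"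
    "m \<in> cdom c \<Longrightarrow> cinv c (cmap c m) = m" "x \<in> cran c \<Longrightarrow> cmap c (cinv c x) = x"
    "x \<in> cran c \<Longrightarrow> cinv c x \<in> cdom c" "m \<in> cdom c \<Longrightarrow> cmap c m \<in> cran c"
    "continuous_on (cran c) (cinv c)" "continuous_on (cdom c) (cmap c)" "cdom c \<subseteq> M"
  using assms unfolding is_chart_def homeomorphism_def by (auto dest: openin_imp_subset)

lemma overlap_eq:
  assumes "is_chart M c"
  shows "overlap c d = cran c \<inter> cinv c -` cdom d" "m \<in> cdom c \<Longrightarrow> m \<in> cdom d \<Longrightarrow> cmap c m \<in> overlap c d"
    "overlap c d \<subseteq> cran c"
proof -
  show "overlap c d = cran c \<inter> cinv c -` cdom d"
  proof (intro equalityI subsetI)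
    fix x assume "x \<in> cran c \<inter> cinv c -` cdom d"
    then show "x \<in> overlap c d"
      unfolding overlap_def using is_chartD(5,6)[OF assms, of x] by (metis IntD1 IntD2 IntI image_eqI vimageD)
  qed (auto simp: overlap_def is_chartD(4,7)[OF assms])
  then show "overlap c d \<subseteq> cran c" by blast
qed (simp add: overlap_def)

lemma open_overlap:
  assumes "is_chart M c" "is_chart M d"
  shows "open (overlap c d)"
proof -
  note c = is_chartD[OF assms(1)] and d = is_chartD[OF assms(2)]
  obtain T where T: "open T" "cdom d = M \<inter> T" using d(1) openin_open by metis
  have "cdom c \<inter> cdom d = cdom c \<inter> T" using T(2) c(10) by blast
  then have "openin (top_of_set (cdom c)) (cdom c \<inter> cdom d)" using openin_open_Int[OF T(1)] by metis
  then have "openin (top_of_set (cran c)) (cran c \<inter> cinv c -` (cdom c \<inter> cdom d))"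
    using continuous_openin_preimage[OF c(8)] c(6) by blast
  moreover have "cran c \<inter> cinv c -` (cdom c \<inter> cdom d) = overlap c d"
    unfolding overlap_eq(1)[OF assms(1)] using c(6) by blast
  ultimately show ?thesis using c(2) openin_open_trans by metis
qed

text \<open>What pulling back requires of a covering, stated in the charts of the atlas. It is
  applied to \<open>p\<close> and to \<open>p \<circ> F\<close>, where \<open>F\<close> is the
  inverse of the developing map.\<close>

locale local_diffeo =
  fixes M :: "'a::{t2_space,second_countable_topology} set" and A :: "'a chart set" and q :: "real^3 \<Rightarrow> 'a"
  assumes man: "smooth_manifold M A" and qM: "q y \<in> M"
    and open_dom: "c \<in> A \<Longrightarrow> open (q -` cdom c)"
    and smooth_chart: "c \<in> A \<Longrightarrow> smooth_on (q -` cdom c) (cmap c \<circ> q)"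
    and immersion: "c \<in> A \<Longrightarrow> q y \<in> cdom c \<Longrightarrow> fd (cmap c \<circ> q) y v = 0 \<Longrightarrow> v = 0"
begin

lemma chart: "c \<in> A \<Longrightarrow> is_chart M c"
  using man by (simp add: smooth_manifold_def)

lemma chart_ex: "\<exists>c\<in>A. q y \<in> cdom c"
  using man qM[of y] unfolding smooth_manifold_def by blast

lemma der_chart: "c \<in> A \<Longrightarrow> q y \<in> cdom c \<Longrightarrow> ((cmap c \<circ> q) has_derivative fd (cmap c \<circ> q) y) (at y)"
  using smooth_on_has_derivative[OF smooth_chart] by blast

lemma lin_chart: "c \<in> A \<Longrightarrow> q y \<in> cdom c \<Longrightarrow> linear (fd (cmap c \<circ> q) y)"
  using der_chart has_derivative_linear by blast

lemma chart_cran: "c \<in> A \<Longrightarrow> q y \<in> cdom c \<Longrightarrow> (cmap c \<circ> q) y \<in> cran c"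
  using is_chartD(7)[OF chart] by simp

lemma chart_overlap: "c \<in> A \<Longrightarrow> q y \<in> cdom c \<Longrightarrow> q y \<in> cdom d \<Longrightarrow> (cmap c \<circ> q) y \<in> overlap c d"
  using overlap_eq(2)[OF chart] by simp

lemma transition_chart:
  assumes "c \<in> A" "q y \<in> cdom c"
  shows "transition c d ((cmap c \<circ> q) y) = (cmap d \<circ> q) y"
  using is_chartD(4)[OF chart] assms by (simp add: transition_def)

lemma compatible_chart_smooth:
  assumes c: "c \<in> A" and d: "is_chart M d" and sm: "smooth_on (overlap c d) (transition c d)"
    and y: "q y \<in> cdom c" "q y \<in> cdom d" and od: "open (q -` cdom d)"
  shows "smooth_on (q -` cdom c \<inter> q -` cdom d) (cmap d \<circ> q)"
    and "fd (cmap d \<circ> q) y v = fd (transition c d) ((cmap c \<circ> q) y) (fd (cmap c \<circ> q) y v)"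
proof -
  define S where "S = q -` cdom c \<inter> q -` cdom d"
  have S: "open S" "y \<in> S" using open_dom[OF c] od y by (auto simp: S_def)
  have eq: "(cmap d \<circ> q) z = transition c d ((cmap c \<circ> q) z)" if "z \<in> S" for z
    using transition_chart[OF c, of z d] that by (simp add: S_def)
  have im: "(cmap c \<circ> q) ` S \<subseteq> overlap c d" using chart_overlap[OF c, of _ d] by (auto simp: S_def)
  have smc: "smooth_on S (cmap c \<circ> q)" using smooth_on_subset[OF smooth_chart[OF c]] by (simp add: S_def)
  show "smooth_on (q -` cdom c \<inter> q -` cdom d) (cmap d \<circ> q)"
    unfolding S_def[symmetric]
    by (rule smooth_on_cong[OF smooth_on_compose[OF sm smc S(1) open_overlap[OF chart[OF c] d] im] S(1) eq])
  have "fd (cmap d \<circ> q) y v = fd (\<lambda>z. transition c d ((cmap c \<circ> q) z)) y v"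
    by (rule fun_cong[OF fd_cong[OF S eq]])
  also have "\<dots> = fd (transition c d) ((cmap c \<circ> q) y) (fd (cmap c \<circ> q) y v)"
    by (rule fd_compose[OF der_chart[OF c y(1)] smooth_on_has_derivative[OF sm chart_overlap[OF c y]]])
  finally show "fd (cmap d \<circ> q) y v = \<dots>" .
qed

lemma chart_change:
  assumes "c \<in> A" "d \<in> A" "q y \<in> cdom c" "q y \<in> cdom d"
  shows "fd (cmap d \<circ> q) y v = fd (transition c d) ((cmap c \<circ> q) y) (fd (cmap c \<circ> q) y v)"
  using compatible_chart_smooth(2)[OF assms(1) chart[OF assms(2)] _ assms(3,4) open_dom[OF assms(2)]] man assms
  by (simp add: smooth_manifold_def)

text \<open>The choice made inside \<open>pullback_form\<close>. Fields and metrics are pulled back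
  with the same chart, and the transformation laws make the choice irrelevant.\<close>

definition chart_at :: "real^3 \<Rightarrow> 'a chart" where
  "chart_at y = (SOME c. c \<in> A \<and> q y \<in> cdom c)"

lemma chart_at: "chart_at y \<in> A" "q y \<in> cdom (chart_at y)"
proof -
  have "chart_at y \<in> A \<and> q y \<in> cdom (chart_at y)"
    unfolding chart_at_def by (rule someI_ex) (use chart_ex in blast)
  then show "chart_at y \<in> A" "q y \<in> cdom (chart_at y)" by auto
qed

lemma pullback_form:
  assumes \<alpha>: "one_form A \<alpha>" and c: "c \<in> A" "q y \<in> cdom c"
  shows "pullback_form A q \<alpha> y \<bullet> v = \<alpha> c ((cmap c \<circ> q) y) \<bullet> fd (cmap c \<circ> q) y v"
proof -
  define d where "d = chart_at y"
  have d: "d \<in> A" "q y \<in> cdom d" by (simp_all add: d_def chart_at)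
  have "pullback_form A q \<alpha> y = (\<chi> i. \<alpha> d ((cmap d \<circ> q) y) \<bullet> fd (cmap d \<circ> q) y (axis i 1))"
    by (simp add: pullback_form_def Let_def d_def chart_at_def)
  then have "pullback_form A q \<alpha> y \<bullet> v = \<alpha> d ((cmap d \<circ> q) y) \<bullet> fd (cmap d \<circ> q) y v"
    by (subst linear_3[OF lin_chart[OF d]]) (simp add: inner_vec_def[of "\<chi> i. _ i"] sum_3 inner_add_right mult.commute)
  also have "\<dots> = \<alpha> c ((cmap c \<circ> q) y) \<bullet> fd (cmap c \<circ> q) y v"
    unfolding chart_change[OF c(1) d(1) c(2) d(2)]
    using \<alpha> c d chart_overlap[OF c d(2)] transition_chart[OF c, of d] unfolding one_form_def by metis
  finally show ?thesis .
qed

lemma smooth_pullback_form: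
  assumes \<alpha>: "one_form A \<alpha>"
  shows "smooth_on UNIV (pullback_form A q \<alpha>)"
proof (rule smooth_on_local)
  fix y
  obtain c where c: "c \<in> A" "q y \<in> cdom c" using chart_ex by blast
  define S where "S = q -` cdom c"
  have S: "open S" using open_dom[OF c(1)] by (simp add: S_def)
  have sm: "smooth_on S (cmap c \<circ> q)" using smooth_chart[OF c(1)] by (simp add: S_def)
  have sm\<alpha>: "smooth_on S (\<lambda>z. \<alpha> c ((cmap c \<circ> q) z))"
    by (rule smooth_on_compose[OF _ sm S is_chartD(2)[OF chart[OF c(1)]]])
      (use \<alpha> c(1) chart_cran[OF c(1)] in \<open>auto simp: one_form_def S_def\<close>)
  have "smooth_on S (\<lambda>z. \<chi> i. \<alpha> c ((cmap c \<circ> q) z) \<bullet> fd (cmap c \<circ> q) z (axis i 1))"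
    by (intro smooth_on_vec_lambda smooth_on_inner smooth_on_fd S sm sm\<alpha>)
  then have "smooth_on S (pullback_form A q \<alpha>)"
  proof (rule smooth_on_cong[OF _ S])
    fix z assume "z \<in> S"
    then have "q z \<in> cdom c" by (simp add: S_def)
    then show "pullback_form A q \<alpha> z = (\<chi> i. \<alpha> c ((cmap c \<circ> q) z) \<bullet> fd (cmap c \<circ> q) z (axis i 1))"
      using pullback_form[OF \<alpha> c(1), of z "axis _ 1"] by (simp add: vec_eq_iff inner_axis)
  qed
  then show "\<exists>T. open T \<and> y \<in> T \<and> smooth_on T (pullback_form A q \<alpha>)" using S c by (auto simp: S_def)
qed

lemma ext_deriv_pullback_form:
  assumes \<alpha>: "one_form A \<alpha>" and c: "c \<in> A" "q y \<in> cdom c"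
  shows "ext_deriv (pullback_form A q \<alpha>) y u v
    = ext_deriv (\<alpha> c) ((cmap c \<circ> q) y) (fd (cmap c \<circ> q) y u) (fd (cmap c \<circ> q) y v)"
proof (rule ext_deriv_pullback[OF open_dom[OF c(1)] smooth_chart[OF c(1)]])
  show "y \<in> q -` cdom c" using c by simp
  show "smooth_on (cran c) (\<alpha> c)" using \<alpha> c by (simp add: one_form_def)
  show "(cmap c \<circ> q) ` (q -` cdom c) \<subseteq> cran c" using chart_cran[OF c(1)] by auto
  show "(pullback_form A q \<alpha> has_derivative fd (pullback_form A q \<alpha>) y) (at y)"
    by (rule smooth_on_has_derivative[OF smooth_pullback_form[OF \<alpha>]]) simp
  show "pullback_form A q \<alpha> z \<bullet> v = \<alpha> c ((cmap c \<circ> q) z) \<bullet> fd (cmap c \<circ> q) z v" if "z \<in> q -` cdom c" for z v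
    using pullback_form[OF \<alpha> c(1), of z v] that by simp
qed

text \<open>Vectors are pulled back by inverting the derivative, which is possible for an immersion
  between spaces of equal dimension.\<close>

definition pullback_field :: "('a chart \<Rightarrow> real^3 \<Rightarrow> real^3) \<Rightarrow> real^3 \<Rightarrow> real^3" where
  "pullback_field X y = inv3 (fd (cmap (chart_at y) \<circ> q) y) (X (chart_at y) ((cmap (chart_at y) \<circ> q) y))"

lemma pullback_field:
  assumes X: "vector_field A X" and c: "c \<in> A" "q y \<in> cdom c"
  shows "fd (cmap c \<circ> q) y (pullback_field X y) = X c ((cmap c \<circ> q) y)"
    and "pullback_field X y = inv3 (fd (cmap c \<circ> q) y) (X c ((cmap c \<circ> q) y))"
proof -
  define d where "d = chart_at y"
  have d: "d \<in> A" "q y \<in> cdom d" by (simp_all add: d_def chart_at)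
  have 1: "fd (cmap d \<circ> q) y (pullback_field X y) = X d ((cmap d \<circ> q) y)"
    unfolding pullback_field_def d_def[symmetric] by (rule inv3_right[OF lin_chart[OF d] immersion[OF d]])
  have 2: "X c ((cmap c \<circ> q) y) = fd (transition d c) ((cmap d \<circ> q) y) (X d ((cmap d \<circ> q) y))"
    using X c d chart_overlap[OF d c(2)] transition_chart[OF d, of c] unfolding vector_field_def by metis
  show *: "fd (cmap c \<circ> q) y (pullback_field X y) = X c ((cmap c \<circ> q) y)"
    unfolding chart_change[OF d(1) c(1) d(2) c(2)] 1 2 ..
  show "pullback_field X y = inv3 (fd (cmap c \<circ> q) y) (X c ((cmap c \<circ> q) y))"
    unfolding *[symmetric] by (rule inv3_left[OF lin_chart[OF c] immersion[OF c], symmetric])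
qed

lemma smooth_pullback_field:
  assumes X: "vector_field A X"
  shows "smooth_on UNIV (pullback_field X)"
proof (rule smooth_on_local)
  fix y
  obtain c where c: "c \<in> A" "q y \<in> cdom c" using chart_ex by blast
  define S where "S = q -` cdom c"
  have S: "open S" using open_dom[OF c(1)] by (simp add: S_def)
  have sm: "smooth_on S (cmap c \<circ> q)" using smooth_chart[OF c(1)] by (simp add: S_def)
  have smX: "smooth_on S (\<lambda>z. X c ((cmap c \<circ> q) z))"
    by (rule smooth_on_compose[OF _ sm S is_chartD(2)[OF chart[OF c(1)]]])
      (use X c(1) chart_cran[OF c(1)] in \<open>auto simp: vector_field_def S_def\<close>)
  have imm: "v = 0" if "z \<in> S" "fd (cmap c \<circ> q) z v = 0" for z v
    using immersion[OF c(1), of z v] that by (simp add: S_def)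
  have "smooth_on S (pullback_field X)"
    by (rule smooth_on_cong[OF smooth_on_inv3[OF S sm smX imm] S])
      (use pullback_field(2)[OF X c(1)] in \<open>auto simp: S_def\<close>)
  then show "\<exists>T. open T \<and> y \<in> T \<and> smooth_on T (pullback_field X)" using S c by (auto simp: S_def)
qed

definition pullback_metric :: "('a chart \<Rightarrow> real^3 \<Rightarrow> real^3^3) \<Rightarrow> metric3" where
  "pullback_metric g y u v = fd (cmap (chart_at y) \<circ> q) y u \<bullet>
     (g (chart_at y) ((cmap (chart_at y) \<circ> q) y) *v fd (cmap (chart_at y) \<circ> q) y v)"

lemma pullback_metric:
  assumes g: "riemannian_metric A g" and c: "c \<in> A" "q y \<in> cdom c"
  shows "pullback_metric g y u v = fd (cmap c \<circ> q) y u \<bullet> (g c ((cmap c \<circ> q) y) *v fd (cmap c \<circ> q) y v)"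
proof -
  define d where "d = chart_at y"
  have d: "d \<in> A" "q y \<in> cdom d" by (simp_all add: d_def chart_at)
  show ?thesis
    unfolding pullback_metric_def d_def[symmetric] chart_change[OF c(1) d(1) c(2) d(2)]
    using g c d chart_overlap[OF c d(2)] transition_chart[OF c, of d] unfolding riemannian_metric_def by metis
qed

lemma pullback_metric_pos:
  assumes g: "riemannian_metric A g" and "pullback_metric g y u u = 0"
  shows "u = 0"
proof -
  obtain c where c: "c \<in> A" "q y \<in> cdom c" using chart_ex by blast
  have "fd (cmap c \<circ> q) y u = 0"
    using assms(2) g c chart_cran[OF c] unfolding pullback_metric[OF g c] riemannian_metric_def by (metis less_irrefl)
  then show ?thesis by (rule immersion[OF c])
qed

text \<open>An isometric chart \<open>e\<close> composed with \<open>q\<close> is the desired map.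
  Since \<open>e\<close> may lie outside \<open>A\<close>, it is compared with a chart
  \<open>d\<close> of the atlas on their overlap.\<close>

lemma pullback_metric_flat:
  assumes g: "riemannian_metric A g" and flat: "flat_metric M A g" and cont: "continuous_on UNIV q"
  shows "\<exists>U \<psi>. y \<in> U \<and> isometric_on (pullback_metric g) U \<psi>"
proof -
  obtain e where e: "compatible_chart M A e" "q y \<in> cdom e"
    and iso: "\<And>d x u v. d \<in> A \<Longrightarrow> x \<in> overlap d e \<Longrightarrow>
      u \<bullet> (g d x *v v) = fd (transition d e) x u \<bullet> fd (transition d e) x v"
    using flat qM[of y] unfolding flat_metric_def by metis
  obtain d where d: "d \<in> A" "q y \<in> cdom d" using chart_ex by blast
  have ce: "is_chart M e" and sm: "smooth_on (overlap d e) (transition d e)"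
    using e(1) d(1) by (simp_all add: compatible_chart_def)
  obtain T where T: "open T" "cdom e = M \<inter> T" using is_chartD(1)[OF ce] openin_open by metis
  have "q -` cdom e = q -` T" using T(2) qM by auto
  then have oe: "open (q -` cdom e)" using open_vimage[OF T(1) cont] by simp
  define U where "U = q -` cdom d \<inter> q -` cdom e"
  have "isometric_on (pullback_metric g) U (cmap e \<circ> q)"
    unfolding isometric_on_def
  proof (intro conjI ballI allI)
    show "open U" unfolding U_def using open_dom[OF d(1)] oe by blast
    show "smooth_on U (cmap e \<circ> q)"
      unfolding U_def by (rule compatible_chart_smooth(1)[OF d(1) ce sm d(2) e(2) oe])
    fix z u v assume "z \<in> U"
    then have z: "q z \<in> cdom d" "q z \<in> cdom e" by (auto simp: U_def)
    show "fd (cmap e \<circ> q) z u \<bullet> fd (cmap e \<circ> q) z v = pullback_metric g z u v"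
      unfolding pullback_metric[OF g d(1) z(1)] compatible_chart_smooth(2)[OF d(1) ce sm z oe]
      by (rule iso[OF d(1) chart_overlap[OF d(1) z], symmetric])
  qed
  moreover have "y \<in> U" using d e by (simp add: U_def)
  ultimately show ?thesis by blast
qed

end

text \<open>In the chart \<open>k\<close> formed by a local inverse of \<open>p\<close>, the map
  \<open>cmap c \<circ> p\<close> is the transition from \<open>k\<close> to \<open>c\<close>. So it
  is smooth, and the reverse transition shows that its derivative is injective.\<close>

lemma smooth_covering_local_diffeo:
  assumes man: "smooth_manifold M A" and cov: "smooth_covering M A p"
  shows "local_diffeo M A p"
proof -
  have p: "continuous_on UNIV p" "range p = M"
    using cov covering_space_imp_continuous covering_space_imp_surjective unfolding smooth_covering_def by blast+
  have op: "open (p -` cdom c)" if c: "c \<in> A" for c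
  proof -
    have "is_chart M c" using man c by (simp add: smooth_manifold_def)
    then obtain T where T: "open T" "cdom c = M \<inter> T" using is_chartD(1) openin_open by metis
    have "p -` cdom c = p -` T" using T(2) p(2) by auto
    then show ?thesis using open_vimage[OF T(1) p(1)] by simp
  qed
  have local: "\<exists>S. open S \<and> x \<in> S \<and> smooth_on S (cmap c \<circ> p) \<and> (\<forall>v. fd (cmap c \<circ> p) x v = 0 \<longrightarrow> v = 0)"
    if c: "c \<in> A" and x: "p x \<in> cdom c" for c x
  proof -
    obtain V where V: "open V" "x \<in> V" "inj_on p V" and k: "compatible_chart M A (p ` V, inv_into V p)"
      using cov unfolding smooth_covering_def by blast
    define k where "k = (p ` V, inv_into V p)"
    have ck: "is_chart M k" and sm: "smooth_on (overlap k c) (transition k c)" "smooth_on (overlap c k) (transition c k)"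
      using k c by (simp_all add: compatible_chart_def k_def)
    have cc: "is_chart M c" using man c by (simp add: smooth_manifold_def)
    have kp: "cmap k (p z) = z" if "z \<in> V" for z using inv_into_f_f[OF V(3) that] by (simp add: k_def)
    have pk: "p z \<in> cdom k" if "z \<in> V" for z using that by (simp add: k_def)
    have ik: "cinv k z = p z" if "z \<in> V" for z using is_chartD(4)[OF ck pk[OF that]] kp[OF that] by simp
    define S where "S = V \<inter> p -` cdom c"
    have S: "open S" "x \<in> S" using V op[OF c] x by (auto simp: S_def)
    have SV: "S \<subseteq> overlap k c"
    proof
      fix z assume "z \<in> S"
      then show "z \<in> overlap k c" using overlap_eq(2)[OF ck, of "p z" c] kp pk by (simp add: S_def)
    qed
    have eq: "(cmap c \<circ> p) z = transition k c z" if "z \<in> S" for z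
      using ik that by (simp add: transition_def S_def)
    have smS: "smooth_on S (cmap c \<circ> p)"
      by (rule smooth_on_cong[OF smooth_on_subset[OF sm(1) SV] S(1) eq])
    have px: "(cmap c \<circ> p) x \<in> overlap c k" using overlap_eq(2)[OF cc x pk[OF V(2)]] by simp
    have "fd (transition c k) ((cmap c \<circ> p) x) (fd (cmap c \<circ> p) x v) = v" for v
    proof -
      have "fd (\<lambda>z. transition c k ((cmap c \<circ> p) z)) x v = fd (transition c k) ((cmap c \<circ> p) x) (fd (cmap c \<circ> p) x v)"
        by (rule fd_compose[OF smooth_on_has_derivative[OF smS S(2)] smooth_on_has_derivative[OF sm(2) px]])
      moreover have "fd (\<lambda>z. transition c k ((cmap c \<circ> p) z)) x = fd (\<lambda>z. z) x"
      proof (rule fd_cong[OF S])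
        fix z assume "z \<in> S"
        then show "transition c k ((cmap c \<circ> p) z) = z"
          using is_chartD(4)[OF cc, of "p z"] kp[of z] by (simp add: transition_def S_def)
      qed
      ultimately show ?thesis by simp
    qed
    moreover have "fd (transition c k) ((cmap c \<circ> p) x) 0 = 0"
      by (rule linear_0[OF smooth_on_linear_fd[OF sm(2) px]])
    ultimately have "\<forall>v. fd (cmap c \<circ> p) x v = 0 \<longrightarrow> v = 0" by metis
    then show ?thesis using S smS by blast
  qed
  show ?thesis
  proof
    show "smooth_manifold M A" by (rule man)
    show "p y \<in> M" for y using p(2) by blast
    show "open (p -` cdom c)" if "c \<in> A" for c by (rule op[OF that])
    show "smooth_on (p -` cdom c) (cmap c \<circ> p)" if "c \<in> A" for c
      by (rule smooth_on_local) (use local[OF that] in blast)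
    show "v = 0" if "c \<in> A" "p y \<in> cdom c" "fd (cmap c \<circ> p) y v = 0" for c y v
      using local[OF that(1,2)] that(3) by blast
  qed
qed

section \<open>Changes of sheets and the invariance of lifted tensors\<close>

context local_diffeo
begin

text \<open>A continuous map \<open>\<delta>\<close> with \<open>q \<circ> \<delta> = q\<close> is a local inverse of \<open>q\<close> composed with \<open>q\<close>.\<close>

lemma deck_smooth:
  assumes W: "open W" and cont: "continuous_on W \<delta>" and qd: "\<And>y. y \<in> W \<Longrightarrow> q (\<delta> y) = q y"
  shows "smooth_on W \<delta>"
proof (rule smooth_on_local)
  fix y assume y: "y \<in> W"
  obtain c where c: "c \<in> A" "q y \<in> cdom c" using chart_ex by blast
  define h where "h = cmap c \<circ> q"
  define S where "S = q -` cdom c"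
  have S: "open S" "smooth_on S h" using open_dom smooth_chart c by (simp_all add: S_def h_def)
  have imm: "v = 0" if "z \<in> S" "fd h z v = 0" for z v
    using immersion[OF c(1), of z v] that by (simp add: S_def h_def)
  have "\<delta> y \<in> S" using c qd[OF y] by (simp add: S_def)
  obtain U g where U: "open U" "U \<subseteq> S" "\<delta> y \<in> U" "open (h ` U)" "smooth_on (h ` U) g" "\<And>z. z \<in> U \<Longrightarrow> g (h z) = z"
    using local_inverse[OF S \<open>\<delta> y \<in> S\<close>] imm by metis
  define N where "N = S \<inter> (W \<inter> \<delta> -` U)"
  have N: "open N" "y \<in> N"
    using S(1) continuous_open_preimage[OF cont W U(1)] y c U(3) by (auto simp: N_def S_def)
  have eq: "h z = h (\<delta> z)" if "z \<in> N" for z using qd that by (simp add: N_def h_def)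
  have "smooth_on N (\<lambda>z. g (h z))"
  proof (rule smooth_on_compose[OF U(5) smooth_on_subset[OF S(2)] N(1) U(4)])
    show "N \<subseteq> S" by (auto simp: N_def)
    show "h ` N \<subseteq> h ` U" using eq by (auto simp: N_def)
  qed
  then have "smooth_on N \<delta>"
    by (rule smooth_on_cong[OF _ N(1)]) (use eq U(6) in \<open>auto simp: N_def\<close>)
  then show "\<exists>T. open T \<and> y \<in> T \<and> smooth_on T \<delta>" using N by blast
qed

text \<open>The chain rule for \<open>q \<circ> \<delta> = q\<close>; the invariance of metrics,
  fields and forms follows from it.\<close>

lemma deck_chart:
  assumes W: "open W" and sm: "smooth_on W \<delta>" and qd: "\<And>y. y \<in> W \<Longrightarrow> q (\<delta> y) = q y"
    and y: "y \<in> W" and c: "c \<in> A" "q y \<in> cdom c"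
  shows "fd (cmap c \<circ> q) (\<delta> y) (fd \<delta> y v) = fd (cmap c \<circ> q) y v"
proof -
  have "fd (\<lambda>z. (cmap c \<circ> q) (\<delta> z)) y v = fd (cmap c \<circ> q) (\<delta> y) (fd \<delta> y v)"
    by (rule fd_compose[OF smooth_on_has_derivative[OF sm y] der_chart[OF c(1)]]) (simp add: qd y c)
  moreover have "fd (\<lambda>z. (cmap c \<circ> q) (\<delta> z)) y = fd (cmap c \<circ> q) y"
    by (rule fd_cong[OF W y]) (simp add: qd)
  ultimately show ?thesis by simp
qed

lemma deck_isometric:
  assumes W: "open W" and sm: "smooth_on W \<delta>" and qd: "\<And>y. y \<in> W \<Longrightarrow> q (\<delta> y) = q y"
    and y: "y \<in> W" and g: "riemannian_metric A g"
  shows "pullback_metric g (\<delta> y) (fd \<delta> y u) (fd \<delta> y v) = pullback_metric g y u v"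
proof -
  obtain c where c: "c \<in> A" "q y \<in> cdom c" using chart_ex by blast
  have c': "q (\<delta> y) \<in> cdom c" using c qd[OF y] by simp
  have dc: "fd (cmap c \<circ> q) (\<delta> y) (fd \<delta> y v) = fd (cmap c \<circ> q) y v" for v
    by (rule deck_chart[OF W sm _ y c]) (rule qd)
  show ?thesis
    unfolding pullback_metric[OF g c(1) c'] pullback_metric[OF g c] dc by (simp add: qd y)
qed

lemma deck_field:
  assumes W: "open W" and sm: "smooth_on W \<delta>" and qd: "\<And>y. y \<in> W \<Longrightarrow> q (\<delta> y) = q y"
    and y: "y \<in> W" and X: "vector_field A X"
  shows "pullback_field X (\<delta> y) = fd \<delta> y (pullback_field X y)"
proof -
  obtain c where c: "c \<in> A" "q y \<in> cdom c" using chart_ex by blast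
  have c': "q (\<delta> y) \<in> cdom c" using c qd[OF y] by simp
  let ?L = "fd (cmap c \<circ> q) (\<delta> y)"
  have lin: "linear ?L" by (rule lin_chart[OF c(1) c'])
  have dc: "fd (cmap c \<circ> q) (\<delta> y) (fd \<delta> y v) = fd (cmap c \<circ> q) y v" for v
    by (rule deck_chart[OF W sm _ y c]) (rule qd)
  have "?L (pullback_field X (\<delta> y)) = ?L (fd \<delta> y (pullback_field X y))"
    unfolding dc pullback_field(1)[OF X c] pullback_field(1)[OF X c(1) c'] by (simp add: qd y)
  then have "?L (pullback_field X (\<delta> y) - fd \<delta> y (pullback_field X y)) = 0" using lin by (simp add: linear_diff)
  then show ?thesis using immersion[OF c(1) c'] by fastforce
qed

lemma deck_form:
  assumes W: "open W" and sm: "smooth_on W \<delta>" and qd: "\<And>y. y \<in> W \<Longrightarrow> q (\<delta> y) = q y"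
    and y: "y \<in> W" and \<alpha>: "one_form A \<alpha>"
  shows "pullback_form A q \<alpha> (\<delta> y) \<bullet> fd \<delta> y v = pullback_form A q \<alpha> y \<bullet> v"
proof -
  obtain c where c: "c \<in> A" "q y \<in> cdom c" using chart_ex by blast
  have c': "q (\<delta> y) \<in> cdom c" using c qd[OF y] by simp
  have dc: "fd (cmap c \<circ> q) (\<delta> y) (fd \<delta> y v) = fd (cmap c \<circ> q) y v" for v
    by (rule deck_chart[OF W sm _ y c]) (rule qd)
  show ?thesis
    unfolding pullback_form[OF \<alpha> c(1) c'] pullback_form[OF \<alpha> c] dc by (simp add: qd y)
qed

end

text \<open>Over an evenly covered set, going down by \<open>p\<close> and up by the inverse on the
  sheet through \<open>x\<close> changes sheets. The domain is the full preimage, hence the same for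
  all \<open>k\<close> and \<open>x\<close>.\<close>

lemma covering_local_decks:
  fixes p :: "real^3 \<Rightarrow> 'a::topological_space"
  assumes cov: "covering_space UNIV p M"
  shows "\<exists>W. open W \<and> x0 \<in> W \<and> (\<forall>k\<in>W. \<forall>x. p k = p x \<longrightarrow>
    (\<exists>\<delta>. continuous_on W \<delta> \<and> \<delta> k = x \<and> (\<forall>y\<in>W. p (\<delta> y) = p y)))"
proof -
  have p: "continuous_on UNIV p" "range p = M"
    using cov covering_space_imp_continuous covering_space_imp_surjective by blast+
  have "p x0 \<in> M" using p by blast
  then obtain T v where T: "p x0 \<in> T" "openin (top_of_set M) T" "\<Union>v = UNIV \<inter> p -` T"
    and h: "\<And>u. u \<in> v \<Longrightarrow> \<exists>r. homeomorphism u T p r"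
    using cov unfolding covering_space_def by metis
  have "open (p -` T)"
  proof -
    obtain T' where T': "open T'" "T = M \<inter> T'" using T(2) openin_open by metis
    have "p -` T = p -` T'" using T'(2) p(2) by auto
    then show ?thesis using open_vimage[OF T'(1) p(1)] by simp
  qed
  moreover have "\<exists>\<delta>. continuous_on (p -` T) \<delta> \<and> \<delta> k = x \<and> (\<forall>y\<in>p -` T. p (\<delta> y) = p y)"
    if "k \<in> p -` T" "p k = p x" for k x
  proof -
    have "x \<in> \<Union>v" using T(3) that by simp
    then obtain u r where u: "x \<in> u" "homeomorphism u T p r" using h by blast
    have "continuous_on (p -` T) (r \<circ> p)"
      using u(2) p(1) by (intro continuous_on_compose continuous_on_subset[OF p(1)])
        (auto simp: homeomorphism_def intro: continuous_on_subset)
    then show ?thesis using u that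
      by (intro exI[of _ "r \<circ> p"]) (auto simp: homeomorphism_def)
  qed
  ultimately show ?thesis using T(1) by (intro exI[of _ "p -` T"]) auto
qed

text \<open>Bounded open sets have images open in \<open>M\<close>; finitely many of these images
  cover \<open>M\<close>, and the closure of the union of the bounded sets is compact.\<close>

lemma covering_compact_section:
  fixes p :: "real^3 \<Rightarrow> 'a::topological_space"
  assumes cov: "covering_space UNIV p M" and "compact M"
  shows "\<exists>K. compact K \<and> (\<forall>x. \<exists>k\<in>K. p k = p x)"
proof -
  have "\<exists>N. open N \<and> bounded N \<and> openin (top_of_set M) (p ` N) \<and> p x \<in> p ` N" for x
  proof -
    obtain T u r where u: "x \<in> T" "openin (top_of_set UNIV) T" "openin (top_of_set M) u" "homeomorphism T u p r"
      using covering_space_local_homeomorphism[OF cov UNIV_I] by metis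
    define N where "N = T \<inter> ball x 1"
    have "openin (top_of_set T) N" by (auto simp: N_def openin_open_Int)
    then have "openin (top_of_set u) (p ` N)" by (rule homeomorphism_imp_open_map[OF u(4)])
    then have "openin (top_of_set M) (p ` N)" using openin_trans u(3) by blast
    moreover have "open N" using u(2) by (simp add: N_def open_Int)
    moreover have "bounded N" by (simp add: N_def bounded_Int)
    ultimately show ?thesis using u(1) by (auto simp: N_def)
  qed
  then obtain N where N: "\<And>x. bounded (N x)" "\<And>x. openin (top_of_set M) (p ` N x)" "\<And>x. p x \<in> p ` N x" by metis
  have pM: "range p = M" using cov covering_space_imp_surjective by blast
  obtain C where C: "finite C" "M \<subseteq> (\<Union>x\<in>C. p ` N x)"
  proof -
    have "\<exists>C\<subseteq>range (\<lambda>x. p ` N x). finite C \<and> M \<subseteq> \<Union>C"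
      using \<open>compact M\<close> N(2,3) pM by (intro compact_eq_openin_cover[THEN iffD1, rule_format]) blast+
    then obtain C where "C \<subseteq> range (\<lambda>x. p ` N x)" "finite C" "M \<subseteq> \<Union>C" by blast
    then show ?thesis using that by (metis finite_subset_image)
  qed
  define K where "K = closure (\<Union>x\<in>C. N x)"
  have "bounded (\<Union>x\<in>C. N x)" using C(1) N(1) by (simp add: bounded_UN)
  then have "compact K" by (simp add: K_def compact_closure)
  moreover have "\<exists>k\<in>K. p k = p x" for x
  proof -
    have "p x \<in> M" using pM by blast
    then obtain c k where "c \<in> C" "k \<in> N c" "p x = p k" using C(2) by blast
    then show ?thesis unfolding K_def using closure_subset by (metis UN_I subsetD)
  qed
  ultimately show ?thesis by blast
qed

subsection \<open>Geodesic vector fields\<close>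

lemma fd_bound_on_compact:
  fixes f :: "'a::euclidean_space \<Rightarrow> 'b::euclidean_space"
  assumes "smooth_on S f" "compact K" "K \<subseteq> S"
  shows "\<exists>L\<ge>0. \<forall>x\<in>K. \<forall>v. norm (fd f x v) \<le> L * norm v"
proof -
  have "\<exists>B. \<forall>x\<in>K. norm (fd f x b) \<le> B" for b
  proof -
    have "continuous_on K (\<lambda>x. fd f x b)"
      using smooth_on_continuous[OF smooth_on_fd[OF assms(1)]] assms(3) continuous_on_subset by blast
    then have "bounded ((\<lambda>x. fd f x b) ` K)"
      by (intro compact_imp_bounded compact_continuous_image assms(2))
    then show ?thesis by (auto simp: bounded_iff)
  qed
  then obtain B where B: "\<And>b x. x \<in> K \<Longrightarrow> norm (fd f x b) \<le> B b" by metis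
  show ?thesis
  proof (intro exI[of _ "\<Sum>b\<in>Basis. \<bar>B b\<bar>"] conjI ballI allI)
    show "0 \<le> (\<Sum>b\<in>Basis. \<bar>B b\<bar>)" by (auto intro: sum_nonneg)
    fix x v assume x: "x \<in> K"
    then have "x \<in> S" using assms(3) by blast
    have "norm (fd f x v) = norm (\<Sum>b\<in>Basis. (v \<bullet> b) *\<^sub>R fd f x b)"
      by (simp only: linear_sum_Basis[OF smooth_on_linear_fd[OF assms(1) \<open>x \<in> S\<close>], of v])
    also have "\<dots> \<le> (\<Sum>b\<in>Basis. \<bar>B b\<bar> * norm v)"
    proof (rule sum_norm_le)
      fix b :: 'a assume "b \<in> Basis"
      have "\<bar>v \<bullet> b\<bar> \<le> norm v" using Basis_le_norm[OF \<open>b \<in> Basis\<close>] .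
      moreover have "norm (fd f x b) \<le> \<bar>B b\<bar>" using B[OF x, of b] by simp
      ultimately show "norm ((v \<bullet> b) *\<^sub>R fd f x b) \<le> \<bar>B b\<bar> * norm v"
        unfolding norm_scaleR by (subst mult.commute) (intro mult_mono, auto)
    qed
    finally show "norm (fd f x v) \<le> (\<Sum>b\<in>Basis. \<bar>B b\<bar>) * norm v" by (simp add: sum_distrib_right)
  qed
qed

lemma smooth_lipschitz_on_cball:
  fixes f :: "'a::euclidean_space \<Rightarrow> 'b::euclidean_space"
  assumes "smooth_on S f" "cball x0 r \<subseteq> S"
  obtains L where "L > 0" "\<And>x y. x \<in> cball x0 r \<Longrightarrow> y \<in> cball x0 r \<Longrightarrow> dist (f x) (f y) \<le> L * dist x y"
proof -
  obtain L where L: "L \<ge> 0" "\<And>x v. x \<in> cball x0 r \<Longrightarrow> norm (fd f x v) \<le> L * norm v"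
    using fd_bound_on_compact[OF assms(1) compact_cball assms(2)] by blast
  have "dist (f x) (f y) \<le> (L + 1) * dist x y" if "x \<in> cball x0 r" "y \<in> cball x0 r" for x y
  proof -
    have "norm (f x - f y) \<le> L * norm (x - y)"
    proof (rule differentiable_bound[OF convex_cball _ _ that])
      fix z assume z: "z \<in> cball x0 r"
      then show "(f has_derivative fd f z) (at z within cball x0 r)"
        using smooth_on_has_derivative[OF assms(1)] assms(2) has_derivative_at_withinI by blast
      show "onorm (fd f z) \<le> L" by (rule onorm_le) (rule L(2)[OF z])
    qed
    also have "\<dots> \<le> (L + 1) * norm (x - y)" by (intro mult_right_mono) auto
    finally show ?thesis by (simp add: dist_norm)
  qed
  then show ?thesis using that[of "L + 1"] L(1) by simp
qed

text \<open>Picard iteration as a contraction. Regularity then comes from the equation itself: if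
  \<open>y\<close> is of order \<open>k\<close>, so is its derivative
  \<open>f (y t)\<close>.\<close>

lemma ode_solution:
  fixes f :: "real^3 \<Rightarrow> real^3"
  assumes S: "open S" "x0 \<in> S" and f: "smooth_on S f"
  obtains h y where "h > 0" "smooth_on {0<..<h} y" "\<And>t. t \<in> {0<..<h} \<Longrightarrow> y t \<in> S"
    "\<And>t. t \<in> {0<..<h} \<Longrightarrow> (y has_vector_derivative f (y t)) (at t)"
    "(y \<longlongrightarrow> x0) (at_right 0)"
proof -
  obtain r where r: "r > 0" "cball x0 r \<subseteq> S" using S open_contains_cball by blast
  obtain L where L: "L > 0" "\<And>x y. x \<in> cball x0 r \<Longrightarrow> y \<in> cball x0 r \<Longrightarrow> dist (f x) (f y) \<le> L * dist x y"
    using smooth_lipschitz_on_cball[OF f r(2)] by blast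
  have cf: "continuous_on (cball x0 r) f" using smooth_on_continuous[OF f] r(2) continuous_on_subset by blast
  then have "bounded (f ` cball x0 r)" by (intro compact_imp_bounded compact_continuous_image compact_cball)
  then obtain B where B: "B > 0" "\<And>x. x \<in> cball x0 r \<Longrightarrow> norm (f x) \<le> B" by (auto simp: bounded_pos)
  \<comment> \<open>\<open>h \<le> r / B\<close> keeps the iterates in the ball, and
    \<open>h \<le> 1 / (2 * L)\<close> gives the contraction factor 1/2.\<close>
  define h where "h = min (r / B) (1 / (2 * L))"
  have h: "h > 0" "B * h \<le> r" "L * h \<le> 1 / 2"
    using r(1) B(1) L(1) by (auto simp: h_def min_def field_simps)
  define C where "C = PiC UNIV (\<lambda>t::real. cball x0 r)"
  have C: "y \<in> C \<longleftrightarrow> (\<forall>t. y t \<in> cball x0 r)" for y :: "real \<Rightarrow>\<^sub>C (real^3)" by (auto simp: C_def mem_PiC_iff)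
  \<comment> \<open>The fixed point is sought among bounded continuous functions on the whole line;
    clamping the upper limit of the integral to \<open>{0..h}\<close> keeps the iterates bounded and
    changes nothing on this interval.\<close>
  define clamp where "clamp t = max 0 (min h t)" for t :: real
  have clamp: "clamp t \<in> {0..h}" "t \<in> {0..h} \<Longrightarrow> clamp t = t" for t using h(1) by (auto simp: clamp_def)
  define G where "G y t = x0 + integral {0..clamp t} (\<lambda>s. f (y s))" for y :: "real \<Rightarrow> real^3" and t
  have cfy: "continuous_on T (\<lambda>s. f (apply_bcontfun y s))" if "y \<in> C" for y T
    by (rule continuous_on_compose2[OF cf]) (use that C in auto)
  have GB: "G (apply_bcontfun y) t \<in> cball x0 r" if "y \<in> C" for y t
  proof -
    have "norm (integral {0..clamp t} (\<lambda>s. f (apply_bcontfun y s))) \<le> B * (clamp t - 0)"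
      by (rule integral_bound) (use clamp(1)[of t] cfy[OF that] that C B in auto)
    also have "\<dots> \<le> B * h" using clamp(1)[of t] B(1) by simp
    finally show ?thesis using h(2) by (simp add: G_def dist_norm)
  qed
  have Gc: "continuous_on UNIV (G (apply_bcontfun y))" if "y \<in> C" for y
  proof -
    have "continuous_on {0..h} (\<lambda>t. integral {0..t} (\<lambda>s. f (apply_bcontfun y s)))"
      by (rule indefinite_integral_continuous_1[OF integrable_continuous_real[OF cfy[OF that]]])
    moreover have "continuous_on UNIV clamp" unfolding clamp_def by (intro continuous_intros)
    ultimately have "continuous_on UNIV (\<lambda>t. integral {0..clamp t} (\<lambda>s. f (apply_bcontfun y s)))"
      by (rule continuous_on_compose2) (use clamp(1) in blast)
    then show ?thesis unfolding G_def by (intro continuous_on_add continuous_on_const)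
  qed
  define G' where "G' y = Bcontfun (G (apply_bcontfun y))" for y
  have G': "apply_bcontfun (G' y) = G (apply_bcontfun y)" if "y \<in> C" for y
  proof -
    have "G (apply_bcontfun y) ` UNIV \<subseteq> cball x0 r" using GB[OF that] by blast
    then have "bounded (range (G (apply_bcontfun y)))" using bounded_subset bounded_cball by blast
    then show ?thesis unfolding G'_def by (intro Bcontfun_inverse) (use Gc[OF that] in \<open>auto simp: bcontfun_def\<close>)
  qed
  have "\<exists>!y\<in>C. G' y = y"
  proof (rule Banach_fix[where c="1/2"])
    show "complete C" unfolding C_def by (intro closed_PiC complete_eq_closed[THEN iffD2]) auto
    have "const_bcontfun x0 \<in> C" using r(1) by (simp add: C const_bcontfun.rep_eq)
    then show "C \<noteq> {}" by blast
    show "G' ` C \<subseteq> C" using G' GB C by auto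
    show "dist (G' y) (G' z) \<le> 1 / 2 * dist y z" if "y \<in> C" "z \<in> C" for y z
    proof (rule dist_bound)
      fix t
      have "dist (G' y t) (G' z t) = norm (integral {0..clamp t} (\<lambda>s. f (y s) - f (z s)))"
        unfolding G'[OF that(1)] G'[OF that(2)] G_def dist_norm
        using Henstock_Kurzweil_Integration.integral_diff[OF integrable_continuous_real[OF cfy[OF that(1)]]
            integrable_continuous_real[OF cfy[OF that(2)]], of 0 "clamp t"] by simp
      also have "\<dots> \<le> (L * dist y z) * (clamp t - 0)"
      proof (rule integral_bound)
        show "0 \<le> clamp t" using clamp(1)[of t] by simp
        show "continuous_on {0..clamp t} (\<lambda>s. f (y s) - f (z s))" using cfy that by (intro continuous_on_diff) auto
        fix s
        have "norm (f (y s) - f (z s)) \<le> L * dist (y s) (z s)" using L(2) that C by (simp add: dist_norm)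
        also have "\<dots> \<le> L * dist y z" using L(1) dist_bounded[of y s z] by simp
        finally show "norm (f (y s) - f (z s)) \<le> L * dist y z" .
      qed
      also have "\<dots> \<le> (L * dist y z) * h" using clamp(1)[of t] L(1) by (intro mult_left_mono) auto
      also have "\<dots> \<le> 1 / 2 * dist y z" using mult_right_mono[OF h(3), of "dist y z"] by (simp add: mult_ac)
      finally show "dist (G' y t) (G' z t) \<le> 1 / 2 * dist y z" .
    qed
  qed auto
  then obtain Y where Y: "Y \<in> C" "G' Y = Y" by blast
  define y where "y = apply_bcontfun Y"
  have yS: "y t \<in> S" for t using Y(1) C r(2) by (auto simp: y_def)
  have yc: "continuous_on T y" for T by (simp add: y_def)
  have fy: "continuous_on T (\<lambda>s. f (y s))" for T unfolding y_def by (rule cfy[OF Y(1)])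
  have eq: "y t = x0 + integral {0..t} (\<lambda>s. f (y s))" if "t \<in> {0..h}" for t
  proof -
    have "y t = G y t" unfolding y_def using G'[OF Y(1)] Y(2) by simp
    then show ?thesis using clamp(2)[OF that] by (simp add: G_def)
  qed
  have der: "(y has_vector_derivative f (y t)) (at t)" if t: "t \<in> {0<..<h}" for t
  proof -
    have "((\<lambda>u. integral {0..u} (\<lambda>s. f (y s))) has_vector_derivative f (y t)) (at t within {0..h})"
      by (rule integral_has_vector_derivative[OF fy]) (use t in auto)
    then have "((\<lambda>u. integral {0..u} (\<lambda>s. f (y s))) has_vector_derivative f (y t)) (at t within {0<..<h})"
      by (rule has_vector_derivative_within_subset) auto
    then have "((\<lambda>u. integral {0..u} (\<lambda>s. f (y s))) has_vector_derivative f (y t)) (at t)"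
      using t at_within_open[of t "{0<..<h}"] by simp
    then have "((\<lambda>u. x0 + integral {0..u} (\<lambda>s. f (y s))) has_vector_derivative 0 + f (y t)) (at t)"
      by (intro has_vector_derivative_add has_vector_derivative_const)
    then have "(y has_vector_derivative 0 + f (y t)) (at t)"
      by (rule has_vector_derivative_transform_within_open[OF _ open_greaterThanLessThan t]) (use eq in auto)
    then show ?thesis by simp
  qed
  have sm: "Ck_on k {0<..<h} y" for k
  proof (induction k)
    case 0
    then show ?case using yc by simp
  next
    case (Suc k)
    show ?case
    proof (rule Ck_on_SucI)
      show "(y has_derivative (\<lambda>v. v *\<^sub>R f (y t))) (at t)" if "t \<in> {0<..<h}" for t
        using der[OF that] by (simp add: has_vector_derivative_def)
      have "Ck_on k {0<..<h} (\<lambda>t. f (y t))"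
        by (rule Ck_on_compose[OF _ S(1) _ smooth_onD[OF f] Suc]) (use yS in auto)
      then show "Ck_on k {0<..<h} (\<lambda>t. v *\<^sub>R f (y t))" for v
        by (intro Ck_on_bounded_linear[OF _ bounded_linear_scaleR_right]) auto
    qed simp
  qed
  have "isCont y 0" using yc[of UNIV] continuous_on_eq_continuous_at by blast
  then have "(y \<longlongrightarrow> y 0) (at_right 0)" by (simp add: isCont_def filterlim_at_split)
  moreover have "y 0 = x0" using eq[of 0] h(1) by simp
  ultimately have "(y \<longlongrightarrow> x0) (at_right 0)" by simp
  then show ?thesis using that[OF h(1)] sm yS der by (auto simp: smooth_on_def)
qed

text \<open>Along an integral curve of \<open>Y\<close> the second derivative is
  \<open>fd Y z (Y z)\<close>, so this is the geodesic equation of the curve through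
  \<open>z\<close>: the covariant derivative of \<open>Y\<close> along itself vanishes
  there.\<close>

definition chart_geodesic :: "(real^3 \<Rightarrow> real^3^3) \<Rightarrow> (real^3 \<Rightarrow> real^3) \<Rightarrow> real^3 \<Rightarrow> bool" where
  "chart_geodesic G Y z \<longleftrightarrow> (\<forall>k. fd Y z (Y z) $ k +
     (\<Sum>i\<in>UNIV. \<Sum>j\<in>UNIV. christoffel G z k i j * Y z $ i * Y z $ j) = 0)"

text \<open>An integral curve is started at \<open>x0\<close> inside \<open>N\<close> and moved into
  the manifold; there the geodesic equation holds on an open interval that excludes the starting
  time. So density is obtained, which continuity later turns into equality.\<close>

lemma geodesic_field_dense:
  assumes man: "smooth_manifold M A" and X: "geodesic_vector_field M A g X"
    and c: "c \<in> A" and N: "open N" "x0 \<in> N" "N \<subseteq> cran c"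
  shows "\<exists>z\<in>N. chart_geodesic (g c) (X c) z"
proof -
  have cc: "is_chart M c" using man c by (simp add: smooth_manifold_def)
  note ch = is_chartD[OF cc]
  have vf: "vector_field A X" using X by (simp add: geodesic_vector_field_def)
  have "smooth_on (cran c) (X c)" using vf c by (simp add: vector_field_def)
  then have smX: "smooth_on N (X c)" by (rule smooth_on_subset[OF _ N(3)])
  obtain h y where h: "h > 0" and smy: "smooth_on {0<..<h} y" and yN: "\<And>t. t \<in> {0<..<h} \<Longrightarrow> y t \<in> N"
    and dy: "\<And>t. t \<in> {0<..<h} \<Longrightarrow> (y has_vector_derivative X c (y t)) (at t)"
    by (rule ode_solution[OF N(1,2) smX]) blast
  define T where "T = {0<..<h}"
  have T: "open T" "is_interval T" by (simp_all add: T_def is_interval_oo)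
  define \<gamma> where "\<gamma> = cinv c \<circ> y"
  have yc: "y t \<in> cran c" if "t \<in> T" for t using yN that N(3) by (auto simp: T_def)
  have gc: "\<gamma> t \<in> cdom c" "cmap c (\<gamma> t) = y t" if "t \<in> T" for t
    using ch(5,6) yc[OF that] by (simp_all add: \<gamma>_def)
  have trans: "(cmap d \<circ> \<gamma>) t = transition c d (y t)" for d t by (simp add: \<gamma>_def transition_def)
  have yov: "y t \<in> overlap c d" if "t \<in> T" "\<gamma> t \<in> cdom d" for t d
    using overlap_eq(2)[OF cc gc(1)[OF that(1)] that(2)] gc(2)[OF that(1)] by simp
  have sm_tr: "smooth_on (overlap c d) (transition c d)" if "d \<in> A" for d
    using man c that by (simp add: smooth_manifold_def)
  have cy: "continuous_on T y" using smooth_on_continuous[OF smy] by (simp add: T_def)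
  have "integral_curve M A X T \<gamma>"
    unfolding integral_curve_def smooth_curve_def
  proof (intro conjI ballI impI)
    show "continuous_on T \<gamma>"
      unfolding \<gamma>_def by (intro continuous_on_compose cy continuous_on_subset[OF ch(8)]) (use yc in auto)
    show "\<gamma> ` T \<subseteq> M" using gc(1) ch(10) by blast
    fix d assume d: "d \<in> A"
    have od: "open (overlap c d)" using open_overlap[OF cc] man d by (simp add: smooth_manifold_def)
    define S where "S = {t \<in> T. \<gamma> t \<in> cdom d}"
    have "S = T \<inter> y -` overlap c d"
      using yov[of _ d] overlap_eq(1)[OF cc, of d] by (auto simp: S_def \<gamma>_def)
    then have S: "open S" using continuous_open_preimage[OF cy T(1) od] by simp
    have "smooth_on S (\<lambda>t. transition c d (y t))"
      by (rule smooth_on_compose[OF sm_tr[OF d] smooth_on_subset[OF smy] S od]) (use yov[of _ d] in \<open>auto simp: S_def T_def\<close>)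
    then show "smooth_on {t \<in> T. \<gamma> t \<in> cdom d} (cmap d \<circ> \<gamma>)"
      unfolding S_def[symmetric] by (rule smooth_on_cong[OF _ S]) (rule trans)
  next
    fix d t assume d: "d \<in> A" and t: "t \<in> T" "\<gamma> t \<in> cdom d"
    have "((\<lambda>t. transition c d (y t)) has_vector_derivative fd (transition c d) (y t) (X c (y t))) (at t)"
      using vector_derivative_diff_chain_within[OF dy has_derivative_at_withinI[OF smooth_on_has_derivative[OF sm_tr[OF d] yov[OF t]]]] t(1)
      by (simp add: o_def T_def)
    moreover have "X d (cmap d (\<gamma> t)) = fd (transition c d) (y t) (X c (y t))"
      using vf c d yov[OF t] trans[of d t] unfolding vector_field_def by (metis comp_apply)
    ultimately show "((cmap d \<circ> \<gamma>) has_vector_derivative X d (cmap d (\<gamma> t))) (at t)"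
      using trans[of d] by (simp add: o_def)
  qed
  then have geo: "geodesic M A g T \<gamma>" using X T unfolding geodesic_vector_field_def by blast
  define t where "t = h / 2"
  have t: "t \<in> T" using h by (simp add: t_def T_def)
  define Y where "Y = cmap c \<circ> \<gamma>"
  have YT: "Y s = y s" if "s \<in> T" for s using gc(2)[OF that] by (simp add: Y_def)
  have v1: "vector_derivative Y (at s) = X c (y s)" if "s \<in> T" for s
  proof (rule vector_derivative_at)
    show "(Y has_vector_derivative X c (y s)) (at s)"
      by (rule has_vector_derivative_transform_within_open[OF dy T(1) that]) (use that YT in \<open>auto simp: T_def\<close>)
  qed
  have v2: "vector_derivative (\<lambda>s. vector_derivative Y (at s)) (at t) = fd (X c) (y t) (X c (y t))"
  proof (rule vector_derivative_at)
    have "((\<lambda>s. X c (y s)) has_vector_derivative fd (X c) (y t) (X c (y t))) (at t)"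
      using vector_derivative_diff_chain_within[OF dy has_derivative_at_withinI[OF smooth_on_has_derivative[OF smX yN]]] t
      by (simp add: o_def T_def)
    then show "((\<lambda>s. vector_derivative Y (at s)) has_vector_derivative fd (X c) (y t) (X c (y t))) (at t)"
      by (rule has_vector_derivative_transform_within_open[OF _ T(1) t]) (simp add: v1)
  qed
  have "\<forall>c\<in>A. \<forall>t\<in>T. \<gamma> t \<in> cdom c \<longrightarrow> (\<forall>k. vector_derivative (\<lambda>s. vector_derivative (cmap c \<circ> \<gamma>) (at s)) (at t) $ k +
      (\<Sum>i\<in>UNIV. \<Sum>j\<in>UNIV. christoffel (g c) ((cmap c \<circ> \<gamma>) t) k i j *
         vector_derivative (cmap c \<circ> \<gamma>) (at t) $ i * vector_derivative (cmap c \<circ> \<gamma>) (at t) $ j) = 0)"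
    using geo unfolding geodesic_def Let_def by (rule conjunct2)
  from this[rule_format, OF c t gc(1)[OF t]]
  have "chart_geodesic (g c) (X c) (y t)"
    unfolding chart_geodesic_def Y_def[symmetric] v1[OF t] v2 YT[OF t] by blast
  then show ?thesis using yN t by (auto simp: T_def)
qed

text \<open>In an isometric chart the Christoffel symbols are the second derivatives of the chart.\<close>

lemma geodesic_in_isometric_chart:
  assumes iso: "isometric_on (\<lambda>y u v. u \<bullet> (G y *v v)) U \<psi>" and z: "z \<in> U"
    and pos: "\<And>v. v \<noteq> 0 \<Longrightarrow> v \<bullet> (G z *v v) > 0"
    and Y: "smooth_on U Y" and geo: "chart_geodesic G Y z"
  shows "fd (\<lambda>y. fd \<psi> y (Y y)) z (Y z) = 0"
proof -
  note I = isometric_onD[OF iso]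
  define S where "S u v = fd (\<lambda>y. fd \<psi> y u) z v" for u v
  define P where "P = fd \<psi> z"
  define x where "x = Y z"
  define e :: "3 \<Rightarrow> real^3" where "e i = axis i 1" for i
  have sym: "S u v = S v u" for u v unfolding S_def by (rule fd_commute[OF I(1,2) z])
  have linS: "linear (S u)" for u
    unfolding S_def by (rule smooth_on_linear_fd[OF smooth_on_fd[OF I(2)] z])
  have S3: "S u v = (\<Sum>j\<in>UNIV. v $ j *\<^sub>R S u (e j))" for u v
    unfolding e_def sum_3 by (rule linear_3[OF linS])
  have Sxx: "S x x = (\<Sum>i\<in>UNIV. \<Sum>j\<in>UNIV. (x $ i * x $ j) *\<^sub>R S (e i) (e j))"
  proof -
    have "S x x = (\<Sum>i\<in>UNIV. x $ i *\<^sub>R S (e i) x)" using S3[of x x] sym[of x "e _"] by simp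
    also have "\<dots> = (\<Sum>i\<in>UNIV. \<Sum>j\<in>UNIV. (x $ i * x $ j) *\<^sub>R S (e i) (e j))"
      by (subst S3[of "e _" x]) (simp add: scaleR_sum_right)
    finally show ?thesis .
  qed
  have Gij: "(\<lambda>y. e i \<bullet> (G y *v e j)) = (\<lambda>y. G y $ i $ j)" for i j
    by (simp add: fun_eq_iff e_def inner_axis matrix_vector_mult_basis column_def inner_axis')
  have chr: "christoffel G z k i j = (\<Sum>l\<in>UNIV. matrix_inv (G z) $ k $ l * (S (e i) (e j) \<bullet> P (e l)))" for k i j
  proof -
    have "partial i (\<lambda>y. G y $ j $ l) z + partial j (\<lambda>y. G y $ i $ l) z - partial l (\<lambda>y. G y $ i $ j) z
        = 2 * (S (e i) (e j) \<bullet> P (e l))" for l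
      using koszul[OF iso z, of "e i" "e j" "e l"] unfolding Gij S_def P_def by (simp add: partial_def e_def)
    then show ?thesis by (simp add: christoffel_def sum_distrib_left mult_ac)
  qed
  define b :: "real^3" where "b = (\<chi> l. S x x \<bullet> P (e l))"
  define \<Gamma> where "\<Gamma> = matrix_inv (G z) *v b"
  have \<Gamma>: "\<Gamma> $ k = (\<Sum>i\<in>UNIV. \<Sum>j\<in>UNIV. christoffel G z k i j * x $ i * x $ j)" for k
  proof -
    have "\<Gamma> $ k = (\<Sum>l\<in>UNIV. matrix_inv (G z) $ k $ l * (S x x \<bullet> P (e l)))"
      by (simp add: \<Gamma>_def b_def matrix_vector_mult_def)
    also have "\<dots> = (\<Sum>i\<in>UNIV. \<Sum>j\<in>UNIV. christoffel G z k i j * x $ i * x $ j)"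
      unfolding chr Sxx sum_3 by (simp add: inner_add_left algebra_simps)
    finally show ?thesis .
  qed
  have acc: "fd Y z x = - \<Gamma>"
    using geo unfolding chart_geodesic_def x_def[symmetric] \<Gamma>[symmetric]
    by (simp add: vec_eq_iff eq_neg_iff_add_eq_0)
  have "invertible (G z)"
    unfolding invertible_left_inverse matrix_left_invertible_ker
    using pos by (metis inner_zero_right less_irrefl)
  then have "G z ** matrix_inv (G z) = mat 1"
    unfolding invertible_def matrix_inv_def by (rule someI2_ex) simp
  then have G\<Gamma>: "G z *v \<Gamma> = b"
    by (simp add: \<Gamma>_def matrix_vector_mul_assoc)
  have linP: "linear P" unfolding P_def by (rule I(5)[OF z])
  \<comment> \<open>In the metric \<open>G\<close> the vector \<open>\<Gamma>\<close> pairs with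
    \<open>w\<close> as \<open>S x x\<close> pairs with \<open>P w\<close>. As \<open>P\<close> is
    onto, \<open>P \<Gamma> = S x x\<close>, so the acceleration \<open>- \<Gamma>\<close> cancels
    the second derivative of the chart.\<close>
  have "(P \<Gamma> - S x x) \<bullet> P w = 0" for w
  proof -
    have "P \<Gamma> \<bullet> P w = w \<bullet> (G z *v \<Gamma>)" using I(3)[OF z, of w \<Gamma>] by (simp add: P_def inner_commute)
    also have "\<dots> = S x x \<bullet> (\<Sum>l\<in>UNIV. w $ l *\<^sub>R P (e l))"
      unfolding G\<Gamma> b_def inner_vec_def[of w] sum_3 by (simp add: inner_add_right mult_ac)
    also have "(\<Sum>l\<in>UNIV. w $ l *\<^sub>R P (e l)) = P w"
      unfolding e_def sum_3 by (rule linear_3[OF linP, symmetric])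
    finally show ?thesis by (simp add: inner_diff_left)
  qed
  moreover have "\<exists>w. P w = P \<Gamma> - S x x"
  proof -
    have "v = 0" if "P v = 0" for v using I(3)[OF z, of v v] pos[of v] that by (auto simp: P_def)
    then show ?thesis using inv3_right[OF linP] by blast
  qed
  ultimately have "(P \<Gamma> - S x x) \<bullet> (P \<Gamma> - S x x) = 0" by metis
  then have "P \<Gamma> = S x x" by simp
  moreover have "fd (\<lambda>y. fd \<psi> y (Y y)) z x = S x x + P (fd Y z x)"
    unfolding S_def P_def x_def by (rule fd_fd_apply[OF I(1,2) Y z])
  ultimately show ?thesis unfolding acc x_def[symmetric] using linP by (simp add: linear_neg)
qed

context local_diffeo
begin

text \<open>A local inverse \<open>\<psi>\<close> of \<open>cmap c \<circ> q\<close> is an isometric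
  chart and takes the geodesic equation to \<open>DZ(Z) = 0\<close>. If this failed at
  \<open>y\<close>, it would fail on a neighbourhood, against the density of points where the
  geodesic equation holds.\<close>

lemma geodesic_pullback_straight:
  assumes g: "riemannian_metric A g" and X: "geodesic_vector_field M A g X"
    and euclid: "\<And>y u v. pullback_metric g y u v = u \<bullet> v"
  shows "fd (pullback_field X) y (pullback_field X y) = 0"
proof (rule ccontr)
  define Z where "Z = pullback_field X"
  assume "fd (pullback_field X) y (pullback_field X y) \<noteq> 0"
  then have ne: "fd Z y (Z y) \<noteq> 0" by (simp add: Z_def)
  have vf: "vector_field A X" using X by (simp add: geodesic_vector_field_def)
  have smZ: "smooth_on UNIV Z" unfolding Z_def by (rule smooth_pullback_field[OF vf])
  obtain c where c: "c \<in> A" "q y \<in> cdom c" using chart_ex by blast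
  define h where "h = cmap c \<circ> q"
  define Q where "Q = q -` cdom c"
  have Q: "open Q" "smooth_on Q h" "y \<in> Q" using open_dom smooth_chart c by (simp_all add: Q_def h_def)
  have imm: "v = 0" if "w \<in> Q" "fd h w v = 0" for w v
    using immersion[OF c(1), of w v] that by (simp add: Q_def h_def)
  obtain U \<psi> where U: "open U" "U \<subseteq> Q" "y \<in> U" "open (h ` U)" "smooth_on (h ` U) \<psi>" "\<And>w. w \<in> U \<Longrightarrow> \<psi> (h w) = w"
    using local_inverse[OF Q] imm by metis
  define V where "V = h ` U"
  have V: "open V" "smooth_on V \<psi>" using U by (simp_all add: V_def)
  have Vc: "V \<subseteq> cran c" using U(2) chart_cran[OF c(1)] by (auto simp: V_def h_def Q_def)
  have inv1: "\<psi> z \<in> U" "h (\<psi> z) = z" if "z \<in> V" for z using that U(6) by (auto simp: V_def)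
  have dh: "(h has_derivative fd h w) (at w)" if "w \<in> U" for w
    using smooth_on_has_derivative[OF Q(2)] U(2) that by blast
  have d\<psi>: "(\<psi> has_derivative fd \<psi> z) (at z)" if "z \<in> V" for z
    by (rule smooth_on_has_derivative[OF V(2) that])
  have h\<psi>: "fd h (\<psi> z) (fd \<psi> z v) = v" if "z \<in> V" for z v
  proof -
    have "fd (\<lambda>z. h (\<psi> z)) z v = fd h (\<psi> z) (fd \<psi> z v)"
      by (rule fd_compose[OF d\<psi>[OF that] dh[OF inv1(1)[OF that]]])
    moreover have "fd (\<lambda>z. h (\<psi> z)) z = fd (\<lambda>z. z) z" by (rule fd_cong[OF V(1) that inv1(2)])
    ultimately show ?thesis by simp
  qed
  have cdU: "q w \<in> cdom c" if "w \<in> U" for w using that U(2) by (auto simp: Q_def)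
  have iso: "isometric_on (\<lambda>z u v. u \<bullet> (g c z *v v)) V \<psi>"
    unfolding isometric_on_def
  proof (intro conjI ballI allI V)
    fix z u v assume z: "z \<in> V"
    have "fd \<psi> z u \<bullet> fd \<psi> z v = pullback_metric g (\<psi> z) (fd \<psi> z u) (fd \<psi> z v)" by (simp add: euclid)
    also have "\<dots> = u \<bullet> (g c z *v v)"
      unfolding pullback_metric[OF g c(1) cdU[OF inv1(1)[OF z]]] h_def[symmetric] h\<psi>[OF z] inv1(2)[OF z] ..
    finally show "fd \<psi> z u \<bullet> fd \<psi> z v = u \<bullet> (g c z *v v)" .
  qed
  have smX: "smooth_on V (X c)"
    using vf c(1) Vc smooth_on_subset[of "cran c" "X c" V] by (simp add: vector_field_def)
  have Z\<psi>: "Z (\<psi> z) = fd \<psi> z (X c z)" if z: "z \<in> V" for z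
  proof -
    have "fd h (\<psi> z) (Z (\<psi> z)) = X c z"
      using pullback_field(1)[OF vf c(1) cdU[OF inv1(1)[OF z]]] inv1(2)[OF z] by (simp add: Z_def h_def)
    then have "fd h (\<psi> z) (Z (\<psi> z) - fd \<psi> z (X c z)) = 0"
      using has_derivative_linear[OF dh[OF inv1(1)[OF z]]] h\<psi>[OF z] by (simp add: linear_diff)
    then show ?thesis using imm[of "\<psi> z"] inv1(1)[OF z] U(2) by fastforce
  qed
  define F where "F w = fd Z w (Z w)" for w
  have cF: "continuous_on UNIV F"
    unfolding F_def by (rule smooth_on_continuous[OF smooth_on_fd_apply[OF open_UNIV smZ smZ]])
  define N where "N = V \<inter> \<psi> -` (F -` (- {0}))"
  have "open (F -` (- {0}))" by (rule open_vimage[OF _ cF]) auto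
  then have "open N"
    unfolding N_def using continuous_open_preimage[OF smooth_on_continuous[OF V(2)] V(1)] by blast
  moreover have "h y \<in> N" using U(3,6) ne by (auto simp: N_def V_def F_def)
  moreover have "N \<subseteq> cran c" using Vc by (auto simp: N_def)
  ultimately obtain z where z: "z \<in> N" "chart_geodesic (g c) (X c) z"
    using geodesic_field_dense[OF man X c(1)] by blast
  then have zV: "z \<in> V" by (simp add: N_def)
  have "fd (\<lambda>y. fd \<psi> y (X c y)) z (X c z) = 0"
    by (rule geodesic_in_isometric_chart[OF iso zV _ smX z(2)])
      (use g c(1) Vc zV in \<open>auto simp: riemannian_metric_def\<close>)
  moreover have "fd (\<lambda>y. fd \<psi> y (X c y)) z = fd (\<lambda>y. Z (\<psi> y)) z"
    by (rule fd_cong[OF V(1) zV]) (simp add: Z\<psi>)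
  moreover have "fd (\<lambda>y. Z (\<psi> y)) z (X c z) = fd Z (\<psi> z) (fd \<psi> z (X c z))"
    by (rule fd_compose[OF d\<psi>[OF zV] smooth_on_has_derivative[OF smZ UNIV_I]])
  ultimately have "F (\<psi> z) = 0" by (simp add: F_def Z\<psi>[OF zV])
  then show False using z(1) by (simp add: N_def)
qed

end

subsection \<open>The contact structure on the universal cover\<close>

lemma diffeomorphismD:
  assumes "diffeomorphism f"
  shows "bij f" "smooth_on UNIV f" "smooth_on UNIV (inv f)"
    "inv f (f x) = x" "f (inv f y) = y"
    "(f has_derivative fd f x) (at x)" "(inv f has_derivative fd (inv f) y) (at y)"
    "fd (inv f) (f x) (fd f x v) = v" "fd f (inv f y) (fd (inv f) y w) = w"
proof -
  show b: "bij f" and s: "smooth_on UNIV f" "smooth_on UNIV (inv f)" using assms by (auto simp: diffeomorphism_def)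
  show i: "inv f (f x) = x" "f (inv f y) = y" for x y
    using b by (simp_all add: bij_is_inj bij_is_surj surj_f_inv_f)
  show d: "(f has_derivative fd f x) (at x)" "(inv f has_derivative fd (inv f) y) (at y)" for x y
    using smooth_on_has_derivative[OF s(1)] smooth_on_has_derivative[OF s(2)] by auto
  show "fd (inv f) (f x) (fd f x v) = v"
    using fd_compose[OF d(1)[of x] d(2), of v] by (simp add: i)
  show "fd f (inv f y) (fd (inv f) y w) = w"
    using fd_compose[OF d(2)[of y] d(1), of w] by (simp add: i)
qed

lemma diffeomorphism_compose:
  assumes "diffeomorphism f" "diffeomorphism g"
  shows "diffeomorphism (f \<circ> g)"
proof -
  note f = diffeomorphismD[OF assms(1)] and g = diffeomorphismD[OF assms(2)]
  have "smooth_on UNIV (f \<circ> g)"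
    using smooth_on_compose[OF f(2) g(2)] by (simp add: o_def)
  moreover have "smooth_on UNIV (inv (f \<circ> g))"
    using smooth_on_compose[OF g(3) f(3)] o_inv_distrib[OF f(1) g(1)] by (simp add: o_def)
  ultimately show ?thesis using bij_comp[OF g(1) f(1)] by (simp add: diffeomorphism_def)
qed

lemma diffeomorphic_structures_pullback:
  assumes f: "diffeomorphism f" and pull: "\<And>x v. \<beta> (f x) \<bullet> fd f x v = \<alpha> x \<bullet> v"
  shows "diffeomorphic_structures (ker_form \<alpha>) (ker_form \<beta>)"
proof -
  note F = diffeomorphismD[OF f]
  have "fd f x ` ker_form \<alpha> x = ker_form \<beta> (f x)" for x
  proof (intro equalityI subsetI)
    fix w assume w: "w \<in> ker_form \<beta> (f x)"
    define v where "v = fd (inv f) (f x) w"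
    have "fd f x v = w" using F(9)[of "f x" w] by (simp add: v_def F(4))
    moreover from this have "v \<in> ker_form \<alpha> x" using w pull[of x v] by (simp add: ker_form_def)
    ultimately show "w \<in> fd f x ` ker_form \<alpha> x" by blast
  qed (auto simp: ker_form_def pull)
  then show ?thesis using f by (auto simp: diffeomorphic_structures_def)
qed

lemma fd2_bound_on_compact:
  fixes f :: "'a::euclidean_space \<Rightarrow> 'b::euclidean_space"
  assumes "smooth_on UNIV f" "compact K"
  shows "\<exists>L\<ge>0. \<forall>x\<in>K. \<forall>u v. norm (fd (\<lambda>y. fd f y u) x v) \<le> L * norm u * norm v"
proof -
  obtain B where B: "\<And>b. B b \<ge> 0" "\<And>b x v. x \<in> K \<Longrightarrow> norm (fd (\<lambda>y. fd f y b) x v) \<le> B b * norm v"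
    using fd_bound_on_compact[OF smooth_on_fd[OF assms(1)] assms(2) subset_UNIV] by metis
  show ?thesis
  proof (intro exI[of _ "\<Sum>b\<in>Basis. B b"] conjI ballI allI)
    show "0 \<le> (\<Sum>b\<in>Basis. B b)" using B(1) by (auto intro: sum_nonneg)
    fix x u v assume x: "x \<in> K"
    \<comment> \<open>Exchanging \<open>u\<close> and \<open>v\<close> makes the linearity of the
      derivative available for \<open>u\<close>, so that \<open>u\<close> can be expanded in the
      basis.\<close>
    have sym: "fd (\<lambda>y. fd f y u) x v = fd (\<lambda>y. fd f y v) x u" for u v
      by (rule fd_commute[OF open_UNIV assms(1)]) simp
    have "fd (\<lambda>y. fd f y u) x v = (\<Sum>b\<in>Basis. (u \<bullet> b) *\<^sub>R fd (\<lambda>y. fd f y b) x v)"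
      unfolding sym[of u v]
      by (subst linear_sum_Basis[OF smooth_on_linear_fd[OF smooth_on_fd[OF assms(1)] UNIV_I], of v x u]) (simp add: sym[of v])
    also have "norm \<dots> \<le> (\<Sum>b\<in>Basis. B b * norm u * norm v)"
    proof (rule sum_norm_le)
      fix b :: 'a assume "b \<in> Basis"
      have "\<bar>u \<bullet> b\<bar> \<le> norm u" using Basis_le_norm[OF \<open>b \<in> Basis\<close>] .
      then have "\<bar>u \<bullet> b\<bar> * norm (fd (\<lambda>y. fd f y b) x v) \<le> norm u * (B b * norm v)"
        using B x by (intro mult_mono) auto
      then show "norm ((u \<bullet> b) *\<^sub>R fd (\<lambda>y. fd f y b) x v) \<le> B b * norm u * norm v" by (simp add: mult_ac)
    qed
    finally show "norm (fd (\<lambda>y. fd f y u) x v) \<le> (\<Sum>b\<in>Basis. B b) * norm u * norm v" by (simp add: sum_distrib_right)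
  qed
qed

text \<open>The derivative of a relation between germs. Two fields are allowed so that the statement
  can be iterated: for second derivatives \<open>Y\<close> and \<open>Z\<close> are derivatives of
  one field in the directions \<open>Q u'\<close> and \<open>u'\<close>.\<close>

lemma equivariant_fd:
  fixes Y Z :: "real^3 \<Rightarrow> real^3"
  assumes Q: "orthogonal_transformation Q" and W: "open W" "z \<in> W"
    and Y: "smooth_on UNIV Y" "smooth_on UNIV Z" and eq: "\<And>w. w \<in> W \<Longrightarrow> Y (Q w + b) = Q (Z w)"
  shows "fd Y (Q z + b) (Q v) = Q (fd Z z v)"
proof -
  have bl: "bounded_linear Q" using Q orthogonal_transformation_linear linear_conv_bounded_linear by blast
  have dQ: "((\<lambda>w. Q w + b) has_derivative (\<lambda>v. Q v + 0)) (at z)"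
    by (intro has_derivative_add bounded_linear.has_derivative[OF bl has_derivative_ident] has_derivative_const)
  have "fd (\<lambda>w. Y (Q w + b)) z v = fd Y (Q z + b) (Q v + 0)"
    by (rule fd_compose[OF dQ smooth_on_has_derivative[OF Y(1) UNIV_I]])
  moreover have "fd (\<lambda>w. Y (Q w + b)) z = fd (\<lambda>w. Q (Z w)) z" by (rule fd_cong[OF W eq])
  moreover have "fd (\<lambda>w. Q (Z w)) z v = Q (fd Z z v)"
    by (rule fd_bounded_linear[OF bl smooth_on_has_derivative[OF Y(2) UNIV_I]])
  ultimately show ?thesis by simp
qed

lemma cross3_surj:
  fixes x :: "real^3"
  obtains u v where "cross3 u v = x"
proof -
  obtain w where w: "w \<noteq> 0" "orthogonal x w" by (rule orthogonal_to_vector_exists[of x]) auto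
  define n where "n = w /\<^sub>R norm w"
  have n: "n \<bullet> n = 1" "n \<bullet> x = 0"
    using w by (auto simp: n_def orthogonal_def inner_commute dot_square_norm power2_eq_square)
  have "cross3 n (cross3 x n) = x" unfolding Lagrange using n by simp
  then show ?thesis by (rule that)
qed

text \<open>The deck transformations act cocompactly by rigid motions; only their germs are needed for
  the bounds.\<close>

locale cocompact_pair =
  fixes X a :: "real^3 \<Rightarrow> real^3" and K :: "(real^3) set"
  assumes smX: "smooth_on UNIV X" and sma: "smooth_on UNIV a" and K: "compact K"
    and inv: "\<exists>z\<in>K. \<exists>Q b W. orthogonal_transformation Q \<and> open W \<and> z \<in> W \<and> Q z + b = y \<and>
      (\<forall>w\<in>W. X (Q w + b) = Q (X w) \<and> a (Q w + b) = Q (a w))"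
begin

lemma fd_bound: "\<exists>L. \<forall>y v. norm (fd X y v) \<le> L * norm v"
proof -
  obtain L where L: "\<And>x v. x \<in> K \<Longrightarrow> norm (fd X x v) \<le> L * norm v"
    using fd_bound_on_compact[OF smX K subset_UNIV] by blast
  have "norm (fd X y v) \<le> L * norm v" for y v
  proof -
    obtain z Q b W where z: "z \<in> K" and Q: "orthogonal_transformation Q" and W: "open W" "z \<in> W" and y: "Q z + b = y"
      and eq: "\<And>w. w \<in> W \<Longrightarrow> X (Q w + b) = Q (X w)" using inv by blast
    obtain v' where v: "v = Q v'" using orthogonal_transformation_surj[OF Q] by (metis surjD)
    show ?thesis
      using L[OF z, of v'] equivariant_fd[OF Q W smX smX eq, of v'] orthogonal_transformation_norm[OF Q]
      by (simp add: v y)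
  qed
  then show ?thesis by blast
qed

lemma fd2_bound: "\<exists>L. \<forall>y u v. norm (fd (\<lambda>w. fd X w u) y v) \<le> L * norm u * norm v"
proof -
  obtain L where L: "\<And>x u v. x \<in> K \<Longrightarrow> norm (fd (\<lambda>w. fd X w u) x v) \<le> L * norm u * norm v"
    using fd2_bound_on_compact[OF smX K] by blast
  have "norm (fd (\<lambda>w. fd X w u) y v) \<le> L * norm u * norm v" for y u v
  proof -
    obtain z Q b W where z: "z \<in> K" and Q: "orthogonal_transformation Q" and W: "open W" "z \<in> W" and y: "Q z + b = y"
      and eq: "\<And>w. w \<in> W \<Longrightarrow> X (Q w + b) = Q (X w)" using inv by blast
    obtain u' v' where uv: "u = Q u'" "v = Q v'" using orthogonal_transformation_surj[OF Q] by (metis surjD)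
    have "fd X (Q w + b) (Q u') = Q (fd X w u')" if "w \<in> W" for w
      by (rule equivariant_fd[OF Q W(1) that smX smX eq])
    from equivariant_fd[OF Q W smooth_on_fd[OF smX] smooth_on_fd[OF smX] this, of v']
    show ?thesis
      using L[OF z, of u' v'] orthogonal_transformation_norm[OF Q] by (simp add: uv y)
  qed
  then show ?thesis by blast
qed

lemma inner_bound:
  assumes "\<And>y. a y \<bullet> X y > 0"
  shows "\<exists>c>0. \<forall>y. c \<le> a y \<bullet> X y"
proof -
  have "K \<noteq> {}" using inv by blast
  moreover have "continuous_on K (\<lambda>y. a y \<bullet> X y)"
    by (intro continuous_on_inner continuous_on_subset[OF smooth_on_continuous[OF smX]]
        continuous_on_subset[OF smooth_on_continuous[OF sma]]) auto
  ultimately obtain k where k: "k \<in> K" "\<And>z. z \<in> K \<Longrightarrow> a k \<bullet> X k \<le> a z \<bullet> X z"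
    using continuous_attains_inf[OF K] by blast
  have "a k \<bullet> X k \<le> a y \<bullet> X y" for y
  proof -
    obtain z Q b W where z: "z \<in> K" "orthogonal_transformation Q" "z \<in> W" "Q z + b = y"
      "\<forall>w\<in>W. X (Q w + b) = Q (X w) \<and> a (Q w + b) = Q (a w)" using inv by metis
    then have "a y \<bullet> X y = a z \<bullet> X z" by (auto simp: orthogonal_transformation_def)
    then show ?thesis using k(2)[OF z(1)] by simp
  qed
  then show ?thesis using assms by blast
qed

lemma curl_bound:
  assumes "\<And>y. curl3 a y \<bullet> X y \<noteq> 0"
  shows "\<exists>m>0. \<exists>C. \<forall>y. m \<le> \<bar>curl3 a y \<bullet> X y\<bar> \<and> \<bar>curl3 a y \<bullet> X y\<bar> \<le> C"
proof -
  define f where "f y = \<bar>curl3 a y \<bullet> X y\<bar>" for y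
  have "K \<noteq> {}" using inv by blast
  moreover have "continuous_on K f"
  proof -
    have "smooth_on UNIV (\<lambda>y. curl3 a y \<bullet> X y)"
      unfolding curl3_def ext_deriv_def
      by (intro smooth_on_inner smooth_on_vector_3 smooth_on_diff smooth_on_fd sma smX smooth_on_const open_UNIV)
    then have "continuous_on UNIV (\<lambda>y. curl3 a y \<bullet> X y)" by (rule smooth_on_continuous)
    then show ?thesis unfolding f_def by (intro continuous_on_rabs) (rule continuous_on_subset, auto)
  qed
  ultimately obtain k l where k: "k \<in> K" "\<And>z. z \<in> K \<Longrightarrow> f k \<le> f z" and l: "l \<in> K" "\<And>z. z \<in> K \<Longrightarrow> f z \<le> f l"
    using continuous_attains_inf[OF K] continuous_attains_sup[OF K] by metis
  have "\<exists>z\<in>K. f y = f z" for y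
  proof -
    obtain z Q b W where z: "z \<in> K" and Q: "orthogonal_transformation Q" and W: "open W" "z \<in> W" and y: "Q z + b = y"
      and eq: "\<And>w. w \<in> W \<Longrightarrow> X (Q w + b) = Q (X w)" "\<And>w. w \<in> W \<Longrightarrow> a (Q w + b) = Q (a w)"
      using inv by blast
    have lin: "linear (fd a w)" for w by (rule smooth_on_linear_fd[OF sma UNIV_I])
    have ext: "ext_deriv a y (Q u) (Q v) = ext_deriv a z u v" for u v
      unfolding ext_deriv_def using equivariant_fd[OF Q W sma sma eq(2)] Q
      by (simp add: y orthogonal_transformation_def)
    obtain u v where uv: "cross3 u v = X z" by (rule cross3_surj)
    have "curl3 a z \<bullet> X z = curl3 a y \<bullet> cross3 (Q u) (Q v)"
      using ext_deriv_curl3[OF lin, of z u v] ext_deriv_curl3[OF lin, of y "Q u" "Q v"] ext[of u v] uv by simp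
    \<comment> \<open>\<open>Q\<close> may reverse orientation; the absolute value in
      \<open>f\<close> absorbs the factor \<open>det (matrix Q)\<close>, which is 1 or -1.\<close>
    also have "cross3 (Q u) (Q v) = det (matrix Q) *\<^sub>R Q (X z)"
      using cross_orthogonal_transformation[OF Q] uv by simp
    also have "Q (X z) = X y" using eq(1)[OF W(2)] y by simp
    finally have "f z = \<bar>det (matrix Q)\<bar> * f y" by (simp add: f_def abs_mult)
    then have "f y = f z" using orthogonal_transformation_det[OF Q] by simp
    then show ?thesis using z by blast
  qed
  then have "f k \<le> f y \<and> f y \<le> f l" for y using k l by metis
  then show ?thesis using assms[of k] unfolding f_def by (intro exI[of _ "\<bar>curl3 a k \<bullet> X k\<bar>"]) auto
qed

end

section \<open>The lifted structures in Euclidean space\<close>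

lemma local_diffeo_compose:
  assumes "local_diffeo M A p" and F: "smooth_on UNIV F" "\<And>y v. fd F y v = 0 \<Longrightarrow> v = 0"
  shows "local_diffeo M A (p \<circ> F)"
proof -
  interpret local_diffeo M A p by fact
  have dF: "(F has_derivative fd F y) (at y)" for y using smooth_on_has_derivative[OF F(1)] by simp
  have dom: "(p \<circ> F) -` S = F -` (p -` S)" for S by auto
  have op: "open ((p \<circ> F) -` cdom c)" if "c \<in> A" for c
    unfolding dom by (rule open_vimage[OF open_dom[OF that] smooth_on_continuous[OF F(1)]])
  show ?thesis
  proof
    show "smooth_manifold M A" by (rule man)
    show "(p \<circ> F) y \<in> M" for y using qM by simp
    show "open ((p \<circ> F) -` cdom c)" if "c \<in> A" for c by (rule op[OF that])
    show "smooth_on ((p \<circ> F) -` cdom c) (cmap c \<circ> (p \<circ> F))" if c: "c \<in> A" for c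
      using smooth_on_compose[OF smooth_chart[OF c] smooth_on_subset[OF F(1)] op[OF c] open_dom[OF c]]
      by (simp add: o_def image_subset_iff)
    show "v = 0" if c: "c \<in> A" "(p \<circ> F) y \<in> cdom c" and z: "fd (cmap c \<circ> (p \<circ> F)) y v = 0" for c y v
    proof -
      have "fd (\<lambda>z. (cmap c \<circ> p) (F z)) y v = fd (cmap c \<circ> p) (F y) (fd F y v)"
        by (rule fd_compose[OF dF der_chart[OF c(1)]]) (use c in simp)
      then have "fd (cmap c \<circ> p) (F y) (fd F y v) = 0" using z by (simp add: o_def)
      moreover have "p (F y) \<in> cdom c" using c(2) by simp
      ultimately show ?thesis using F(2) immersion[OF c(1)] by blast
    qed
  qed
qed

context local_diffeo
begin

lemma unit_pullback_field:
  assumes g: "riemannian_metric A g" and X: "geodesic_vector_field M A g X"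
  shows "pullback_metric g y (pullback_field X y) (pullback_field X y) = 1"
proof -
  obtain c where c: "c \<in> A" "q y \<in> cdom c" using chart_ex by blast
  have "vector_field A X" using X by (simp add: geodesic_vector_field_def)
  from pullback_field(1)[OF this c] show ?thesis
    unfolding pullback_metric[OF g c] using X c(1) chart_cran[OF c] by (simp add: geodesic_vector_field_def)
qed

text \<open>The kernel condition is homogeneous in the field, and the positive factor preserves the
  sign of the value of the form.\<close>

lemma conformally_reeb_pullback:
  assumes \<alpha>: "one_form A \<alpha>" and X: "vector_field A X" and R: "conformally_reeb M A \<alpha> X"
  shows "ext_deriv (pullback_form A q \<alpha>) y (pullback_field X y) v = 0"
    and "pullback_form A q \<alpha> y \<bullet> pullback_field X y > 0"
proof -
  obtain R f where R: "reeb_field A \<alpha> R" and f: "\<And>m. m \<in> M \<Longrightarrow> f m > 0"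
    and XR: "\<And>c x. c \<in> A \<Longrightarrow> x \<in> cran c \<Longrightarrow> X c x = f (cinv c x) *\<^sub>R R c x"
    using R unfolding conformally_reeb_def by metis
  obtain c where c: "c \<in> A" "q y \<in> cdom c" using chart_ex by blast
  define z where "z = (cmap c \<circ> q) y"
  have z: "z \<in> cran c" unfolding z_def by (rule chart_cran[OF c])
  have "cinv c z \<in> M" using is_chartD(6,10)[OF chart[OF c(1)]] z by blast
  then have fz: "f (cinv c z) > 0" by (rule f)
  have smc: "smooth_on (cran c) (\<alpha> c)" using \<alpha> c by (simp add: one_form_def)
  have lin: "linear (fd (\<alpha> c) z)" by (rule smooth_on_linear_fd[OF smc z])
  have Rz: "\<And>v. ext_deriv (\<alpha> c) z (R c z) v = 0" "\<alpha> c z \<bullet> R c z = 1"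
    using R c(1) z unfolding reeb_field_def by blast+
  have "ext_deriv (\<alpha> c) z (X c z) v = f (cinv c z) * ext_deriv (\<alpha> c) z (R c z) v" for v
    unfolding XR[OF c(1) z] ext_deriv_def by (simp add: linear_cmul[OF lin] right_diff_distrib)
  then show "ext_deriv (pullback_form A q \<alpha>) y (pullback_field X y) v = 0"
    unfolding ext_deriv_pullback_form[OF \<alpha> c] pullback_field(1)[OF X c] z_def[symmetric] Rz by simp
  show "pullback_form A q \<alpha> y \<bullet> pullback_field X y > 0"
    unfolding pullback_form[OF \<alpha> c] pullback_field(1)[OF X c] z_def[symmetric] XR[OF c(1) z]
    using fz Rz(2) by simp
qed

lemma contact_pullback:
  assumes "contact_form A \<alpha>"
  shows "\<exists>u v w. wedge_ext_deriv (pullback_form A q \<alpha>) y u v w \<noteq> 0"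
proof -
  have \<alpha>: "one_form A \<alpha>" using assms by (simp add: contact_form_def)
  obtain c where c: "c \<in> A" "q y \<in> cdom c" using chart_ex by blast
  define L where "L = fd (cmap c \<circ> q) y"
  have surj: "\<exists>v. L v = w" for w
    using linear_eq_zero_imp_surj[OF lin_chart[OF c] immersion[OF c]] unfolding L_def by metis
  obtain u v w where uvw: "wedge_ext_deriv (\<alpha> c) ((cmap c \<circ> q) y) u v w \<noteq> 0"
    using assms c(1) chart_cran[OF c] unfolding contact_form_def by blast
  obtain u' v' w' where "L u' = u" "L v' = v" "L w' = w" using surj by metis
  then have "wedge_ext_deriv (pullback_form A q \<alpha>) y u' v' w' = wedge_ext_deriv (\<alpha> c) ((cmap c \<circ> q) y) u v w"
    unfolding wedge_ext_deriv_def ext_deriv_pullback_form[OF \<alpha> c] pullback_form[OF \<alpha> c] L_def by simp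
  then show ?thesis using uvw by metis
qed

end

text \<open>The kernel condition makes the curl parallel to \<open>x\<close>. If it were also
  orthogonal to \<open>x\<close>, it would vanish, and \<open>da\<close> with it, against the
  contact condition.\<close>

lemma contact_curl_nonzero:
  assumes lin: "linear (fd a y)" and ker: "\<And>v. ext_deriv a y x v = 0" and x: "norm x = 1"
    and contact: "wedge_ext_deriv a y u v w \<noteq> 0"
  shows "curl3 a y \<bullet> x \<noteq> 0"
proof
  assume z: "curl3 a y \<bullet> x = 0"
  have "cross3 (curl3 a y) x = 0"
    by (rule cross3_all_eq_0_imp) (use ker ext_deriv_curl3[OF lin] in metis)
  then have "curl3 a y = 0" using cross3_eq_0_imp[OF _ x] z by fastforce
  then show False using contact by (simp add: wedge_ext_deriv_def ext_deriv_curl3[OF lin])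
qed

theorem corollary3:
  fixes M :: "'a::{t2_space,second_countable_topology} set"
    and A :: "'a chart set"
    and g :: "'a chart \<Rightarrow> real^3 \<Rightarrow> real^3^3"
    and X \<alpha> :: "'a chart \<Rightarrow> real^3 \<Rightarrow> real^3"
    and p :: "real^3 \<Rightarrow> 'a"
  assumes "smooth_manifold M A" and "compact M" and "connected M"
    and "riemannian_metric A g" and "flat_metric M A g"
    and "geodesic_vector_field M A g X"
    and "contact_form A \<alpha>"
    and "conformally_reeb M A \<alpha> X"
    and "smooth_covering M A p"
  shows "diffeomorphic_structures (ker_form (pullback_form A p \<alpha>)) (ker_form std_contact_form)"
proof -
  note g = assms(4)
  have cov: "covering_space UNIV p M" using assms(9) by (simp add: smooth_covering_def)
  have contp: "continuous_on UNIV p" by (rule covering_space_imp_continuous[OF cov])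
  have X: "vector_field A X" using assms(6) by (simp add: geodesic_vector_field_def)
  have \<alpha>: "one_form A \<alpha>" using assms(7) by (simp add: contact_form_def)
  interpret p: local_diffeo M A p by (rule smooth_covering_local_diffeo[OF assms(1,9)])
  define H where "H = p.pullback_metric g"
  obtain K where K: "compact K" "\<And>x. \<exists>k\<in>K. p k = p x" using covering_compact_section[OF cov assms(2)] by blast
  \<comment> \<open>The covering gives continuous changes of sheets. They are smooth, being locally
    \<open>p\<close> followed by a local inverse of \<open>p\<close>, and preserve the lifted metric
    because it comes from \<open>M\<close>.\<close>
  have decks: "\<exists>W. open W \<and> x0 \<in> W \<and> (\<forall>k\<in>W. \<forall>x. p k = p x \<longrightarrow>
    (\<exists>\<delta>. smooth_on W \<delta> \<and> \<delta> k = x \<and> (\<forall>y\<in>W. p y = p (\<delta> y) \<and> (\<forall>u v. H (\<delta> y) (fd \<delta> y u) (fd \<delta> y v) = H y u v))))" for x0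
  proof -
    obtain W where W: "open W" "x0 \<in> W" and d: "\<And>k x. k \<in> W \<Longrightarrow> p k = p x \<Longrightarrow>
      \<exists>\<delta>. continuous_on W \<delta> \<and> \<delta> k = x \<and> (\<forall>y\<in>W. p (\<delta> y) = p y)"
      using covering_local_decks[OF cov, of x0] by blast
    show ?thesis
    proof (intro exI[of _ W] conjI W ballI allI impI)
      fix k x assume "k \<in> W" "p k = p x"
      then obtain \<delta> where \<delta>: "continuous_on W \<delta>" "\<delta> k = x" "\<And>y. y \<in> W \<Longrightarrow> p (\<delta> y) = p y" using d by blast
      have sm: "smooth_on W \<delta>" by (rule p.deck_smooth[OF W(1) \<delta>(1,3)])
      have "H (\<delta> y) (fd \<delta> y u) (fd \<delta> y v) = H y u v" if "y \<in> W" for y u v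
        unfolding H_def by (rule p.deck_isometric[OF W(1) sm \<delta>(3) that g])
      then show "\<exists>\<delta>. smooth_on W \<delta> \<and> \<delta> k = x \<and> (\<forall>y\<in>W. p y = p (\<delta> y) \<and> (\<forall>u v. H (\<delta> y) (fd \<delta> y u) (fd \<delta> y v) = H y u v))"
        using sm \<delta> by (intro exI[of _ \<delta>]) auto
    qed
  qed
  interpret H: complete_flat H "\<lambda>x y. p x = p y" K
  proof
    show "u = 0" if "H x u u = 0" for x u using p.pullback_metric_pos[OF g] that by (simp add: H_def)
    show "\<exists>U \<psi>. x \<in> U \<and> isometric_on H U \<psi>" for x
      unfolding H_def by (rule p.pullback_metric_flat[OF g assms(5) contp])
    show "compact K" "\<exists>k\<in>K. p k = p x" for x using K by auto
    show "locally_related_isometrically H (\<lambda>x y. p x = p y)"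
      unfolding locally_related_isometrically_def using decks by blast
  qed
  obtain D where D: "isometric_on H UNIV D" and diffD: "diffeomorphism D" by (rule H.developing_diffeomorphism)
  define F where "F = inv D"
  note DD = diffeomorphismD[OF diffD, folded F_def]
  have injF: "v = 0" if "fd F y v = 0" for y v
    using DD(9)[of y v] linear_0[OF has_derivative_linear[OF DD(6)]] that by metis
  \<comment> \<open>From here on the universal cover is read through the inverse of the developing
    map, so that the lifted metric becomes the Euclidean inner product.\<close>
  define q where "q = p \<circ> F"
  interpret q: local_diffeo M A q
    unfolding q_def by (rule local_diffeo_compose[OF p.local_diffeo_axioms DD(3) injF])
  have chain: "fd (cmap c \<circ> q) y v = fd (cmap c \<circ> p) (F y) (fd F y v)" if "c \<in> A" "q y \<in> cdom c" for c y v
    using fd_compose[OF DD(7) p.der_chart[OF that(1)], of y v] that by (simp add: q_def o_def)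
  have euclid: "q.pullback_metric g y u v = u \<bullet> v" for y u v
  proof -
    obtain c where c: "c \<in> A" "q y \<in> cdom c" using q.chart_ex by blast
    have c': "p (F y) \<in> cdom c" using c by (simp add: q_def)
    have "q.pullback_metric g y u v = H (F y) (fd F y u) (fd F y v)"
      unfolding q.pullback_metric[OF g c] H_def p.pullback_metric[OF g c(1) c'] chain[OF c] by (simp add: q_def)
    also have "\<dots> = u \<bullet> v"
      using isometric_onD(3)[OF D UNIV_I, of "F y" "fd F y u" "fd F y v"] DD(9) by simp
    finally show ?thesis .
  qed
  define Z where "Z = q.pullback_field X"
  define a where "a = pullback_form A q \<alpha>"
  have smZ: "smooth_on UNIV Z" unfolding Z_def by (rule q.smooth_pullback_field[OF X])
  have sma: "smooth_on UNIV a" unfolding a_def by (rule q.smooth_pullback_form[OF \<alpha>])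
  have unit: "norm (Z y) = 1" for y
    using q.unit_pullback_field[OF g assms(6), of y] unfolding euclid Z_def[symmetric]
    by (simp add: norm_eq_sqrt_inner)
  have straight: "fd Z y (Z y) = 0" for y
    unfolding Z_def by (rule q.geodesic_pullback_straight[OF g assms(6) euclid])
  have ker: "ext_deriv a y (Z y) v = 0" and pos: "a y \<bullet> Z y > 0" for y v
    unfolding a_def Z_def using q.conformally_reeb_pullback[OF \<alpha> X assms(8)] by blast+
  have curl: "curl3 a y \<bullet> Z y \<noteq> 0" for y
  proof -
    obtain u v w where "wedge_ext_deriv a y u v w \<noteq> 0"
      using q.contact_pullback[OF assms(7)] unfolding a_def by blast
    then show ?thesis
      by (rule contact_curl_nonzero[OF smooth_on_linear_fd[OF sma UNIV_I] ker unit])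
  qed
  \<comment> \<open>On a ball in the cover, \<open>D \<circ> \<delta>\<close> and \<open>D\<close>
    are both isometric for \<open>H\<close>, so they differ by a rigid motion \<open>\<tau>\<close>.
    It satisfies \<open>q \<circ> \<tau> = q\<close> near the point in question and hence preserves
    the lifted field and form there.\<close>
  interpret cocompact_pair Z a "D ` K"
  proof
    show "smooth_on UNIV Z" "smooth_on UNIV a" by (rule smZ sma)+
    show "compact (D ` K)" by (rule compact_continuous_image[OF continuous_on_subset[OF smooth_on_continuous[OF DD(2)] subset_UNIV] K(1)])
    fix y
    obtain k where k: "k \<in> K" "p k = p (F y)" using K(2) by blast
    obtain W \<delta> where W: "open W" "k \<in> W" and \<delta>: "smooth_on W \<delta>" "\<delta> k = F y" "\<And>x. x \<in> W \<Longrightarrow> p x = p (\<delta> x)"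
      "\<And>x u v. x \<in> W \<Longrightarrow> H (\<delta> x) (fd \<delta> x u) (fd \<delta> x v) = H x u v"
      using decks[of k] k(2) by metis
    obtain r where r: "r > 0" "ball k r \<subseteq> W" using W openE by blast
    define B where "B = ball k r"
    have B: "open B" "connected B" "k \<in> B" "B \<subseteq> W" using r by (simp_all add: B_def)
    have "isometric_on H B (\<lambda>x. D (\<delta> x))"
      unfolding isometric_on_def
    proof (intro conjI ballI allI B)
      show "smooth_on B (\<lambda>x. D (\<delta> x))"
        by (rule smooth_on_compose[OF DD(2) smooth_on_subset[OF \<delta>(1) B(4)] B(1)]) auto
      fix x u v assume "x \<in> B"
      then have x: "x \<in> W" using B by blast
      have "fd (\<lambda>x. D (\<delta> x)) x w = fd D (\<delta> x) (fd \<delta> x w)" for w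
        by (rule fd_compose[OF smooth_on_has_derivative[OF \<delta>(1) x] DD(6)])
      then show "fd (\<lambda>x. D (\<delta> x)) x u \<bullet> fd (\<lambda>x. D (\<delta> x)) x v = H x u v"
        using isometric_onD(3)[OF D UNIV_I] \<delta>(4)[OF x] by simp
    qed
    then obtain \<tau> where "rigid \<tau>" and \<tau>: "\<And>x. x \<in> B \<Longrightarrow> D (\<delta> x) = \<tau> (D x)"
      using rigidity[OF isometric_on_subset[OF D B(1) subset_UNIV] _ B(2)] H.pos by blast
    then obtain Q b where Q: "orthogonal_transformation Q" and \<tau>Q: "\<tau> = (\<lambda>x. Q x + b)" by (auto simp: rigid_def)
    define V where "V = F -` B"
    have V: "open V" unfolding V_def by (rule open_vimage[OF B(1) smooth_on_continuous[OF DD(3)]])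
    have q\<tau>: "q (\<tau> w) = q w" if "w \<in> V" for w
    proof -
      have w: "F w \<in> B" using that by (simp add: V_def)
      have "\<tau> w = D (\<delta> (F w))" using \<tau>[OF w] DD(5) by simp
      then show ?thesis using \<delta>(3)[of "F w"] w B(4) DD(4) by (auto simp: q_def)
    qed
    have bl: "bounded_linear Q" using Q orthogonal_transformation_linear linear_conv_bounded_linear by blast
    have sm\<tau>: "smooth_on V \<tau>"
      unfolding \<tau>Q by (intro smooth_on_add V smooth_on_linear orthogonal_transformation_linear[OF Q] smooth_on_const)
    have d\<tau>: "fd \<tau> w v = Q v" for w v
    proof (rule fd_eqI)
      have "((\<lambda>x. Q x + b) has_derivative (\<lambda>v. Q v + 0)) (at w)"
        by (intro has_derivative_add bounded_linear.has_derivative[OF bl has_derivative_ident] has_derivative_const)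
      then show "(\<tau> has_derivative Q) (at w)" by (simp add: \<tau>Q)
    qed
    have "Z (Q w + b) = Q (Z w) \<and> a (Q w + b) = Q (a w)" if w: "w \<in> V" for w
    proof
      show "Z (Q w + b) = Q (Z w)"
        using q.deck_field[OF V sm\<tau> q\<tau> w X] unfolding d\<tau> Z_def by (simp add: \<tau>Q)
      \<comment> \<open>A form transforms by duality; since \<open>Q\<close> is orthogonal and onto,
        this becomes the same law as for the field.\<close>
      have "a (\<tau> w) \<bullet> Q v = a w \<bullet> v" for v
        using q.deck_form[OF V sm\<tau> q\<tau> w \<alpha>, of v] unfolding d\<tau> a_def .
      then have "(a (\<tau> w) - Q (a w)) \<bullet> Q v = 0" for v
        using Q by (simp add: inner_diff_left orthogonal_transformation_def)
      moreover obtain v where "Q v = a (\<tau> w) - Q (a w)" using orthogonal_transformation_surj[OF Q] by (metis surjD)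
      ultimately have "(a (\<tau> w) - Q (a w)) \<bullet> (a (\<tau> w) - Q (a w)) = 0" by metis
      then show "a (Q w + b) = Q (a w)" by (simp add: \<tau>Q)
    qed
    moreover have "D k \<in> V" using B(3) by (simp add: V_def DD(4))
    moreover have "Q (D k) + b = y" using \<tau>[OF B(3)] by (simp add: \<delta>(2) DD(5) \<tau>Q)
    ultimately show "\<exists>z\<in>D ` K. \<exists>Q b W. orthogonal_transformation Q \<and> open W \<and> z \<in> W \<and> Q z + b = y \<and>
        (\<forall>w\<in>W. Z (Q w + b) = Q (Z w) \<and> a (Q w + b) = Q (a w))"
      using Q V k(1) by blast
  qed
  obtain L where L: "\<And>y v. norm (fd Z y v) \<le> L * norm v" using fd_bound by blast
  obtain L2 where L2: "\<And>y u v. norm (fd (\<lambda>w. fd Z w u) y v) \<le> L2 * norm u * norm v" using fd2_bound by blast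
  obtain c where c: "c > 0" "\<And>y. c \<le> a y \<bullet> Z y" using inner_bound[OF pos] by blast
  obtain m C where m: "m > 0" "\<And>y. m \<le> \<bar>curl3 a y \<bullet> Z y\<bar>" "\<And>y. \<bar>curl3 a y \<bullet> Z y\<bar> \<le> C"
    using curl_bound[OF curl] by blast
  interpret reeb_line_field Z L L2 a c m C
    by unfold_locales (rule smZ sma unit straight ker L L2 c m)+
  obtain f where f: "diffeomorphism f" "\<And>y v. std_contact_form (f y) \<bullet> fd f y v = a y \<bullet> v" using darboux by blast
  note ff = diffeomorphismD[OF f(1)]
  \<comment> \<open>The map \<open>f\<close> belongs to the form as read in Euclidean coordinates;
    composition with \<open>D\<close> returns to the original lift by \<open>p\<close>.\<close>
  show ?thesis
  proof (rule diffeomorphic_structures_pullback[OF diffeomorphism_compose[OF f(1) diffD]])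
    fix x v
    obtain e where e: "e \<in> A" "p x \<in> cdom e" using p.chart_ex by blast
    have e': "q (D x) \<in> cdom e" using e by (simp add: q_def DD(4))
    have "fd (f \<circ> D) x v = fd f (D x) (fd D x v)"
      using fd_compose[OF DD(6) ff(6)] by (simp add: o_def)
    then have "std_contact_form ((f \<circ> D) x) \<bullet> fd (f \<circ> D) x v = a (D x) \<bullet> fd D x v" using f(2) by simp
    also have "\<dots> = pullback_form A p \<alpha> x \<bullet> v"
      unfolding a_def q.pullback_form[OF \<alpha> e(1) e'] p.pullback_form[OF \<alpha> e] chain[OF e(1) e']
      by (simp add: q_def DD(4,8))
    finally show "std_contact_form ((f \<circ> D) x) \<bullet> fd (f \<circ> D) x v = pullback_form A p \<alpha> x \<bullet> v" .
  qed
qed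

end
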